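(* Let $m,n$ be positive integers. Let $\Gamma^{(m,n)}_{[2]}$ be the subgroup of $\Gamma^{(m,n)}$ generated by the elements $$(S,(0,0)),\qquad (T_*,(0,s))\qquad\text{and}\qquad (I_2,(\lambda_0,\mu_0)),$$ where $S=\begin{pmatrix}0&-1\\1&0\end{pmatrix}$, $T_*=\begin{pmatrix}1&2\\0&1\end{pmatrix}$ and $s,\lambda_0,\mu_0$ range over $\mathbb{Z}^{(m,n)}$. Let $\mathcal{M}=(\mathcal{M}_{kl})$ be a positive definite symmetric unimodular integral $m\times m$ matrix such that $\mathcal{M}\,\mathbb{Z}^{(m,n)}=\mathbb{Z}^{(m,n)}$. Then for $f,g\in\mathscr{S}(\mathbb{R}^{(m,n)})$, the function $$\Theta_f^{[\mathcal{M}]}(\tau,\phi;\lambda,\mu)\,\overline{\Theta_g^{[\mathcal{M}]}(\tau,\phi;\lambda,\mu)}$$ is invariant under the (left) action of $\Gamma^{(m,n)}_{[2]}$ on $G^{(m,n)}$.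
   Context: Notation: $F^{(k,l)}$ is the set of $k\times l$ matrices over $F$; ${}^tA$ is the transpose; $\sigma(A)$ is the trace of a square matrix $A$; $i=\sqrt{-1}$; $\mathbb{H}_1=\{\tau=u+iv\in\mathbb{C}: v>0\}$; $\mathscr{S}$ denotes the Schwartz space; $\arg$ of a point of $\mathbb{H}_1$ lies in $(0,\pi)$. For $x,y\in\mathbb{R}^{(m,n)}$ put $(x,y)_{\mathcal{M}}=\sigma({}^tx\mathcal{M}y)$ and $\|x\|_{\mathcal{M}}=\sqrt{(x,x)_{\mathcal{M}}}$. Coordinates on $SL(2,\mathbb{R})$: each element is uniquely $$(\tau,\phi):=\begin{pmatrix}1&u\\0&1\end{pmatrix}\begin{pmatrix}v^{1/2}&0\\0&v^{-1/2}\end{pmatrix}\begin{pmatrix}\cos\phi&-\sin\phi\\ \sin\phi&\cos\phi\end{pmatrix},\quad \tau=u+iv\in\mathbb{H}_1,\ \phi\in[0,2\pi),$$ with $\phi$ read modulo $2\pi$. Group: $G^{(m,n)}=SL(2,\mathbb{R})\ltimes(\mathbb{R}^{(m,n)}\times\mathbb{R}^{(m,n)})$ with multiplication $(g_1,(\lambda_1,\mu_1))\cdot(g_2,(\lambda_2,\mu_2))=(g_1g_2,(\lambda_1,\mu_1)g_2+(\lambda_2,\mu_2))$, where $(\lambda,\mu)\begin{pmatrix}a&b\\c&d\end{pmatrix}=(a\lambda+c\mu,\,b\lambda+d\mu)$. Let $\Gamma^{(m,n)}=SL(2,\mathbb{Z})\ltimes(\mathbb{Z}^{(m,n)}\times\mathbb{Z}^{(m,n)})\subset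 G^{(m,n)}$, acting on $G^{(m,n)}$ by left multiplication. Coordinates on $G^{(m,n)}$: the coordinates $((\tau,\phi),(\lambda,\mu))$ denote the group element $(I_2,(\lambda,\mu))\cdot((\tau,\phi),(0,0))$, and functions of $(\tau,\phi;\lambda,\mu)$ are regarded as functions on $G^{(m,n)}$ in this way. In these coordinates the left actions of the generators $(S,(0,0))$, $(T_*,(0,s))$, $(I_2,(\lambda_0,\mu_0))$ are respectively $$((\tau,\phi),(\lambda,\mu))\mapsto\left(\left(-\tfrac1\tau,\phi+\arg\tau\right),(-\mu,\lambda)\right),$$ $$((\tau,\phi),(\lambda,\mu))\mapsto((\tau+2,\phi),(\lambda,s-2\lambda+\mu)),$$ $$((\tau,\phi),(\lambda,\mu))\mapsto((\tau,\phi),(\lambda+\lambda_0,\mu+\mu_0)).$$ Theta sum: for $f\in\mathscr{S}(\mathbb{R}^{(m,n)})$, $$\Theta_f^{[\mathcal{M}]}(\tau,\phi;\lambda,\mu)=v^{\frac{mn}4}\sum_{\omega\in\mathbb{Z}^{(m,n)}}e^{\pi i\{u\|\omega+\lambda\|_{\mathcal{M}}^2+2(\omega,\mu)_{\mathcal{M}}\}}\,[R_{\mathcal{M}}(i,\phi)f]\left(v^{1/2}(\omega+\lambda)\right),$$ where $[R_{\mathcal{M}}(i,\phi)f](x)$ equals $f(x)$ if $\phi\equiv0\bmod 2\pi$, equals $f(-x)$ if $\phi\equiv\pi\bmod2\pi$, and otherwise equals $$(\det\mathcal{M})^{\frac n2}|\sin\phi|^{-\frac{mn}2}\int_{\mathbb{R}^{(m,n)}}\exp\left(\pi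 i\,\frac{(\|x\|_{\mathcal{M}}^2+\|y\|_{\mathcal{M}}^2)\cos\phi-2(x,y)_{\mathcal{M}}}{\sin\phi}\right)f(y)\,dy.$$ *)

theory Defs
  imports "HOL-Analysis.Analysis" "HOL-Algebra.Generated_Groups" "HOL-Library.Real_Mod"
begin

text \<open>Iterated partial derivatives along a list of basis vectors. A function all of whose iterated
  partial derivatives are (Frechet) differentiable everywhere is exactly a smooth function.\<close>

fun iter_partial ::
  "'a list \<Rightarrow> ('a::euclidean_space \<Rightarrow> 'b::real_normed_vector) \<Rightarrow> 'a \<Rightarrow> 'b" where
  "iter_partial [] f = f"
| "iter_partial (b # bs) f = (\<lambda>x. frechet_derivative (iter_partial bs f) (at x) b)"

definition schwartz :: "('a::euclidean_space \<Rightarrow> 'b::real_normed_vector) \<Rightarrow> bool" where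
  "schwartz f \<longleftrightarrow> (\<forall>bs \<in> lists Basis.
     (\<forall>x. iter_partial bs f differentiable at x) \<and>
     (\<forall>k::nat. bounded (range (\<lambda>x. norm x ^ k *\<^sub>R iter_partial bs f x))))"

text \<open>The space of \<open>m \<times> n\<close> real matrices is \<^typ>\<open>real^'n^'m\<close> (\<open>'m\<close> indexes the rows).\<close>

definition integral_matrices :: "(real^'n^'m) set" where
  "integral_matrices = {A. \<forall>i j. A $ i $ j \<in> \<int>}"

definition positive_definite :: "real^'m^'m \<Rightarrow> bool" where
  "positive_definite M \<longleftrightarrow> (\<forall>x. x \<noteq> 0 \<longrightarrow> x \<bullet> (M *v x) > 0)"

definition unimodular :: "real^'m^'m \<Rightarrow> bool" where
  "unimodular M \<longleftrightarrow> \<bar>det M\<bar> = 1"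

definition inner_M :: "real^'m^'m \<Rightarrow> real^'n^'m \<Rightarrow> real^'n^'m \<Rightarrow> real" where
  "inner_M M x y = trace (transpose x ** M ** y)"

definition norm_M :: "real^'m^'m \<Rightarrow> real^'n^'m \<Rightarrow> real" where
  "norm_M M x = sqrt (inner_M M x x)"

abbreviation mat2 :: "real \<Rightarrow> real \<Rightarrow> real \<Rightarrow> real \<Rightarrow> real^2^2" where
  "mat2 a b c d \<equiv> vector [vector [a, b], vector [c, d]]"

definition right_act ::
  "((real^'n^'m) \<times> (real^'n^'m)) \<Rightarrow> real^2^2 \<Rightarrow> ((real^'n^'m) \<times> (real^'n^'m))" where
  "right_act p g = (case p of (l, mu) \<Rightarrow>
     (g$1$1 *\<^sub>R l + g$2$1 *\<^sub>R mu, g$1$2 *\<^sub>R l + g$2$2 *\<^sub>R mu))"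

type_synonym ('m, 'n) jacobi = "(real^2^2) \<times> (real^'n^'m) \<times> (real^'n^'m)"

definition jacobi_group :: "('m::finite, 'n::finite) jacobi monoid" where
  "jacobi_group =
     \<lparr>carrier = {(g, p). det g = 1},
      mult = (\<lambda>(g1, p1) (g2, p2). (g1 ** g2, right_act p1 g2 + p2)),
      one = (mat 1, (0, 0))\<rparr>"

definition jacobi_Gamma :: "('m::finite, 'n::finite) jacobi set" where
  "jacobi_Gamma = {(g, (l, mu)). det g = 1 \<and> g \<in> integral_matrices \<and>
                          l \<in> integral_matrices \<and> mu \<in> integral_matrices}"

definition jacobi_Gamma2 :: "('m::finite, 'n::finite) jacobi set" where
  "jacobi_Gamma2 = generate (jacobi_group\<lparr>carrier := jacobi_Gamma\<rparr>)
     ({(mat2 0 (-1) 1 0, (0, 0))}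
      \<union> {(mat2 1 2 0 1, (0, s)) | s. s \<in> integral_matrices}
      \<union> {(mat 1, (l0, mu0)) | l0 mu0. l0 \<in> integral_matrices \<and> mu0 \<in> integral_matrices})"

definition sl2_coord :: "complex \<Rightarrow> real \<Rightarrow> real^2^2" where
  "sl2_coord \<tau> \<phi> =
     mat2 1 (Re \<tau>) 0 1
     ** mat2 (Im \<tau> powr (1/2)) 0 0 (Im \<tau> powr (-1/2))
     ** mat2 (cos \<phi>) (- sin \<phi>) (sin \<phi>) (cos \<phi>)"

definition jacobi_coord ::
  "complex \<times> real \<times> (real^'n^'m) \<times> (real^'n^'m) \<Rightarrow> ('m::finite, 'n::finite) jacobi" where
  "jacobi_coord = (\<lambda>(\<tau>, \<phi>, l, mu).
     (mat 1, (l, mu)) \<otimes>\<^bsub>jacobi_group\<^esub> (sl2_coord \<tau> \<phi>, (0, 0)))"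

definition coord_domain :: "(complex \<times> real \<times> (real^'n^'m) \<times> (real^'n^'m)) set" where
  "coord_domain = {\<tau>. Im \<tau> > 0} \<times> {0..<2*pi} \<times> UNIV \<times> UNIV"

text \<open>The function on the group given by a function of the coordinates; see
  \<open>bij_betw_jacobi_coord\<close> below.\<close>

definition on_group ::
  "(complex \<Rightarrow> real \<Rightarrow> real^'n^'m \<Rightarrow> real^'n^'m \<Rightarrow> complex)
     \<Rightarrow> ('m::finite, 'n::finite) jacobi \<Rightarrow> complex" where
  "on_group F h = (case inv_into coord_domain jacobi_coord h of (\<tau>, \<phi>, l, mu) \<Rightarrow> F \<tau> \<phi> l mu)"

text \<open>\<open>weil_R M \<phi>\<close> is the operator \<open>R\<^sub>M(i, \<phi>)\<close>.\<close>

definition weil_R ::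
  "real^'m^'m \<Rightarrow> real \<Rightarrow> (real^'n^'m \<Rightarrow> complex) \<Rightarrow> real^'n^'m \<Rightarrow> complex" where
  "weil_R M \<phi> f x =
     (if [\<phi> = 0] (rmod (2*pi)) then f x
      else if [\<phi> = pi] (rmod (2*pi)) then f (- x)
      else of_real (det M powr (real CARD('n) / 2)
                    * \<bar>sin \<phi>\<bar> powr (- (real CARD('m) * real CARD('n) / 2)))
           * (LINT y|lborel.
                exp (pi * \<i> * of_real ((((norm_M M x)\<^sup>2 + (norm_M M y)\<^sup>2) * cos \<phi>
                                          - 2 * inner_M M x y) / sin \<phi>)) * f y))"

definition theta_sum ::
  "real^'m^'m \<Rightarrow> (real^'n^'m \<Rightarrow> complex)
     \<Rightarrow> complex \<Rightarrow> real \<Rightarrow> real^'n^'m \<Rightarrow> real^'n^'m \<Rightarrow> complex" where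
  "theta_sum M f \<tau> \<phi> l mu =
     of_real (Im \<tau> powr (real CARD('m) * real CARD('n) / 4))
     * (\<Sum>\<^sub>\<infinity>\<omega>\<in>integral_matrices.
          exp (pi * \<i> * of_real (Re \<tau> * (norm_M M (\<omega> + l))\<^sup>2 + 2 * inner_M M \<omega> mu))
          * weil_R M \<phi> f ((Im \<tau> powr (1/2)) *\<^sub>R (\<omega> + l)))"

lemma mat2_nth [simp]:
  "mat2 a b c d $ 1 $ 1 = a" "mat2 a b c d $ 1 $ 2 = b"
  "mat2 a b c d $ 2 $ 1 = c" "mat2 a b c d $ 2 $ 2 = d"
  by (simp_all add: vector_2)

lemma mat2_eq_iff: "(A::real^2^2) = B \<longleftrightarrow>
    A$1$1 = B$1$1 \<and> A$1$2 = B$1$2 \<and> A$2$1 = B$2$1 \<and> A$2$2 = B$2$2"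
  by (auto simp: vec_eq_iff forall_2)

lemma right_act_mult: "right_act (right_act p g) h = right_act p (g ** h)"
  by (cases p) (simp add: right_act_def matrix_matrix_mult_def sum_2 algebra_simps)

lemma right_act_one [simp]: "right_act p (mat 1) = p"
  by (cases p) (simp add: right_act_def mat_def)

lemma right_act_add: "right_act (p + q) g = right_act p g + right_act q g"
  by (cases p; cases q) (simp add: right_act_def algebra_simps)

lemma right_act_zero [simp]: "right_act (0, 0) g = 0" "right_act 0 g = 0"
  by (simp_all add: right_act_def zero_prod_def)

lemma group_jacobi_group: "group (jacobi_group :: ('m::finite, 'n::finite) jacobi monoid)"
proof (rule groupI)
  fix x :: "('m, 'n) jacobi" assume x: "x \<in> carrier jacobi_group"
  obtain g p where [simp]: "x = (g, p)" by (cases x)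
  have d: "det g = 1" using x by (simp add: jacobi_group_def)
  then have "invertible g" by (simp add: invertible_det_nz)
  then obtain h where h: "h ** g = mat 1" by (auto simp: invertible_def)
  have "det h = 1" using arg_cong[OF h, of det] d by (simp add: det_mul)
  then show "\<exists>y\<in>carrier jacobi_group. y \<otimes>\<^bsub>jacobi_group\<^esub> x = \<one>\<^bsub>jacobi_group\<^esub>"
    using h by (intro bexI[of _ "(h, right_act (- p) h)"])
      (auto simp: jacobi_group_def right_act_mult simp flip: zero_prod_def)
qed (auto simp: jacobi_group_def det_mul right_act_mult right_act_add matrix_mul_assoc add_ac
       simp flip: zero_prod_def)

lemma subgroup_jacobi_Gamma: "subgroup jacobi_Gamma (jacobi_group :: ('m::finite, 'n::finite) jacobi monoid)"
proof (rule group.subgroupI[OF group_jacobi_group])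
  show "jacobi_Gamma \<subseteq> carrier (jacobi_group :: ('m, 'n) jacobi monoid)"
    by (auto simp: jacobi_Gamma_def jacobi_group_def)
  have "(mat 1, 0, 0) \<in> (jacobi_Gamma :: ('m, 'n) jacobi set)"
    using det_I[where 'a=real and 'n=2] by (auto simp: jacobi_Gamma_def integral_matrices_def) (simp add: mat_def)
  then show "(jacobi_Gamma :: ('m, 'n) jacobi set) \<noteq> {}" by blast
next
  fix x y :: "('m, 'n) jacobi" assume "x \<in> jacobi_Gamma" "y \<in> jacobi_Gamma"
  then show "x \<otimes>\<^bsub>jacobi_group\<^esub> y \<in> jacobi_Gamma"
    using det_mul[of "fst x" "fst y"]
    by (auto simp: jacobi_Gamma_def jacobi_group_def integral_matrices_def right_act_def
        matrix_matrix_mult_def intro!: Ints_add Ints_mult Ints_sum)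
next
  fix x :: "('m, 'n) jacobi" assume x: "x \<in> jacobi_Gamma"
  obtain g l mu where xe [simp]: "x = (g, (l, mu))" by (cases x)
  have d: "g$1$1 * g$2$2 - g$1$2 * g$2$1 = 1" using x by (simp add: jacobi_Gamma_def det_2)
  define h where "h = mat2 (g$2$2) (- g$1$2) (- g$2$1) (g$1$1)"
  define y where "y = (h, right_act (- (l, mu)) h)"
  have hg: "h ** g = mat 1"
    using d by (simp add: h_def mat2_eq_iff matrix_matrix_mult_def sum_2 mat_def algebra_simps)
  have hd: "det h = 1" using d by (simp add: h_def det_2 algebra_simps)
  have "y \<otimes>\<^bsub>jacobi_group\<^esub> x = \<one>\<^bsub>jacobi_group\<^esub>"
    using hg by (auto simp: y_def jacobi_group_def right_act_mult simp flip: zero_prod_def)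
  then have "inv\<^bsub>jacobi_group\<^esub> x = y"
    using x hd by (intro group.inv_equality[OF group_jacobi_group])
      (auto simp: jacobi_group_def y_def jacobi_Gamma_def)
  moreover have "y \<in> jacobi_Gamma"
    using x hd by (auto simp: y_def jacobi_Gamma_def integral_matrices_def h_def right_act_def forall_2
        intro!: Ints_add Ints_mult Ints_minus Ints_diff)
  ultimately show "inv\<^bsub>jacobi_group\<^esub> x \<in> jacobi_Gamma" by simp
qed

lemma sl2_coord_nth:
  "sl2_coord \<tau> \<phi> $ 2 $ 1 = Im \<tau> powr (-1/2) * sin \<phi>"
  "sl2_coord \<tau> \<phi> $ 2 $ 2 = Im \<tau> powr (-1/2) * cos \<phi>"
  "sl2_coord \<tau> \<phi> $ 1 $ 1 = Im \<tau> powr (1/2) * cos \<phi> + Re \<tau> * (Im \<tau> powr (-1/2) * sin \<phi>)"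
  "sl2_coord \<tau> \<phi> $ 1 $ 2 = - (Im \<tau> powr (1/2) * sin \<phi>) + Re \<tau> * (Im \<tau> powr (-1/2) * cos \<phi>)"
  by (simp_all add: sl2_coord_def matrix_matrix_mult_def sum_2)

lemma det_sl2_coord: "Im \<tau> > 0 \<Longrightarrow> det (sl2_coord \<tau> \<phi>) = 1"
  unfolding sl2_coord_def det_mul by (simp add: det_2 flip: powr_add power2_eq_square)

lemma sl2_coord_inj:
  assumes "Im \<tau> > 0" "Im \<tau>' > 0" "\<phi> \<in> {0..<2*pi}" "\<phi>' \<in> {0..<2*pi}"
    and eq: "sl2_coord \<tau> \<phi> = sl2_coord \<tau>' \<phi>'"
  shows "\<tau> = \<tau>' \<and> \<phi> = \<phi>'"
proof -
  define w w' where "w = Im \<tau> powr (-1/2)" and "w' = Im \<tau>' powr (-1/2)"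
  have pos: "w > 0" "w' > 0" using assms by (auto simp: w_def w'_def)
  have e: "w * sin \<phi> = w' * sin \<phi>'" "w * cos \<phi> = w' * cos \<phi>'"
    using arg_cong[OF eq, of "\<lambda>A. A$2$1"] arg_cong[OF eq, of "\<lambda>A. A$2$2"]
    by (simp_all add: sl2_coord_nth w_def w'_def)
  have "(w * sin \<phi>)\<^sup>2 + (w * cos \<phi>)\<^sup>2 = w\<^sup>2" "(w' * sin \<phi>')\<^sup>2 + (w' * cos \<phi>')\<^sup>2 = w'\<^sup>2"
    by (simp_all add: power_mult_distrib flip: distrib_left)
  then have "w\<^sup>2 = w'\<^sup>2" using e by simp
  then have ww: "w = w'" using pos by (simp add: power2_eq_iff)
  have "w powr -2 = Im \<tau>" "w' powr -2 = Im \<tau>'"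
    using assms(1,2) by (simp_all add: w_def w'_def powr_powr)
  then have im: "Im \<tau> = Im \<tau>'" using ww by simp
  have sc: "sin \<phi> = sin \<phi>'" "cos \<phi> = cos \<phi>'" using e ww pos by auto
  then obtain k :: int where k: "\<phi> = \<phi>' + 2 * pi * k"
    using sin_cos_eq_iff[of \<phi> \<phi>'] by auto
  have "2 * pi * real_of_int k < 2 * pi * 1" "2 * pi * (-1) < 2 * pi * real_of_int k"
    using k assms(3,4) unfolding atLeastLessThan_iff by linarith+
  then have "real_of_int k < 1" "-1 < real_of_int k"
    by (auto intro: mult_left_less_imp_less[of "2 * pi"])
  then have ph: "\<phi> = \<phi>'" using k by simp
  have "Re \<tau> * (w * sin \<phi>) = Re \<tau>' * (w * sin \<phi>)" "Re \<tau> * (w * cos \<phi>) = Re \<tau>' * (w * cos \<phi>)"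
    using arg_cong[OF eq, of "\<lambda>A. A$1$1"] arg_cong[OF eq, of "\<lambda>A. A$1$2"] im ph
    by (simp_all add: sl2_coord_nth w_def)
  then have "Re \<tau> = Re \<tau>'" using pos sin_zero_abs_cos_one[of \<phi>] by auto
  then show ?thesis using im ph by (simp add: complex_eq_iff)
qed

lemma sl2_coord_surj:
  assumes "det (g::real^2^2) = 1"
  obtains \<tau> \<phi> where "Im \<tau> > 0" "\<phi> \<in> {0..<2*pi}" "sl2_coord \<tau> \<phi> = g"
proof -
  define a b c d where "a = g$1$1" and "b = g$1$2" and "c = g$2$1" and "d = g$2$2"
  have det: "a * d - b * c = 1" using assms by (simp add: det_2 a_def b_def c_def d_def)
  define r where "r = c\<^sup>2 + d\<^sup>2"
  have r: "r > 0" using det unfolding r_def by (metis sum_power2_gt_zero_iff mult_zero_right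
      diff_zero zero_neq_one)
  define s where "s = sqrt r"
  have s: "s > 0" "s\<^sup>2 = r" using r by (simp_all add: s_def)
  have "(d / s)\<^sup>2 + (c / s)\<^sup>2 = 1"
    using r unfolding power_divide s(2)
    by (simp only: r_def add.commute[of "d\<^sup>2"] divide_self flip: add_divide_distrib)
  then obtain \<phi> where \<phi>: "0 \<le> \<phi>" "\<phi> < 2*pi" "d / s = cos \<phi>" "c / s = sin \<phi>"
    using sincos_total_2pi by metis
  define \<tau> where "\<tau> = Complex ((a*c + b*d) / r) (1 / r)"
  have p1: "Im \<tau> powr (-1/2) = s" "Im \<tau> powr (1/2) = 1 / s"
    using r by (simp_all add: \<tau>_def s_def powr_minus powr_half_sqrt real_sqrt_divide powr_divide)
  have cs: "c = s * sin \<phi>" "d = s * cos \<phi>" using \<phi> s by (auto simp: field_simps)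
  have "sl2_coord \<tau> \<phi> $ 2 $ 1 = c" "sl2_coord \<tau> \<phi> $ 2 $ 2 = d"
    using cs by (simp_all only: sl2_coord_nth p1)
  moreover have "sl2_coord \<tau> \<phi> $ 1 $ 1 = (d + (a*c + b*d) * c) / r"
    using s unfolding sl2_coord_nth p1 \<phi>(3,4)[symmetric]
    by (simp add: \<tau>_def power2_eq_square flip: add_divide_distrib)
  moreover have "sl2_coord \<tau> \<phi> $ 1 $ 2 = (- c + (a*c + b*d) * d) / r"
    using s unfolding sl2_coord_nth p1 \<phi>(3,4)[symmetric]
    by (simp add: \<tau>_def power2_eq_square minus_divide_left flip: add_divide_distrib
        del: divide_minus_left)
  moreover have "d + (a*c + b*d) * c = a * r" "- c + (a*c + b*d) * d = b * r"
    using det unfolding r_def by algebra+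
  ultimately have "sl2_coord \<tau> \<phi> = g"
    using r by (simp add: mat2_eq_iff a_def b_def c_def d_def)
  moreover have "Im \<tau> > 0" using r by (simp add: \<tau>_def)
  ultimately show ?thesis using that \<phi> by auto
qed

lemma bij_betw_jacobi_coord:
  "bij_betw jacobi_coord coord_domain
     (carrier (jacobi_group :: ('m::finite, 'n::finite) jacobi monoid))"
proof -
  have eq: "jacobi_coord (\<tau>, \<phi>, l, mu) = (sl2_coord \<tau> \<phi>, right_act (l, mu) (sl2_coord \<tau> \<phi>))"
    for \<tau> \<phi> and l mu :: "real^'n^'m"
    by (simp add: jacobi_coord_def jacobi_group_def flip: zero_prod_def)
  have inv: "\<exists>h. g ** h = mat 1 \<and> h ** g = mat 1" if "det g = 1" for g :: "real^2^2"
    using that invertible_det_nz[of g] by (auto simp: invertible_def)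
  show ?thesis unfolding bij_betw_def
  proof
    show "inj_on jacobi_coord (coord_domain :: (_ \<times> _ \<times> (real^'n^'m) \<times> _) set)"
    proof (rule inj_onI)
      fix x y :: "complex \<times> real \<times> (real^'n^'m) \<times> (real^'n^'m)"
      assume x: "x \<in> coord_domain" and y: "y \<in> coord_domain" and e: "jacobi_coord x = jacobi_coord y"
      obtain \<tau> \<phi> p where [simp]: "x = (\<tau>, \<phi>, p)" by (cases x)
      obtain \<tau>' \<phi>' p' where [simp]: "y = (\<tau>', \<phi>', p')" by (cases y)
      have tp: "\<tau> = \<tau>' \<and> \<phi> = \<phi>'"
        using x y e eq
        by (cases p; cases p'; intro sl2_coord_inj) (auto simp: coord_domain_def)
      have "right_act p (sl2_coord \<tau> \<phi>) = right_act p' (sl2_coord \<tau> \<phi>)"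
        using e eq tp by (cases p; cases p') auto
      moreover obtain h where "sl2_coord \<tau> \<phi> ** h = mat 1"
        using inv[OF det_sl2_coord] x by (auto simp: coord_domain_def)
      ultimately have "p = p'" by (metis right_act_mult right_act_one)
      then show "x = y" using tp by simp
    qed
    show "jacobi_coord ` coord_domain = carrier (jacobi_group :: ('m, 'n) jacobi monoid)"
    proof
      show "jacobi_coord ` coord_domain \<subseteq> carrier (jacobi_group :: ('m, 'n) jacobi monoid)"
        by (auto simp: eq coord_domain_def jacobi_group_def det_sl2_coord)
      show "carrier (jacobi_group :: ('m, 'n) jacobi monoid) \<subseteq> jacobi_coord ` coord_domain"
      proof
        fix x :: "('m, 'n) jacobi" assume "x \<in> carrier jacobi_group"
        then obtain g p where x: "x = (g, p)" and d: "det g = 1" by (auto simp: jacobi_group_def)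
        obtain \<tau> \<phi> where t: "Im \<tau> > 0" "\<phi> \<in> {0..<2*pi}" "sl2_coord \<tau> \<phi> = g"
          using sl2_coord_surj[OF d] .
        obtain h where "h ** g = mat 1" using inv[OF d] by blast
        then have "right_act (right_act p h) g = p" by (simp add: right_act_mult)
        then have "jacobi_coord (\<tau>, \<phi>, right_act p h) = x"
          using t x eq[of \<tau> \<phi> "fst (right_act p h)" "snd (right_act p h)"] by simp
        moreover have "(\<tau>, \<phi>, right_act p h) \<in> coord_domain"
          using t by (cases "right_act p h") (simp add: coord_domain_def)
        ultimately show "x \<in> jacobi_coord ` coord_domain" by blast
      qed
    qed
  qed
qed

end

theory Submission
  imports Defs "HOL-Probability.Sinc_Integral"
begin

text \<open>Put \<open>B(x, y) = \<sigma>(\<^sup>tx M y)\<close>, let \<open>F\<close> be the Fourier transform with respect to \<open>B\<close> and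
  \<open>W(\<tau>) f(x) = v\<^bsup>mn/4\<^esup> exp(\<pi>i u B(x, x)) f(v\<^bsup>1/2\<^esup> x)\<close>, so that the theta sum is
  \<open>\<Sum>\<omega>. exp(2\<pi>i B(\<omega>, \<mu>)) [W(\<tau>) R(\<phi>) f](\<omega> + \<lambda>)\<close>. Under each generator it changes by a factor of modulus 1
  that does not depend on \<open>f\<close>, which cancels in the product. For translations the factor is read off from the
  integrality of \<open>B\<close>. For \<open>S\<close>, Poisson summation (the lattice is self-dual because \<open>M\<close> maps it onto itself) replaces
  \<open>W(\<tau>) R(\<phi>) f\<close> by its Fourier transform; a change of variables gives \<open>F W(\<tau>) = W(-1/\<tau>) R(arg \<tau>)\<close> exactly, and
  \<open>R(\<theta>) R(\<phi>)\<close> is a unimodular multiple of \<open>R(\<theta> + \<phi>)\<close>. The last fact reduces to the Fourier transform of a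
  Gaussian chirp, known up to a constant whose modulus follows from Plancherel; the exact (Maslov) phases are never
  needed.\<close>

section \<open>Decay on Euclidean space\<close>

text \<open>Schwartz regularity is not carried through the operators; two bounds are: a function and
  its transform are both \<open>decaying\<close>, that is, continuous and dominated by a product of
  factors 1 / (1 + t^2). Poisson summation and inversion ask for nothing else. To have these bounds
  at every angle, the products of Schwartz functions with chirps exp(pi i c B(x, x)) are treated as
  one class: parameters add, so the class is closed under chirps, and integration by parts controls
  all the transforms. Poisson summation rests on the fact that a continuous function on the cube
  whose Fourier coefficients vanish is zero at 0; one point is enough, because the formula is an
  identity of values at 0. The composition law has singular angles, where sine vanishes and the
  kernel degenerates. Only the outer angle \<open>Arg tau\<close> has to be regular, and it is so in
  the upper half plane; the inner angle and the sum may be singular, whence the cases in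
  \<open>weil_comp\<close>. The form is written as T x . y for an abstract linear map T, so that the
  analysis takes place on a Euclidean space and matrices enter only at the end.\<close>

definition int_lattice :: "'a::euclidean_space set" where
  "int_lattice = {x. \<forall>b\<in>Basis. x \<bullet> b \<in> \<int>}"

text \<open>The product over coordinates, rather than a power of the norm, makes integrals and
  lattice sums factor into one-dimensional ones.\<close>

definition decay :: "'a::euclidean_space \<Rightarrow> real" where
  "decay x = (\<Prod>b\<in>Basis. 1 / (1 + (x \<bullet> b)\<^sup>2))"

lemma one_plus_square_pos [simp]: "1 + (x::real)\<^sup>2 > 0"
  by (simp add: add_pos_nonneg)

lemma one_plus_square_neq_0 [simp]: "1 + (x::real)\<^sup>2 \<noteq> 0"
  by (metis less_irrefl one_plus_square_pos)

lemma decay_pos: "decay x > 0"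
  unfolding decay_def by (intro prod_pos) auto

lemma decay_nonneg: "decay x \<ge> 0"
  using decay_pos less_imp_le by blast

lemma continuous_on_decay [continuous_intros]:
  "continuous_on A f \<Longrightarrow> continuous_on A (\<lambda>x. decay (f x))"
  unfolding decay_def by (intro continuous_intros) auto

lemma borel_measurable_decay [measurable]: "decay \<in> borel_measurable borel"
  using continuous_on_decay[OF continuous_on_id, of UNIV] by (intro borel_measurable_continuous_onI) simp

text \<open>A Peetre-type inequality: a translation costs a factor that depends on the translation
  vector alone, with one 2 per coordinate.\<close>

lemma decay_add_le:
  fixes x y :: "'a::euclidean_space"
  shows "decay (x + y) \<le> 2 ^ DIM('a) * decay x / decay y"
proof -
  have "1 / (1 + (x + y)\<^sup>2) \<le> 2 * (1 / (1 + x\<^sup>2)) * (1 + y\<^sup>2)" for x y :: real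
  proof -
    \<comment> \<open>2 (1 + (x + y)^2) (1 + y^2) - (1 + x^2) equals 1 + (x + 2y)^2 + 2 (y (x +
      y))^2.\<close>
    have "0 \<le> (x + 2 * y)\<^sup>2" "0 \<le> (y * (x + y))\<^sup>2" by simp_all
    then have "1 + x\<^sup>2 \<le> 2 * ((1 + (x + y)\<^sup>2) * (1 + y\<^sup>2))"
      by (simp add: power2_eq_square algebra_simps)
    then show ?thesis
      by (simp add: pos_divide_le_eq pos_le_divide_eq algebra_simps)
  qed
  then have "decay (x + y) \<le> (\<Prod>b\<in>Basis. 2 * (1 / (1 + (x \<bullet> b)\<^sup>2)) * (1 + (y \<bullet> b)\<^sup>2))"
    unfolding decay_def by (intro prod_mono) (auto simp: inner_add_left)
  also have "\<dots> = 2 ^ DIM('a) * decay x / decay y"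
    unfolding decay_def prod.distrib prod_constant prod_dividef by simp
  finally show ?thesis .
qed

lemma decay_scaleR_le:
  assumes "a \<noteq> 0"
  obtains C where "\<And>x::'a::euclidean_space. decay (a *\<^sub>R x) \<le> C * decay x"
proof -
  have "1 / (1 + (a * t)\<^sup>2) \<le> (1 + 1 / a\<^sup>2) * (1 / (1 + t\<^sup>2))" for t
  proof -
    have "0 \<le> (1 / a\<^sup>2) + a\<^sup>2 * t\<^sup>2" by simp
    moreover have "1 / a\<^sup>2 * (a\<^sup>2 * t\<^sup>2) = t\<^sup>2" using assms by simp
    ultimately have "1 + t\<^sup>2 \<le> (1 + 1 / a\<^sup>2) * (1 + (a * t)\<^sup>2)"
      by (simp add: ring_distribs power_mult_distrib)
    then show ?thesis by (simp add: pos_divide_le_eq mult.commute pos_le_divide_eq)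
  qed
  then have "decay (a *\<^sub>R x) \<le> (\<Prod>b\<in>(Basis::'a set). (1 + 1 / a\<^sup>2) * (1 / (1 + (x \<bullet> b)\<^sup>2)))" for x :: 'a
    unfolding decay_def by (intro prod_mono) auto
  also have "\<dots> x = (1 + 1 / a\<^sup>2) ^ DIM('a) * decay x" for x :: 'a
    by (simp only: decay_def prod.distrib prod_constant)
  finally show ?thesis by (rule that)
qed

text \<open>Bridge from bounds by powers of the norm to bounds by \<open>decay\<close>. The product
  has one quadratic factor per coordinate, which explains the exponent; comparing the squared norm
  with 1 turns the power of a sum into a sum.\<close>

lemma decay_ge_norm:
  fixes x :: "'a::euclidean_space"
  shows "1 \<le> decay x * (2 ^ DIM('a) * (1 + norm x ^ (2 * DIM('a))))"
proof -
  have "(\<Prod>b\<in>(Basis::'a set). 1 + (x \<bullet> b)\<^sup>2) \<le> (\<Prod>b\<in>(Basis::'a set). 1 + (norm x)\<^sup>2)"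
    by (intro prod_mono) (auto simp: Basis_le_norm abs_le_square_iff[symmetric])
  also have "\<dots> = (1 + (norm x)\<^sup>2) ^ DIM('a)" by simp
  also have "\<dots> \<le> 2 ^ DIM('a) * (1 + norm x ^ (2 * DIM('a)))"
  proof (cases "(norm x)\<^sup>2 \<le> 1")
    case True
    then have "(1 + (norm x)\<^sup>2) ^ DIM('a) \<le> 2 ^ DIM('a)" by (intro power_mono) auto
    then show ?thesis by (simp add: ring_distribs add_increasing2)
  next
    case False
    then have "(1 + (norm x)\<^sup>2) ^ DIM('a) \<le> (2 * (norm x)\<^sup>2) ^ DIM('a)" by (intro power_mono) auto
    then show ?thesis by (simp add: ring_distribs power_mult_distrib power_mult add_increasing)
  qed
  finally have *: "(\<Prod>b\<in>(Basis::'a set). 1 + (x \<bullet> b)\<^sup>2) \<le> 2 ^ DIM('a) * (1 + norm x ^ (2 * DIM('a)))" .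
  have "1 = decay x * (\<Prod>b\<in>(Basis::'a set). 1 + (x \<bullet> b)\<^sup>2)"
    by (simp add: decay_def prod_dividef)
  also have "\<dots> \<le> decay x * (2 ^ DIM('a) * (1 + norm x ^ (2 * DIM('a))))"
    by (intro mult_left_mono * decay_nonneg)
  finally show ?thesis .
qed

lemma integrable_decay: "integrable lborel (decay :: 'a::euclidean_space \<Rightarrow> real)"
proof (rule integrableI_bounded)
  have "integrable lborel (\<lambda>t::real. 1 / (1 + t\<^sup>2))"
    using integrable_inverse_1_plus_square
    by (simp add: einterval_def set_integrable_def inverse_eq_divide)
  then have fin: "(\<integral>\<^sup>+t. ennreal (1 / (1 + t\<^sup>2)) \<partial>lborel) < \<infinity>"
    by (auto simp: integrable_iff_bounded)
  have "(\<integral>\<^sup>+x. ennreal (norm (decay (x::'a))) \<partial>lborel)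
      = (\<integral>\<^sup>+x. (\<Prod>b\<in>(Basis::'a set). ennreal (1 / (1 + (x \<bullet> b)\<^sup>2))) \<partial>lborel)"
    by (simp add: decay_nonneg) (simp add: decay_def prod_ennreal)
  also have "\<dots> = (\<Prod>b\<in>(Basis::'a set). (\<integral>\<^sup>+t. ennreal (1 / (1 + t\<^sup>2)) \<partial>lborel))"
    by (rule nn_integral_lborel_prod) auto
  also have "\<dots> < \<infinity>"
    using fin by (simp add: power_less_top_ennreal)
  finally show "(\<integral>\<^sup>+x. ennreal (norm (decay (x::'a))) \<partial>lborel) < \<infinity>" .
qed measurable

lemma summable_on_inverse_square_Ints: "(\<lambda>t::real. 1 / (1 + t\<^sup>2)) summable_on \<int>"
proof -
  have n: "(\<lambda>n::nat. 1 / (1 + (real n)\<^sup>2)) summable_on UNIV"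
  proof (subst summable_on_UNIV_nonneg_real_iff)
    have "summable (\<lambda>n. 1 / (real n)\<^sup>2)"
      using inverse_power_summable[of 2, where 'a=real] by (simp add: inverse_eq_divide)
    then show "summable (\<lambda>n::nat. 1 / (1 + (real n)\<^sup>2))"
    proof (rule summable_comparison_test_ev[rotated])
      show "\<forall>\<^sub>F n in sequentially. norm (1 / (1 + (real n)\<^sup>2)) \<le> 1 / (real n)\<^sup>2"
        using eventually_gt_at_top[of 0] by eventually_elim (auto simp: divide_simps)
    qed
  qed auto
  have 1: "(\<lambda>t::real. 1 / (1 + t\<^sup>2)) summable_on range real"
    using n by (subst summable_on_reindex) (auto simp: o_def inj_on_def)
  have 2: "(\<lambda>t::real. 1 / (1 + t\<^sup>2)) summable_on range (\<lambda>n. - real n)"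
    using n by (subst summable_on_reindex) (auto simp: o_def inj_on_def)
  have "(\<lambda>t::real. 1 / (1 + t\<^sup>2)) summable_on (range real \<union> range (\<lambda>n. - real n))"
    by (rule summable_on_union[OF 1 2])
  moreover have "\<int> = range real \<union> range (\<lambda>n. - real n)"
  proof (intro equalityI subsetI)
    fix t :: real assume "t \<in> \<int>"
    then obtain k :: int where "t = of_int k" by (auto elim: Ints_cases)
    then show "t \<in> range real \<union> range (\<lambda>n. - real n)" by (cases k rule: int_cases2) auto
  qed auto
  ultimately show ?thesis by simp
qed

lemma summable_on_decay: "decay summable_on (int_lattice :: 'a::euclidean_space set)"
proof -
  have "(\<lambda>t::real. norm (1 / (1 + t\<^sup>2))) summable_on \<int>"
    using summable_on_inverse_square_Ints by simp
  \<comment> \<open>A lattice point is the family of its integer coordinates, and over such families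
    the sum of products factors.\<close>
  then have "(\<lambda>g. norm (\<Prod>b\<in>(Basis::'a set). 1 / (1 + (g b)\<^sup>2))) summable_on (Basis \<rightarrow>\<^sub>E (\<int>::real set))"
    unfolding abs_summable_equivalent
    by (intro abs_summable_on_prod_PiE) (auto simp: countable_int Ints_def)
  then have s: "(\<lambda>g. \<Prod>b\<in>(Basis::'a set). 1 / (1 + (g b)\<^sup>2)) summable_on (Basis \<rightarrow>\<^sub>E (\<int>::real set))"
    by (rule abs_summable_summable)
  show ?thesis
  proof (subst summable_on_reindex_bij_witness[where
        i = "\<lambda>g. \<Sum>b\<in>Basis. g b *\<^sub>R b" and j = "\<lambda>x. restrict (\<lambda>b. x \<bullet> b) Basis"])
    show "(\<lambda>g. \<Prod>b\<in>(Basis::'a set). 1 / (1 + (g b)\<^sup>2)) summable_on (Basis \<rightarrow>\<^sub>E (\<int>::real set))"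
      by (rule s)
  qed (auto simp: int_lattice_def euclidean_representation decay_def inner_sum_left_Basis
        fun_eq_iff PiE_def extensional_def)
qed

lemma int_lattice_closed:
  "x \<in> int_lattice \<Longrightarrow> y \<in> int_lattice \<Longrightarrow> x + y \<in> int_lattice"
  "x \<in> int_lattice \<Longrightarrow> y \<in> int_lattice \<Longrightarrow> x - y \<in> int_lattice"
  "x \<in> int_lattice \<Longrightarrow> - x \<in> int_lattice"
  "0 \<in> int_lattice"
  by (auto simp: int_lattice_def inner_simps)

lemma inner_int_lattice: "x \<in> int_lattice \<Longrightarrow> y \<in> int_lattice \<Longrightarrow> x \<bullet> y \<in> \<int>"
  unfolding euclidean_inner[of x y] by (intro Ints_sum Ints_mult) (simp_all add: int_lattice_def)

text \<open>A summable family has countable support, and \<open>decay\<close> vanishes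
  nowhere.\<close>

lemma countable_int_lattice: "countable (int_lattice :: 'a::euclidean_space set)"
proof -
  have "(\<lambda>x. norm (decay x)) summable_on (int_lattice::'a set)"
    using summable_on_decay by (simp add: decay_nonneg)
  then have "countable {x \<in> (int_lattice::'a set). decay x \<noteq> 0}"
    by (rule abs_summable_countable)
  moreover have "decay x \<noteq> 0" for x :: 'a
    using decay_pos[of x] by linarith
  ultimately show ?thesis by simp
qed

lemma infinite_int_lattice: "infinite (int_lattice :: 'a::euclidean_space set)"
proof -
  obtain b :: 'a where b: "b \<in> Basis" using nonempty_Basis by blast
  have "inj (\<lambda>n::nat. real n *\<^sub>R b)" using b by (auto simp: inj_on_def)
  then have "infinite (range (\<lambda>n::nat. real n *\<^sub>R b))" by (simp add: finite_image_iff)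
  moreover have "range (\<lambda>n::nat. real n *\<^sub>R b) \<subseteq> int_lattice"
    using b by (auto simp: int_lattice_def inner_Basis)
  ultimately show ?thesis using finite_subset by blast
qed

text \<open>One majorant serves both integrals over the space and sums over the lattice. The class
  survives translation, dilation and bounded continuous multipliers, from which \<open>flow\<close>
  and the twisted sums are built.\<close>

definition decaying :: "('a::euclidean_space \<Rightarrow> complex) \<Rightarrow> bool" where
  "decaying u \<longleftrightarrow> continuous_on UNIV u \<and> (\<exists>C. \<forall>x. norm (u x) \<le> C * decay x)"

lemma decayingI:
  "continuous_on UNIV u \<Longrightarrow> (\<And>x. norm (u x) \<le> C * decay x) \<Longrightarrow> decaying u"
  by (auto simp: decaying_def)

lemma decaying_bound:
  assumes "decaying u"
  shows "\<exists>C\<ge>0. \<forall>x. norm (u x) \<le> C * decay x"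
proof -
  obtain C where C: "\<And>x. norm (u x) \<le> C * decay x"
    using assms by (auto simp: decaying_def)
  have "0 \<le> C * decay (0::'a)" by (rule order_trans[OF norm_ge_zero C])
  then have "C \<ge> 0" using decay_pos[of "0::'a"] by (simp add: zero_le_mult_iff)
  with C show ?thesis by blast
qed

lemma decaying_continuous: "decaying u \<Longrightarrow> continuous_on A u"
  by (auto simp: decaying_def intro: continuous_on_subset)

lemma decaying_measurable: "decaying u \<Longrightarrow> u \<in> borel_measurable borel"
  by (intro borel_measurable_continuous_onI decaying_continuous)

lemma decaying_integrable:
  assumes "decaying u"
  shows "integrable lborel u"
proof -
  obtain C where C: "C \<ge> 0" "\<And>x. norm (u x) \<le> C * decay x"
    using decaying_bound[OF assms(1)] by blast
  then show ?thesis
    using decaying_measurable[OF assms]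
    by (intro Bochner_Integration.integrable_bound[OF integrable_mult_right[OF integrable_decay, of C]])
       (auto simp: decay_nonneg)
qed

lemma decaying_mult_bounded:
  assumes "decaying u" "continuous_on UNIV w" "\<And>x. norm (w x) \<le> K"
  shows "decaying (\<lambda>x. w x * u x)"
proof -
  obtain C where C: "C \<ge> 0" "\<And>x. norm (u x) \<le> C * decay x"
    using decaying_bound[OF assms(1)] by blast
  have u: "continuous_on UNIV u" by (rule decaying_continuous[OF assms(1)])
  have "norm (w x) * norm (u x) \<le> K * (C * decay x)" for x
    using assms(3)[of x] C norm_ge_zero[of "w x"] order_trans[OF norm_ge_zero assms(3)[of x]]
    by (intro mult_mono) auto
  then show ?thesis
    using u assms(2) by (intro decayingI[where C = "K * C"])
      (auto intro!: continuous_intros simp: norm_mult mult.assoc)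
qed

lemma decaying_cmult: "decaying u \<Longrightarrow> decaying (\<lambda>x. c * u x)"
  by (rule decaying_mult_bounded[where w = "\<lambda>_. c" and K = "norm c"]) auto

lemma decaying_shift:
  assumes "decaying u"
  shows "decaying (\<lambda>x. u (x + a))"
proof -
  obtain C where C: "C \<ge> 0" "\<And>x. norm (u x) \<le> C * decay x"
    using decaying_bound[OF assms(1)] by blast
  have u: "continuous_on UNIV u" by (rule decaying_continuous[OF assms(1)])
  have "norm (u (x + a)) \<le> C * 2 ^ DIM('a) / decay a * decay x" for x
    using C(2)[of "x + a"] mult_left_mono[OF decay_add_le[of x a] C(1)] by (simp add: mult_ac)
  then show ?thesis
    using u by (intro decayingI[where C = "C * 2 ^ DIM('a) / decay a"])
      (auto intro!: continuous_intros continuous_on_compose2[OF u])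
qed

lemma decaying_scaleR:
  assumes "decaying u" "a \<noteq> 0"
  shows "decaying (\<lambda>x. u (a *\<^sub>R x))"
proof -
  obtain C where C: "C \<ge> 0" "\<And>x. norm (u x) \<le> C * decay x"
    using decaying_bound[OF assms(1)] by blast
  have u: "continuous_on UNIV u" by (rule decaying_continuous[OF assms(1)])
  obtain K where K: "\<And>x::'a. decay (a *\<^sub>R x) \<le> K * decay x"
    using decay_scaleR_le[OF assms(2)] by metis
  have "norm (u (a *\<^sub>R x)) \<le> C * (K * decay x)" for x
    using C(2)[of "a *\<^sub>R x"] mult_left_mono[OF K[of x] C(1)] by linarith
  then show ?thesis
    using u by (intro decayingI[where C = "C * K"])
      (auto intro!: continuous_intros continuous_on_compose2[OF u] simp: mult.assoc)
qed

lemma decaying_cnj: "decaying u \<Longrightarrow> decaying (\<lambda>x. cnj (u x))"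
  by (auto simp: decaying_def intro!: continuous_intros)

lemma decaying_abs_summable:
  assumes "decaying u"
  shows "(\<lambda>x. norm (u x)) summable_on int_lattice"
proof -
  obtain C where C: "C \<ge> 0" "\<And>x. norm (u x) \<le> C * decay x"
    using decaying_bound[OF assms(1)] by blast
  show ?thesis
    by (rule Infinite_Sum.abs_summable_on_comparison_test'[OF summable_on_cmult_right[OF summable_on_decay]])
       (rule C(2))
qed

section \<open>Fourier series on the unit cube\<close>

definition echar :: "real \<Rightarrow> complex" where
  "echar t = cis (2 * pi * t)"

lemma echar_0 [simp]: "echar 0 = 1"
  by (simp add: echar_def)

lemma echar_add: "echar (s + t) = echar s * echar t"
  by (simp add: echar_def cis_mult distrib_left)

lemma echar_diff: "echar (s - t) = echar s * echar (- t)"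
  using echar_add[of s "- t"] by simp

lemma echar_minus_cancel [simp]: "echar t * echar (- t) = 1" "echar (- t) * echar t = 1"
  by (simp_all flip: echar_add)

lemma norm_echar [simp]: "norm (echar t) = 1"
  by (simp add: echar_def)

lemma cnj_echar [simp]: "cnj (echar t) = echar (- t)"
  by (simp add: echar_def cis_cnj)

lemma echar_Ints [simp]: "t \<in> \<int> \<Longrightarrow> echar t = 1"
  by (auto simp: echar_def intro: cis_multiple_2pi)

lemma continuous_on_echar [continuous_intros]:
  "continuous_on A f \<Longrightarrow> continuous_on A (\<lambda>x. echar (f x))"
  unfolding echar_def by (intro continuous_intros continuous_on_cis)

lemma borel_measurable_echar [measurable]: "echar \<in> borel_measurable borel"
  using continuous_on_echar[OF continuous_on_id, of UNIV] by (intro borel_measurable_continuous_onI) simp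

section \<open>Lebesgue integrals under translation, dilation and separation of variables\<close>

lemma lborel_distr_shift: "distr lborel borel (\<lambda>x. x + a) = (lborel :: 'a::euclidean_space measure)"
proof -
  have "(\<lambda>x. x + a) = (+) a" by (auto simp: add.commute)
  then show ?thesis by (simp add: lborel_distr_plus)
qed

lemma
  fixes f :: "'a::euclidean_space \<Rightarrow> complex"
  assumes [measurable]: "f \<in> borel_measurable borel"
  shows integral_lborel_shift: "(LINT x|lborel. f (x + a)) = (LINT x|lborel. f x)"
    and integrable_lborel_shift: "integrable lborel (\<lambda>x. f (x + a)) \<longleftrightarrow> integrable lborel f"
proof -
  show "(LINT x|lborel. f (x + a)) = (LINT x|lborel. f x)"
    by (subst lborel_distr_shift[of a, symmetric], subst integral_distr) simp_all
  have "integrable lborel f \<longleftrightarrow> integrable (distr lborel borel (\<lambda>x. x + a)) f"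
    by (simp only: lborel_distr_shift)
  also have "\<dots> \<longleftrightarrow> integrable lborel (\<lambda>x. f (x + a))"
    by (subst integrable_distr_eq) simp_all
  finally show "integrable lborel (\<lambda>x. f (x + a)) \<longleftrightarrow> integrable lborel f" ..
qed

lemma integral_lborel_scaleR:
  fixes f :: "'a::euclidean_space \<Rightarrow> complex"
  assumes [measurable]: "f \<in> borel_measurable borel" and "c \<noteq> 0"
  shows "(LINT x|lborel. f x) = of_real (\<bar>c\<bar> ^ DIM('a)) * (LINT x|lborel. f (c *\<^sub>R x))"
proof -
  have "(LINT x|lborel. f x) = (LINT x|density (distr lborel borel (\<lambda>x. 0 + c *\<^sub>R x)) (\<lambda>_. \<bar>c\<bar> ^ DIM('a)). f x)"
    using lborel_affine[OF assms(2), of "0::'a"] by simp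
  also have "\<dots> = (LINT x|distr lborel borel (\<lambda>x. 0 + c *\<^sub>R x). (\<bar>c\<bar> ^ DIM('a)) *\<^sub>R f x)"
    by (subst integral_density) simp_all
  also have "\<dots> = (LINT x|lborel. (\<bar>c\<bar> ^ DIM('a)) *\<^sub>R f (c *\<^sub>R x))"
    by (subst integral_distr) simp_all
  finally show ?thesis by (simp add: scaleR_conv_of_real)
qed

lemma integral_lborel_prod:
  fixes f :: "'a::euclidean_space \<Rightarrow> real \<Rightarrow> complex"
  assumes "\<And>b. b \<in> Basis \<Longrightarrow> integrable lborel (f b)"
  shows "(LINT x|lborel. (\<Prod>b\<in>Basis. f b (x \<bullet> b))) = (\<Prod>b\<in>Basis. LINT t|lborel. f b t)"
proof -
  interpret product_sigma_finite "\<lambda>_::'a. lborel :: real measure"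
    by standard
  have [measurable]: "f b \<in> borel_measurable borel" if "b \<in> Basis" for b
    using assms[OF that] by auto
  have "(LINT x|lborel. (\<Prod>b\<in>Basis. f b (x \<bullet> b)))
      = (LINT g|(\<Pi>\<^sub>M b\<in>(Basis::'a set). lborel). (\<Prod>b\<in>Basis. f b ((\<Sum>c\<in>Basis. g c *\<^sub>R c) \<bullet> b)))"
    by (subst lborel_eq, subst integral_distr) simp_all
  also have "\<dots> = (LINT g|(\<Pi>\<^sub>M b\<in>(Basis::'a set). lborel). (\<Prod>b\<in>Basis. f b (g b)))"
    by (intro Bochner_Integration.integral_cong prod.cong refl) simp
  also have "\<dots> = (\<Prod>b\<in>Basis. LINT t|lborel. f b t)"
    by (rule product_integral_prod) (auto intro: assms)
  finally show ?thesis .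
qed

section \<open>The unit cube, its characters and its lattice translates\<close>

definition unit_cube :: "'a::euclidean_space set" where
  "unit_cube = {x. \<forall>b\<in>Basis. x \<bullet> b \<in> {-1/2..<1/2}}"

text \<open>Two cubes are kept: translates of the half-open one tile the space without overlap,
  while the closed one is compact, so that continuous functions on it are bounded and integrable.
  Centring both at 0 keeps 0 an interior point for the concentration argument.\<close>

definition closed_cube :: "'a::euclidean_space set" where
  "closed_cube = {x. \<forall>b\<in>Basis. x \<bullet> b \<in> {-1/2..1/2}}"

lemma closed_cube_eq: "closed_cube = cbox (- (1/2) *\<^sub>R One) ((1/2) *\<^sub>R One)"
  by (auto simp: closed_cube_def mem_box)

lemma compact_closed_cube: "compact closed_cube"
  by (simp add: closed_cube_eq)

lemma unit_cube_subset: "unit_cube \<subseteq> closed_cube"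
  by (force simp: closed_cube_def unit_cube_def)

lemma sets_unit_cube [measurable]: "unit_cube \<in> sets borel"
proof -
  have "unit_cube = (\<Inter>b\<in>Basis. (\<lambda>x::'a. x \<bullet> b) -` {-1/2..<1/2} \<inter> space borel)"
    by (auto simp: unit_cube_def)
  also have "\<dots> \<in> sets borel"
    by (intro sets.finite_INT measurable_sets[of _ _ borel]) auto
  finally show ?thesis .
qed

lemma indicator_unit_cube:
  "(indicator unit_cube x :: 'b::comm_semiring_1) = (\<Prod>b\<in>Basis. indicator {-1/2..<1/2} (x \<bullet> b))"
proof (cases "x \<in> unit_cube")
  case True
  then show ?thesis by (auto simp: unit_cube_def indicator_def)
next
  case False
  then obtain b where "b \<in> Basis" "x \<bullet> b \<notin> {-1/2..<1/2}" by (auto simp: unit_cube_def)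
  then have "(\<Prod>b\<in>Basis. indicator {-1/2..<1/2} (x \<bullet> b) :: 'b) = 0"
    by (intro prod_zero) (auto intro!: bexI[of _ b])
  with False show ?thesis by simp
qed

lemma emeasure_unit_cube: "emeasure lborel (unit_cube :: 'a::euclidean_space set) = 1"
proof -
  have "emeasure lborel (unit_cube :: 'a set) = (\<integral>\<^sup>+x. indicator (unit_cube :: 'a set) x \<partial>lborel)"
    by simp
  also have "\<dots> = (\<integral>\<^sup>+x. (\<Prod>b\<in>(Basis::'a set). indicator {-1/2..<1/2::real} (x \<bullet> b)) \<partial>lborel)"
    by (simp only: indicator_unit_cube)
  also have "\<dots> = (\<Prod>b\<in>(Basis::'a set). \<integral>\<^sup>+t. indicator {-1/2..<1/2::real} t \<partial>lborel)"
    by (rule nn_integral_lborel_prod) auto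
  also have "\<dots> = 1" by simp
  finally show ?thesis .
qed

lemma measure_unit_cube: "measure lborel (unit_cube :: 'a::euclidean_space set) = 1"
  by (simp add: measure_def emeasure_unit_cube)

lemma set_integrable_unit_cube:
  fixes F :: "'a::euclidean_space \<Rightarrow> 'b::{banach, second_countable_topology}"
  assumes "continuous_on closed_cube F"
  shows "set_integrable lborel unit_cube F"
proof -
  have "set_integrable lborel closed_cube F"
    unfolding set_integrable_def
    by (rule borel_integrable_compact[OF compact_closed_cube assms])
  then show ?thesis
    by (rule set_integrable_subset) (auto simp: unit_cube_subset)
qed

lemma LINT_unit_cube_const: "(LINT x:(unit_cube::'a::euclidean_space set)|lborel. c) = (c::complex)"
  by (simp add: set_lebesgue_integral_def measure_unit_cube emeasure_unit_cube)

lemma norm_LINT_unit_cube_le: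
  fixes F :: "'a::euclidean_space \<Rightarrow> complex"
  assumes "continuous_on closed_cube F" "\<And>x. x \<in> closed_cube \<Longrightarrow> norm (F x) \<le> B"
  shows "norm (LINT x:unit_cube|lborel. F x) \<le> B"
proof -
  have "norm (LINT x:unit_cube|lborel. F x) \<le> (LINT x|lborel. norm (indicator unit_cube x *\<^sub>R F x))"
    unfolding set_lebesgue_integral_def by (rule integral_norm_bound)
  also have "\<dots> \<le> (LINT x|lborel. B * indicator (unit_cube::'a set) x)"
  proof (rule integral_mono)
    show "integrable lborel (\<lambda>x. norm (indicat_real unit_cube x *\<^sub>R F x))"
      using set_integrable_unit_cube[OF assms(1)] unfolding set_integrable_def by (rule integrable_norm)
    show "integrable lborel (\<lambda>x. B * indicat_real (unit_cube::'a set) x)"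
      by (intro integrable_mult_right integrable_real_indicator) (auto simp: emeasure_unit_cube)
    show "norm (indicat_real unit_cube x *\<^sub>R F x) \<le> B * indicat_real unit_cube x" for x
      using assms(2)[of x] unit_cube_subset by (cases "x \<in> unit_cube") auto
  qed
  also have "\<dots> = B" by (simp add: measure_unit_cube)
  finally show ?thesis .
qed

lemma integral_echar_Ico:
  assumes "n \<in> \<int>" "n \<noteq> 0"
  shows "(LINT t|lborel. indicator {-1/2..<1/2::real} t * echar (n * t)) = 0"
proof -
  let ?F = "\<lambda>t. echar (n * t) / (2 * pi * n * \<i>)"
  have "(LINT t|lborel. indicator {-1/2..1/2::real} t *\<^sub>R echar (n * t)) = ?F (1/2) - ?F (-1/2)"
  proof (rule integral_FTC_Icc)
    fix t :: real
    show "(?F has_vector_derivative echar (n * t)) (at t within {-1/2..1/2})"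
    proof -
      define c where "c = 2 * pi * n * \<i>"
      have c: "c \<noteq> 0" using assms(2) by (simp add: c_def)
      have "((\<lambda>z. exp (c * z) / c) has_field_derivative exp (c * of_real t)) (at (of_real t))"
        using c by (auto intro!: derivative_eq_intros)
      then have "((\<lambda>t. exp (c * of_real t) / c) has_vector_derivative exp (c * of_real t)) (at t within {-1/2..1/2})"
        by (rule has_vector_derivative_real_field)
      moreover have "exp (c * of_real t) = echar (n * t)" for t
        by (simp add: c_def echar_def cis_conv_exp mult_ac)
      ultimately show ?thesis by (simp add: c_def)
    qed
  qed (auto intro!: continuous_intros)
  \<comment> \<open>The end points differ by 1 and n is an integer, so the antiderivative agrees at
    both.\<close>
  also have "echar (n * (1/2)) = echar (n * (-1/2))"
    using echar_add[of "n * (-1/2)" n] assms(1) by simp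
  finally have "(LINT t|lborel. indicator {-1/2..1/2::real} t *\<^sub>R echar (n * t)) = 0" by simp
  moreover have "(LINT t|lborel. indicator {-1/2..1/2::real} t *\<^sub>R echar (n * t))
      = (LINT t|lborel. indicator {-1/2..<1/2::real} t * echar (n * t))"
  proof (rule integral_cong_AE)
    show "AE t in lborel. indicator {-1/2..1/2::real} t *\<^sub>R echar (n * t) = indicator {-1/2..<1/2::real} t * echar (n * t)"
      using AE_lborel_singleton[of "1/2::real"] by eventually_elim (auto simp: indicator_def)
  qed measurable
  ultimately show ?thesis by simp
qed

lemma LINT_unit_cube_echar:
  fixes k :: "'a::euclidean_space"
  assumes "k \<in> int_lattice"
  shows "(LINT x:unit_cube|lborel. echar (k \<bullet> x)) = (if k = 0 then 1 else 0)"
proof (cases "k = 0")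
  case True
  then show ?thesis by (simp add: LINT_unit_cube_const)
next
  case False
  then obtain b where b: "b \<in> Basis" "k \<bullet> b \<noteq> 0" using euclidean_all_zero_iff[of k] by blast
  have echar_sum: "echar (sum f A) = (\<Prod>b\<in>A. echar (f b))" if "finite A" for f :: "'a \<Rightarrow> real" and A
    using that by (induction A) (auto simp: echar_add)
  have "(LINT x:unit_cube|lborel. echar (k \<bullet> x))
      = (LINT x|lborel. (\<Prod>b\<in>Basis. indicator {-1/2..<1/2} (x \<bullet> b) * echar ((k \<bullet> b) * (x \<bullet> b))))"
    unfolding set_lebesgue_integral_def
  proof (rule Bochner_Integration.integral_cong[OF refl])
    fix x :: 'a
    have "indicat_real unit_cube x *\<^sub>R echar (k \<bullet> x) = indicator unit_cube x * echar (k \<bullet> x)"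
      by (auto simp: indicator_def)
    also have "\<dots> = (\<Prod>b\<in>Basis. indicator {-1/2..<1/2} (x \<bullet> b)) * (\<Prod>b\<in>Basis. echar ((k \<bullet> b) * (x \<bullet> b)))"
      by (simp only: indicator_unit_cube euclidean_inner[of k x] echar_sum[OF finite_Basis])
    finally show "indicat_real unit_cube x *\<^sub>R echar (k \<bullet> x)
        = (\<Prod>b\<in>Basis. indicator {-1/2..<1/2} (x \<bullet> b) * echar ((k \<bullet> b) * (x \<bullet> b)))"
      by (simp add: prod.distrib)
  qed
  also have "\<dots> = (\<Prod>b\<in>Basis. LINT t|lborel. indicator {-1/2..<1/2} t * echar ((k \<bullet> b) * t))"
  proof (rule integral_lborel_prod)
    fix b :: 'a
    show "integrable lborel (\<lambda>t. indicator {-1/2..<1/2::real} t * echar ((k \<bullet> b) * t))"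
      by (rule Bochner_Integration.integrable_bound[where f = "indicat_real {-1/2..<1/2}"])
        (auto simp: norm_mult indicator_def)
  qed
  also have "\<dots> = 0"
    using b assms integral_echar_Ico[of "k \<bullet> b"]
    by (intro prod_zero finite_Basis bexI[of _ b]) (auto simp: int_lattice_def)
  finally show ?thesis using False by simp
qed

text \<open>The Weierstrass M-test gives uniform convergence along finite subsets. The cube has
  volume 1, so a uniform error bound is also a bound for the error of the integrals.\<close>

lemma
  fixes F :: "'i \<Rightarrow> 'a::euclidean_space \<Rightarrow> complex"
  assumes "c summable_on X" "\<And>i x. i \<in> X \<Longrightarrow> x \<in> closed_cube \<Longrightarrow> norm (F i x) \<le> c i"
    and "\<And>i. i \<in> X \<Longrightarrow> continuous_on closed_cube (F i)"
  shows continuous_on_infsum_cube: "continuous_on closed_cube (\<lambda>x. \<Sum>\<^sub>\<infinity>i\<in>X. F i x)"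
    and has_sum_LINT_cube: "((\<lambda>i. LINT x:unit_cube|lborel. F i x) has_sum
            (LINT x:unit_cube|lborel. \<Sum>\<^sub>\<infinity>i\<in>X. F i x)) X"
proof -
  have unif: "uniform_limit closed_cube (\<lambda>Y x. \<Sum>i\<in>Y. F i x) (\<lambda>x. \<Sum>\<^sub>\<infinity>i\<in>X. F i x) (finite_subsets_at_top X)"
    by (rule Weierstrass_m_test_general[OF assms(2,1)])
  have ev: "\<forall>\<^sub>F Y in finite_subsets_at_top X. finite Y \<and> Y \<subseteq> X"
    by (simp add: eventually_finite_subsets_at_top_weakI)
  show cont: "continuous_on closed_cube (\<lambda>x. \<Sum>\<^sub>\<infinity>i\<in>X. F i x)"
  proof (rule uniform_limit_theorem[OF _ unif])
    show "\<forall>\<^sub>F Y in finite_subsets_at_top X. continuous_on closed_cube (\<lambda>x. \<Sum>i\<in>Y. F i x)"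
      using ev by eventually_elim (auto intro!: continuous_intros assms(3))
  qed simp
  show "((\<lambda>i. LINT x:unit_cube|lborel. F i x) has_sum (LINT x:unit_cube|lborel. \<Sum>\<^sub>\<infinity>i\<in>X. F i x)) X"
    unfolding has_sum_def
  proof (rule tendstoI)
    fix e :: real assume e: "e > 0"
    have "\<forall>\<^sub>F Y in finite_subsets_at_top X. \<forall>x\<in>closed_cube. dist (\<Sum>i\<in>Y. F i x) (\<Sum>\<^sub>\<infinity>i\<in>X. F i x) < e / 2"
      using e by (intro uniform_limitD[OF unif]) simp
    then show "\<forall>\<^sub>F Y in finite_subsets_at_top X. dist (\<Sum>i\<in>Y. LINT x:unit_cube|lborel. F i x)
          (LINT x:unit_cube|lborel. \<Sum>\<^sub>\<infinity>i\<in>X. F i x) < e"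
      using ev
    proof eventually_elim
      fix Y assume Y: "\<forall>x\<in>closed_cube. dist (\<Sum>i\<in>Y. F i x) (\<Sum>\<^sub>\<infinity>i\<in>X. F i x) < e / 2"
        and fin: "finite Y \<and> Y \<subseteq> X"
      have cY: "continuous_on closed_cube (\<lambda>x. \<Sum>i\<in>Y. F i x)"
        using fin by (auto intro!: continuous_intros assms(3))
      have "(\<Sum>i\<in>Y. LINT x:unit_cube|lborel. F i x) = (LINT x:unit_cube|lborel. (\<Sum>i\<in>Y. F i x))"
        using set_integrable_unit_cube[OF assms(3)] fin
        unfolding set_lebesgue_integral_def set_integrable_def scaleR_sum_right
        by (subst Bochner_Integration.integral_sum) auto
      then have "dist (\<Sum>i\<in>Y. LINT x:unit_cube|lborel. F i x) (LINT x:unit_cube|lborel. \<Sum>\<^sub>\<infinity>i\<in>X. F i x)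
          = norm (LINT x:unit_cube|lborel. (\<Sum>i\<in>Y. F i x) - (\<Sum>\<^sub>\<infinity>i\<in>X. F i x))"
        by (simp add: dist_norm set_integral_diff[OF set_integrable_unit_cube[OF cY] set_integrable_unit_cube[OF cont]])
      also have "\<dots> \<le> e / 2"
        using Y by (intro norm_LINT_unit_cube_le continuous_intros cY cont) (auto simp: dist_norm less_imp_le)
      finally show "dist (\<Sum>i\<in>Y. LINT x:unit_cube|lborel. F i x)
          (LINT x:unit_cube|lborel. \<Sum>\<^sub>\<infinity>i\<in>X. F i x) < e" using e by simp
    qed
  qed
qed

lemma exists_cube_lattice_decomp:
  fixes x :: "'a::euclidean_space"
  obtains w where "w \<in> int_lattice" "x - w \<in> unit_cube"
proof
  let ?w = "\<Sum>b\<in>Basis. of_int \<lfloor>x \<bullet> b + 1/2\<rfloor> *\<^sub>R b :: 'a"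
  show "?w \<in> int_lattice" by (simp add: int_lattice_def)
  have "-1/2 \<le> t - of_int \<lfloor>t + 1/2\<rfloor>" "t - of_int \<lfloor>t + 1/2\<rfloor> < 1/2" for t :: real by linarith+
  then show "x - ?w \<in> unit_cube" by (simp add: unit_cube_def inner_diff_left)
qed

lemma cube_lattice_decomp_unique:
  fixes x :: "'a::euclidean_space"
  assumes "w \<in> int_lattice" "w' \<in> int_lattice" "x - w \<in> unit_cube" "x - w' \<in> unit_cube"
  shows "w = w'"
proof (rule euclidean_eqI)
  fix b :: 'a assume b: "b \<in> Basis"
  obtain i j where ij: "w \<bullet> b = of_int i" "w' \<bullet> b = of_int j"
    using assms(1,2) b by (fastforce simp: int_lattice_def elim: Ints_cases)
  have "x \<bullet> b - of_int i \<in> {-1/2..<1/2}" "x \<bullet> b - of_int j \<in> {-1/2..<1/2}"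
    using assms(3,4) b unfolding unit_cube_def mem_Collect_eq ij[symmetric] inner_diff_left[symmetric]
    by blast+
  then have "i = j" by simp
  then show "w \<bullet> b = w' \<bullet> b" using ij by simp
qed

text \<open>On the compact cube 1 / \<open>decay\<close> is bounded, so \<open>decay_add_le\<close>
  dominates all u (x + w) by one summable function of w, uniformly in x.\<close>

lemma decaying_sum_LINT_cube:
  fixes u :: "'a::euclidean_space \<Rightarrow> complex"
  assumes "decaying u"
  shows "((\<lambda>w. LINT x:unit_cube|lborel. u (x + w)) has_sum (LINT x:unit_cube|lborel. \<Sum>\<^sub>\<infinity>w\<in>int_lattice. u (x + w))) int_lattice"
    and "continuous_on closed_cube (\<lambda>x. \<Sum>\<^sub>\<infinity>w\<in>int_lattice. u (x + w))"
    and "(\<lambda>w. norm (LINT x:unit_cube|lborel. u (x + w))) summable_on int_lattice"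
proof -
  obtain C where C: "C \<ge> 0" "\<And>x. norm (u x) \<le> C * decay x"
    using decaying_bound[OF assms(1)] by blast
  have "compact ((\<lambda>x. 1 / decay x) ` (closed_cube :: 'a set))"
    using less_imp_neq[OF decay_pos]
    by (intro compact_continuous_image compact_closed_cube continuous_intros ballI) fastforce
  then have "bounded ((\<lambda>x. 1 / decay x) ` (closed_cube :: 'a set))"
    by (rule compact_imp_bounded)
  then obtain K where "\<forall>y\<in>(\<lambda>x. 1 / decay x) ` (closed_cube :: 'a set). norm y \<le> K"
    unfolding bounded_iff by blast
  then have K: "1 / decay x \<le> K" if "x \<in> closed_cube" for x :: 'a
    using that decay_pos[of x] by (metis (no_types, lifting) abs_ge_self imageI order_trans real_norm_def)
  define c where "c = (\<lambda>w::'a. C * 2 ^ DIM('a) * K * decay w)"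
  have sum: "c summable_on int_lattice"
    unfolding c_def by (intro summable_on_cmult_right summable_on_decay)
  have bound: "norm (u (x + w)) \<le> c w" if "x \<in> closed_cube" for x w
  proof -
    have "norm (u (x + w)) \<le> C * decay (w + x)" using C(2) by (simp add: add.commute)
    also have "\<dots> \<le> C * (2 ^ DIM('a) * decay w * (1 / decay x))"
      using decay_add_le[of w x] C(1) by (intro mult_left_mono) auto
    also have "\<dots> \<le> C * (2 ^ DIM('a) * decay w * K)"
      using K[OF that] C(1) decay_nonneg[of w] by (intro mult_left_mono) auto
    finally show ?thesis by (simp add: c_def mult_ac)
  qed
  have cont: "continuous_on closed_cube (\<lambda>x. u (x + w))" for w
    by (rule decaying_continuous[OF decaying_shift[OF assms]])
  show "((\<lambda>w. LINT x:unit_cube|lborel. u (x + w)) has_sum (LINT x:unit_cube|lborel. \<Sum>\<^sub>\<infinity>w\<in>int_lattice. u (x + w))) int_lattice"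
    "continuous_on closed_cube (\<lambda>x. \<Sum>\<^sub>\<infinity>w\<in>int_lattice. u (x + w))"
    using has_sum_LINT_cube[OF sum bound cont] continuous_on_infsum_cube[OF sum bound cont] by auto
  show "(\<lambda>w. norm (LINT x:unit_cube|lborel. u (x + w))) summable_on int_lattice"
    by (rule Infinite_Sum.abs_summable_on_comparison_test'[OF sum])
      (intro norm_LINT_unit_cube_le cont bound)
qed

text \<open>The lattice translates of the half-open cube partition the space. Enumerating the
  lattice brings this into the shape of countable additivity over sequences; the unordered sum has
  the same value.\<close>

lemma LINT_unfold:
  fixes u :: "'a::euclidean_space \<Rightarrow> complex"
  assumes "decaying u"
  shows "(LINT x:unit_cube|lborel. \<Sum>\<^sub>\<infinity>w\<in>int_lattice. u (x + w)) = (LINT x|lborel. u x)"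
proof -
  define f where "f = from_nat_into (int_lattice :: 'a set)"
  have f: "bij_betw f UNIV int_lattice"
    unfolding f_def by (intro bij_betw_from_nat_into countable_int_lattice infinite_int_lattice)
  define A where "A n = {x. x - f n \<in> unit_cube}" for n
  have [measurable]: "A n \<in> sets borel" for n
    unfolding A_def by measurable
  have [measurable]: "u \<in> borel_measurable borel" by (rule decaying_measurable[OF assms])
  have fL: "f n \<in> int_lattice" for n using f by (auto simp: bij_betw_def)
  have UN: "(\<Union>n. A n) = UNIV"
  proof (intro equalityI subsetI UNIV_I)
    fix x :: 'a
    obtain w where "w \<in> int_lattice" "x - w \<in> unit_cube" by (rule exists_cube_lattice_decomp)
    moreover then obtain n where "w = f n" using f by (auto simp: bij_betw_def)
    ultimately show "x \<in> (\<Union>n. A n)" by (auto simp: A_def)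
  qed
  have disj: "A i \<inter> A j = {}" if "i \<noteq> j" for i j
  proof -
    have "f i \<noteq> f j" using f that by (auto simp: bij_betw_def inj_on_def)
    then show ?thesis using cube_lattice_decomp_unique[OF fL fL] by (auto simp: A_def)
  qed
  have "(LINT x|lborel. u x) = (LINT x:(\<Union>n. A n)|lborel. u x)"
    unfolding UN set_lebesgue_integral_def by simp
  also have "\<dots> = (\<Sum>n. LINT x:A n|lborel. u x)"
    using decaying_integrable[OF assms] disj UN
    by (intro lebesgue_integral_countable_add) (auto simp: set_integrable_def)
  also have "\<dots> = (\<Sum>n. LINT x:unit_cube|lborel. u (x + f n))"
  proof (rule suminf_cong)
    fix n
    have "(LINT x:A n|lborel. u x) = (LINT x|lborel. indicat_real (A n) (x + f n) *\<^sub>R u (x + f n))"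
      unfolding set_lebesgue_integral_def
      by (subst integral_lborel_shift[where a = "f n", symmetric]) simp_all
    also have "\<dots> = (LINT x:unit_cube|lborel. u (x + f n))"
      unfolding set_lebesgue_integral_def
      by (intro Bochner_Integration.integral_cong) (auto simp: A_def indicator_def)
    finally show "(LINT x:A n|lborel. u x) = (LINT x:unit_cube|lborel. u (x + f n))" .
  qed
  finally have *: "(LINT x|lborel. u x) = (\<Sum>n. LINT x:unit_cube|lborel. u (x + f n))" .
  have "((\<lambda>n. LINT x:unit_cube|lborel. u (x + f n)) has_sum
      (LINT x:unit_cube|lborel. \<Sum>\<^sub>\<infinity>w\<in>int_lattice. u (x + w))) UNIV"
    using decaying_sum_LINT_cube(1)[OF assms]
    by (subst has_sum_reindex_bij_betw[OF f, where f = "\<lambda>w. LINT x:unit_cube|lborel. u (x + w)"])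
  then show ?thesis using * has_sum_imp_sums sums_unique by metis
qed

section \<open>Uniqueness of Fourier series, tested at the origin\<close>

lemma half_one_plus_cos: "0 \<le> (1 + cos t) / 2" "(1 + cos t) / 2 \<le> 1" for t :: real
  using add_left_mono[OF cos_ge_minus_one[of t], of 1] by simp_all

text \<open>No periodicity is built in: 0 is interior to the cube and the test takes place near
  it.\<close>

definition fourier_null :: "('a::euclidean_space \<Rightarrow> complex) \<Rightarrow> bool" where
  "fourier_null D \<longleftrightarrow> continuous_on closed_cube D \<and>
     (\<forall>k\<in>int_lattice. (LINT x:unit_cube|lborel. D x * echar (k \<bullet> x)) = 0)"

lemma fourier_null_mult_cos:
  fixes D :: "'a::euclidean_space \<Rightarrow> complex"
  assumes D: "fourier_null D" and b: "b \<in> Basis"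
  shows "fourier_null (\<lambda>x. D x * of_real ((1 + cos (2 * pi * (x \<bullet> b))) / 2))"
  unfolding fourier_null_def
proof (intro conjI ballI)
  have cont: "continuous_on closed_cube D" using D by (simp add: fourier_null_def)
  then show "continuous_on closed_cube (\<lambda>x. D x * of_real ((1 + cos (2 * pi * (x \<bullet> b))) / 2))"
    by (intro continuous_intros) auto
  fix k :: 'a assume k: "k \<in> int_lattice"
  have b': "b \<in> int_lattice" using b by (auto simp: int_lattice_def inner_Basis)
  have int: "set_integrable lborel unit_cube (\<lambda>x. c * (D x * echar (l \<bullet> x)))" for l c
    by (intro set_integrable_unit_cube continuous_intros cont)
  have zero: "(LINT x:unit_cube|lborel. c * (D x * echar (l \<bullet> x))) = 0" if "l \<in> int_lattice" for l c
    using D that by (simp add: fourier_null_def)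
  \<comment> \<open>The cosine factor mixes the coefficients at k, k + b and k - b, all of which
    vanish.\<close>
  have e: "complex_of_real ((1 + cos (2 * pi * t)) / 2) = 1 / 2 + 1 / 4 * echar t + 1 / 4 * echar (- t)" for t
    by (simp add: echar_def complex_eq_iff)
  have "D x * of_real ((1 + cos (2 * pi * (x \<bullet> b))) / 2) * echar (k \<bullet> x)
      = 1 / 2 * (D x * echar (k \<bullet> x)) + 1 / 4 * (D x * echar ((k + b) \<bullet> x)) + 1 / 4 * (D x * echar ((k - b) \<bullet> x))" for x
    unfolding e inner_add_left inner_diff_left inner_commute[of b x] echar_add echar_diff
    by (simp only: ring_distribs mult_ac)
  then show "(LINT x:unit_cube|lborel. D x * of_real ((1 + cos (2 * pi * (x \<bullet> b))) / 2) * echar (k \<bullet> x)) = 0"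
    by (simp only: set_integral_add int zero int_lattice_closed k b') simp
qed

lemma fourier_null_mult_kernel:
  fixes D :: "'a::euclidean_space \<Rightarrow> complex"
  assumes "fourier_null D"
  shows "fourier_null (\<lambda>x. D x * of_real ((\<Prod>b\<in>Basis. (1 + cos (2 * pi * (x \<bullet> b))) / 2) ^ n))"
proof (induction n)
  case 0
  then show ?case using assms by simp
next
  case (Suc n)
  have *: "fourier_null (\<lambda>x. E x * of_real (\<Prod>b\<in>S. (1 + cos (2 * pi * (x \<bullet> b))) / 2))"
    if "finite S" "S \<subseteq> Basis" "fourier_null E" for S and E :: "'a \<Rightarrow> complex"
    using that
  proof (induction S arbitrary: E)
    case (insert b S)
    have "fourier_null (\<lambda>x. E x * of_real ((1 + cos (2 * pi * (x \<bullet> b))) / 2))"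
      using insert by (intro fourier_null_mult_cos) auto
    then have "fourier_null (\<lambda>x. E x * of_real ((1 + cos (2 * pi * (x \<bullet> b))) / 2)
        * of_real (\<Prod>b\<in>S. (1 + cos (2 * pi * (x \<bullet> b))) / 2))"
      using insert by blast
    then show ?case by (simp only: prod.insert[OF insert.hyps(1,2)] of_real_mult mult.assoc)
  qed simp
  show ?case
    using *[OF finite_Basis order_refl Suc] by (simp add: mult_ac)
qed

text \<open>The powers of the kernel \<open>\<Prod>b. (1 + cos (2\<pi>x\<^sub>b)) / 2\<close> concentrate at \<open>0\<close>, so testing \<open>D\<close> against
  them detects a nonzero value \<open>D 0\<close>.\<close>

lemma fourier_null_at_0:
  fixes D :: "'a::euclidean_space \<Rightarrow> complex"
  assumes D: "fourier_null D"
  shows "D 0 = 0"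
proof (rule ccontr)
  assume ne: "D 0 \<noteq> 0"
  \<comment> \<open>Multiplying by the conjugate of D 0 makes the value at 0 real and
    positive.\<close>
  define E where "E x = Re (cnj (D 0) * D x)" for x
  define q where "q x = (\<Prod>b\<in>(Basis::'a set). (1 + cos (2 * pi * (x \<bullet> b))) / 2)" for x
  define \<eta> where "\<eta> = E 0 / 2"
  have "E 0 = (norm (D 0))\<^sup>2" by (simp add: E_def cmod_power2) (simp add: power2_eq_square)
  then have \<eta>: "\<eta> > 0" "E 0 > \<eta>" using ne by (simp_all add: \<eta>_def)
  have contD: "continuous_on closed_cube D" using D by (simp add: fourier_null_def)
  then have contE: "continuous_on closed_cube E" unfolding E_def by (intro continuous_intros)
  have contq: "continuous_on A q" for A unfolding q_def by (intro continuous_intros) auto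
  have q01: "0 \<le> q x" "q x \<le> 1" for x
    unfolding q_def by (intro prod_nonneg prod_le_1 conjI half_one_plus_cos)+
  have q0: "q 0 = 1" by (simp add: q_def)
  have zero_in: "0 \<in> (closed_cube::'a set)" by (simp add: closed_cube_def)
  obtain r where r: "r > 0" "\<And>x. x \<in> closed_cube \<Longrightarrow> norm x < r \<Longrightarrow> E x > \<eta>"
  proof -
    have "\<exists>r>0. \<forall>x\<in>closed_cube. dist x 0 < r \<longrightarrow> dist (E x) (E 0) < E 0 - \<eta>"
      using contE zero_in \<eta>(2) unfolding continuous_on_iff by (meson diff_gt_0_iff_gt)
    then obtain r where "r > 0" "\<And>x. x \<in> closed_cube \<Longrightarrow> norm x < r \<Longrightarrow> \<bar>E x - E 0\<bar> < E 0 - \<eta>"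
      by (auto simp: dist_norm)
    then show ?thesis by (intro that[of r]) (auto simp: abs_less_iff)
  qed
  \<comment> \<open>A bound by r / (2 d) on each of the d coordinates forces norm below r through
    the l1 norm. The cap 1/4 keeps 2 pi delta inside (0, pi), where cosine decreases.\<close>
  define \<delta> where "\<delta> = min (1/4) (r / (2 * DIM('a)))"
  have \<delta>: "0 < \<delta>" "\<delta> \<le> 1/4" using r(1) by (simp_all add: \<delta>_def)
  have inside: "norm x < r" if "\<And>b. b \<in> Basis \<Longrightarrow> \<bar>x \<bullet> b\<bar> < \<delta>" for x :: 'a
  proof -
    have "norm x \<le> (\<Sum>b\<in>Basis. \<bar>x \<bullet> b\<bar>)" by (rule norm_le_l1)
    also have "\<dots> \<le> (\<Sum>b\<in>(Basis::'a set). \<delta>)" using that by (intro sum_mono) (simp add: less_imp_le)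
    also have "\<dots> \<le> DIM('a) * (r / (2 * DIM('a)))"
      unfolding sum_constant by (intro mult_left_mono) (auto simp: \<delta>_def)
    also have "\<dots> < r" using r(1) by simp
    finally show ?thesis .
  qed
  define \<rho> where "\<rho> = (1 + cos (2 * pi * \<delta>)) / 2"
  have "cos (2 * pi * \<delta>) < cos 0"
    using \<delta> by (intro cos_monotone_0_pi) auto
  then have "\<rho> < 1" by (simp add: \<rho>_def)
  moreover have "0 \<le> \<rho>" unfolding \<rho>_def by (rule half_one_plus_cos)
  ultimately have \<rho>: "0 \<le> \<rho>" "\<rho> < 1" by auto
  have outside: "q x \<le> \<rho>" if x: "x \<in> closed_cube" and b: "b \<in> Basis" and xb: "\<bar>x \<bullet> b\<bar> \<ge> \<delta>" for x b
  proof -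
    have "cos (2 * pi * (x \<bullet> b)) = cos (2 * pi * \<bar>x \<bullet> b\<bar>)"
      by (cases "x \<bullet> b \<ge> 0") auto
    also have "\<dots> \<le> cos (2 * pi * \<delta>)"
    proof (rule cos_monotone_0_pi_le)
      show "2 * pi * \<bar>x \<bullet> b\<bar> \<le> pi" using x b by (auto simp: closed_cube_def abs_le_iff)
    qed (use \<delta> xb in auto)
    finally have 1: "(1 + cos (2 * pi * (x \<bullet> b))) / 2 \<le> \<rho>" by (simp add: \<rho>_def)
    have "q x = (1 + cos (2 * pi * (x \<bullet> b))) / 2 * (\<Prod>b\<in>Basis - {b}. (1 + cos (2 * pi * (x \<bullet> b))) / 2)"
      unfolding q_def using b by (intro prod.remove) auto
    also have "\<dots> \<le> \<rho> * 1"
    proof (rule mult_mono[OF 1 _ \<rho>(1)])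
      show "(\<Prod>b\<in>Basis - {b}. (1 + cos (2 * pi * (x \<bullet> b))) / 2) \<le> 1"
        "0 \<le> (\<Prod>b\<in>Basis - {b}. (1 + cos (2 * pi * (x \<bullet> b))) / 2)"
        by (intro prod_nonneg prod_le_1 conjI half_one_plus_cos)+
    qed
    finally show ?thesis by simp
  qed
  \<comment> \<open>Strictly between the bound rho off the neighbourhood and the kernel value 1 at
    0, so that the gain rho'^n near 0 outgrows the loss rho^n elsewhere.\<close>
  define \<rho>' where "\<rho>' = (1 + \<rho>) / 2"
  have \<rho>': "0 < \<rho>'" "\<rho> < \<rho>'" "\<rho>' < 1" using \<rho> by (auto simp: \<rho>'_def)
  obtain s where s: "s > 0" "\<And>x. norm x < s \<Longrightarrow> q x > \<rho>'"
  proof -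
    have "\<exists>s>0. \<forall>x\<in>UNIV. dist x 0 < s \<longrightarrow> dist (q x) (q 0) < 1 - \<rho>'"
      using contq[of UNIV] \<rho>'(3) unfolding continuous_on_iff by (meson UNIV_I diff_gt_0_iff_gt)
    then obtain s where "s > 0" "\<And>x. norm x < s \<Longrightarrow> \<bar>q x - 1\<bar> < 1 - \<rho>'"
      by (auto simp: dist_norm q0)
    then show ?thesis by (intro that[of s]) (auto simp: abs_less_iff)
  qed
  define t where "t = min (min s r) (1/2)"
  have t: "t > 0" "t \<le> s" "t \<le> r" "t \<le> 1/2" using s r by (auto simp: t_def)
  define W where "W = ball (0::'a) t"
  have W: "W \<subseteq> unit_cube"
  proof
    fix x assume "x \<in> W"
    then have "\<bar>x \<bullet> b\<bar> < 1/2" if "b \<in> Basis" for b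
      using Basis_le_norm[OF that, of x] t(4) by (simp add: W_def)
    then show "x \<in> unit_cube" by (fastforce simp: unit_cube_def abs_less_iff)
  qed
  have "bounded (E ` closed_cube)"
    by (intro compact_imp_bounded compact_continuous_image contE compact_closed_cube)
  then obtain B where "\<forall>y\<in>E ` closed_cube. norm y \<le> B"
    unfolding bounded_iff by blast
  then have B: "\<bar>E x\<bar> \<le> B" if "x \<in> closed_cube" for x
    using that by auto
  have B0: "0 \<le> B" using B[OF zero_in] by linarith
  \<comment> \<open>On W both factors are bounded below; for norm below r the product is still
    nonnegative; farther out some coordinate reaches delta, so the kernel is at most rho.\<close>
  have lower: "\<eta> * \<rho>' ^ n * indicator W x - B * \<rho> ^ n \<le> E x * q x ^ n" if x: "x \<in> unit_cube" for x n
  proof -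
    have xc: "x \<in> closed_cube" using x unit_cube_subset by blast
    have "0 \<le> B * \<rho> ^ n" using B0 \<rho> by simp
    consider "x \<in> W" | "x \<notin> W" "norm x < r" | "x \<notin> W" "norm x \<ge> r" by linarith
    then show ?thesis
    proof cases
      case 1
      then have "\<eta> < E x" "\<rho>' < q x" using t r(2)[OF xc] s(2)[of x] by (auto simp: W_def)
      then have "\<eta> * \<rho>' ^ n \<le> E x * q x ^ n"
        using \<eta>(1) \<rho>'(1) by (intro mult_mono power_mono) auto
      then show ?thesis using 1 \<open>0 \<le> B * \<rho> ^ n\<close> by simp
    next
      case 2
      then have "0 < E x" using r(2)[OF xc] \<eta>(1) by simp
      then have "0 \<le> E x * q x ^ n" using q01 by simp
      then show ?thesis using 2 \<open>0 \<le> B * \<rho> ^ n\<close> by simp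
    next
      case 3
      then obtain b where "b \<in> Basis" "\<bar>x \<bullet> b\<bar> \<ge> \<delta>" using inside[of x] by (meson not_less)
      then have "q x \<le> \<rho>" by (rule outside[OF xc])
      then have "\<bar>E x\<bar> * q x ^ n \<le> B * \<rho> ^ n"
        using B[OF xc] B0 q01 by (intro mult_mono power_mono) auto
      moreover have "- (\<bar>E x\<bar> * q x ^ n) \<le> E x * q x ^ n"
        using mult_right_mono[of "- \<bar>E x\<bar>" "E x" "q x ^ n"] q01(1)[of x] by simp
      ultimately show ?thesis using 3 by simp
    qed
  qed
  have zero: "(LINT x:unit_cube|lborel. E x * q x ^ n) = 0" for n
  proof -
    have "continuous_on closed_cube (\<lambda>x. D x * of_real (q x ^ n))"
      using contD contq by (intro continuous_intros) auto
    then have int: "set_integrable lborel unit_cube (\<lambda>x. cnj (D 0) * (D x * of_real (q x ^ n)))"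
      by (intro set_integrable_unit_cube continuous_on_mult_left)
    have "(LINT x:unit_cube|lborel. D x * of_real (q x ^ n) * echar (0 \<bullet> x)) = 0"
      using fourier_null_mult_kernel[OF D, of n] int_lattice_closed(4) unfolding fourier_null_def q_def by blast
    then have "(LINT x:unit_cube|lborel. cnj (D 0) * (D x * of_real (q x ^ n))) = 0" by simp
    then have "Re (LINT x:unit_cube|lborel. cnj (D 0) * (D x * of_real (q x ^ n))) = 0"
      by (simp only: zero_complex.sel)
    also have "Re (LINT x:unit_cube|lborel. cnj (D 0) * (D x * of_real (q x ^ n)))
        = (LINT x:unit_cube|lborel. E x * q x ^ n)"
      using int unfolding set_lebesgue_integral_def set_integrable_def
      by (subst integral_Re[symmetric]) (auto simp: E_def algebra_simps)
    finally show ?thesis .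
  qed
  have ineq: "\<eta> * \<rho>' ^ n * measure lborel W \<le> B * \<rho> ^ n" for n
  proof -
    have cEq: "continuous_on closed_cube (\<lambda>x. E x * q x ^ n)"
      using contE contq by (intro continuous_intros) auto
    have fin: "emeasure lborel W < \<infinity>" unfolding W_def by (rule emeasure_lborel_ball_finite)
    have "(LINT x|lborel. \<eta> * \<rho>' ^ n * indicator W x - B * \<rho> ^ n * indicator (unit_cube::'a set) x)
        \<le> (LINT x|lborel. indicator unit_cube x *\<^sub>R (E x * q x ^ n))"
    proof (rule integral_mono)
      show "integrable lborel (\<lambda>x. \<eta> * \<rho>' ^ n * indicator W x - B * \<rho> ^ n * indicator (unit_cube::'a set) x)"
        using fin by (intro Bochner_Integration.integrable_diff integrable_mult_right integrable_real_indicator)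
          (auto simp: emeasure_unit_cube W_def)
      show "integrable lborel (\<lambda>x. indicat_real unit_cube x *\<^sub>R (E x * q x ^ n))"
        using set_integrable_unit_cube[OF cEq] by (simp add: set_integrable_def)
      show "\<eta> * \<rho>' ^ n * indicator W x - B * \<rho> ^ n * indicator unit_cube x
          \<le> indicat_real unit_cube x *\<^sub>R (E x * q x ^ n)" for x
        using lower[of x n] W by (cases "x \<in> unit_cube") (auto simp: indicator_def)
    qed
    also have "\<dots> = 0" using zero[of n] by (simp add: set_lebesgue_integral_def)
    also have "(LINT x|lborel. \<eta> * \<rho>' ^ n * indicator W x - B * \<rho> ^ n * indicator (unit_cube::'a set) x)
        = \<eta> * \<rho>' ^ n * measure lborel W - B * \<rho> ^ n"
    proof (subst Bochner_Integration.integral_diff)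
      show "integrable lborel (\<lambda>x. \<eta> * \<rho>' ^ n * indicator W x)"
        "integrable lborel (\<lambda>x. B * \<rho> ^ n * indicator (unit_cube::'a set) x)"
        using fin by (intro integrable_mult_right integrable_real_indicator; simp add: emeasure_unit_cube W_def)+
    qed (simp add: measure_unit_cube)
    finally show ?thesis by simp
  qed
  have mW: "measure lborel W > 0" unfolding W_def using t(1) by (simp add: content_ball_pos)
  \<comment> \<open>Dividing the inequality by rho'^n leaves a fixed positive number below a null
    sequence.\<close>
  have "(\<lambda>n. B * (\<rho> / \<rho>') ^ n) \<longlonglongrightarrow> B * 0"
    using \<rho> \<rho>' by (intro tendsto_mult_left LIMSEQ_realpow_zero) auto
  moreover have "\<eta> * measure lborel W \<le> B * (\<rho> / \<rho>') ^ n" for n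
    using ineq[of n] \<rho>'(1) by (simp add: power_divide pos_le_divide_eq mult_ac)
  ultimately have "\<eta> * measure lborel W \<le> B * 0"
    by (intro LIMSEQ_le_const[where X = "\<lambda>n. B * (\<rho> / \<rho>') ^ n"]) auto
  then show False using mW \<eta>(1) by (simp add: mult_le_0_iff)
qed

lemma has_sum_single:
  fixes f :: "'b \<Rightarrow> complex"
  assumes "(f has_sum s) A" "k \<in> A" "\<And>l. l \<in> A \<Longrightarrow> f l = (if l = k then c else 0)"
  shows "s = c"
proof -
  have "(f has_sum c) A"
    using assms(2,3) by (intro has_sum_finite_neutralI[of "{k}"]) auto
  then show ?thesis using assms(1) has_sum_unique by blast
qed

section \<open>Poisson summation and Fourier inversion\<close>

text \<open>The equality in the last assumption gives both halves of self-duality: T maps the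
  lattice into itself, so the form is integral on it, and onto itself, so every Euclidean functional
  given by a lattice vector is \<open>form k\<close> for a lattice point k.\<close>

locale selfdual_form =
  fixes T :: "'a::euclidean_space \<Rightarrow> 'a"
  assumes linear_T: "linear T"
    and selfadjoint: "T x \<bullet> y = x \<bullet> T y"
    and T_lattice: "T ` int_lattice = int_lattice"
begin

definition form :: "'a \<Rightarrow> 'a \<Rightarrow> real" where
  "form x y = T x \<bullet> y"

lemma form_commute: "form x y = form y x"
  by (metis form_def inner_commute selfadjoint)

lemma form_simps:
  "form (x + y) z = form x z + form y z"
  "form (x - y) z = form x z - form y z"
  "form (a *\<^sub>R x) z = a * form x z"
  "form (- x) z = - form x z"
  "form z (x + y) = form z x + form z y"
  "form z (x - y) = form z x - form z y"
  "form z (a *\<^sub>R x) = a * form z x"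
  "form z (- x) = - form z x"
  "form 0 z = 0" "form z 0 = 0"
  using linear_T by (simp_all add: form_def linear_add linear_diff linear_scale linear_neg linear_0 inner_simps)

lemma bounded_linear_T: "bounded_linear T"
  using linear_T linear_conv_bounded_linear by blast

lemma continuous_on_T [continuous_intros]: "continuous_on A f \<Longrightarrow> continuous_on A (\<lambda>x. T (f x))"
  using bounded_linear.continuous_on[OF bounded_linear_T] .

lemma continuous_on_form [continuous_intros]:
  "continuous_on A f \<Longrightarrow> continuous_on A g \<Longrightarrow> continuous_on A (\<lambda>x. form (f x) (g x))"
  unfolding form_def by (intro continuous_intros)

lemma borel_measurable_form [measurable]:
  "f \<in> borel_measurable N \<Longrightarrow> g \<in> borel_measurable N \<Longrightarrow> (\<lambda>x. form (f x) (g x)) \<in> borel_measurable N"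
proof -
  have [measurable]: "T \<in> borel_measurable borel"
    by (intro borel_measurable_continuous_onI continuous_intros)
  show "f \<in> borel_measurable N \<Longrightarrow> g \<in> borel_measurable N \<Longrightarrow> (\<lambda>x. form (f x) (g x)) \<in> borel_measurable N"
    unfolding form_def by measurable
qed

text \<open>The standard basis lies in the lattice, hence in the range of T; in finite dimension
  surjectivity gives injectivity.\<close>

lemma inj_T: "inj T"
proof -
  have "surj T"
  proof -
    have "Basis \<subseteq> (int_lattice :: 'a set)" by (auto simp: int_lattice_def inner_Basis)
    then have "Basis \<subseteq> range T" using T_lattice by blast
    then have "span Basis \<subseteq> range T"
      by (rule span_minimal) (use linear_T in \<open>simp add: linear_subspace_image subspace_UNIV\<close>)
    then show ?thesis by auto
  qed
  then show ?thesis using linear_T linear_surjective_imp_injective by blast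
qed

lemma form_lattice: "x \<in> int_lattice \<Longrightarrow> y \<in> int_lattice \<Longrightarrow> form x y \<in> \<int>"
  unfolding form_def using T_lattice by (intro inner_int_lattice) auto

lemma LINT_unit_cube_form:
  assumes "k \<in> int_lattice"
  shows "(LINT x:unit_cube|lborel. echar (form k x)) = (if k = 0 then 1 else 0)"
proof -
  have "T k \<in> int_lattice" using assms T_lattice by blast
  moreover have "T k = 0 \<longleftrightarrow> k = 0"
    using inj_T linear_T by (metis injD linear_0)
  ultimately show ?thesis by (simp add: form_def LINT_unit_cube_echar)
qed

text \<open>Lebesgue measure is kept without a normalising constant: T permutes the lattice, whose
  cube has volume 1, so the measure is already self-dual for \<open>form\<close>.\<close>

definition ft :: "('a \<Rightarrow> complex) \<Rightarrow> 'a \<Rightarrow> complex" where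
  "ft u \<xi> = (LINT x|lborel. echar (- form \<xi> x) * u x)"

lemma continuous_on_ft:
  assumes "integrable lborel u"
  shows "continuous_on UNIV (ft u)"
  unfolding continuous_on_sequentially ft_def
proof (intro allI ballI impI, unfold o_def)
  have [measurable]: "u \<in> borel_measurable borel" using assms by auto
  fix X :: "nat \<Rightarrow> 'a" and a assume X: "(\<forall>n. X n \<in> UNIV) \<and> X \<longlonglongrightarrow> a"
  show "(\<lambda>n. LINT x|lborel. echar (- form (X n) x) * u x) \<longlonglongrightarrow> (LINT x|lborel. echar (- form a x) * u x)"
  proof (rule integral_dominated_convergence)
    show "integrable lborel (\<lambda>x. norm (u x))" using assms by (rule integrable_norm)
    have "(\<lambda>n. echar (- form (X n) x) * u x) \<longlonglongrightarrow> echar (- form a x) * u x" for x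
    proof -
      have "continuous_on UNIV (\<lambda>\<xi>. echar (- form \<xi> x) * u x)"
        by (intro continuous_intros)
      then show ?thesis using X by (auto simp: continuous_on_sequentially o_def)
    qed
    then show "AE x in lborel. (\<lambda>n. echar (- form (X n) x) * u x) \<longlonglongrightarrow> echar (- form a x) * u x" by simp
  qed (auto simp: norm_mult)
qed

text \<open>The periodisation G of u and the series H with coefficients \<open>ft u\<close> have the
  same Fourier coefficients, so their difference vanishes at 0.\<close>

theorem poisson:
  assumes u: "decaying u" and fu: "decaying (ft u)"
  shows "(\<Sum>\<^sub>\<infinity>w\<in>int_lattice. u w) = (\<Sum>\<^sub>\<infinity>k\<in>int_lattice. ft u k)"
proof -
  define G where "G x = (\<Sum>\<^sub>\<infinity>w\<in>int_lattice. u (x + w))" for x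
  define H where "H x = (\<Sum>\<^sub>\<infinity>k\<in>int_lattice. ft u k * echar (form k x))" for x
  have contG: "continuous_on closed_cube G"
    unfolding G_def by (rule decaying_sum_LINT_cube(2)[OF u])
  have bound: "(\<lambda>k. norm (ft u k)) summable_on int_lattice" by (rule decaying_abs_summable[OF fu])
  have contH: "continuous_on closed_cube H"
    unfolding H_def by (rule continuous_on_infsum_cube[OF bound]) (auto intro!: continuous_intros simp: norm_mult)
  have "fourier_null (\<lambda>x. G x - H x)"
    unfolding fourier_null_def
  proof (intro conjI ballI)
    show "continuous_on closed_cube (\<lambda>x. G x - H x)" using contG contH by (intro continuous_intros)
    fix k' :: 'a assume "k' \<in> int_lattice"
    \<comment> \<open>Self-duality turns the Euclidean character of k' into one given by
      \<open>form k\<close>, with the sign that occurs in \<open>ft\<close>.\<close>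
    then have "- k' \<in> T ` int_lattice" using T_lattice int_lattice_closed(3) by blast
    then obtain k where k: "k \<in> int_lattice" "- k' = T k" by blast
    have fk: "k' \<bullet> x = - form k x" for x using k(2) by (simp add: form_def flip: k(2))
    have "decaying (\<lambda>x. echar (- form k x) * u x)"
      by (intro decaying_mult_bounded[OF u, where K = 1] continuous_intros) simp
    from LINT_unfold[OF this]
    have "(LINT x:unit_cube|lborel. \<Sum>\<^sub>\<infinity>w\<in>int_lattice. echar (- form k (x + w)) * u (x + w)) = ft u k"
      by (simp add: ft_def)
    moreover have "(\<Sum>\<^sub>\<infinity>w\<in>int_lattice. echar (- form k (x + w)) * u (x + w)) = G x * echar (- form k x)" for x
    proof -
      have "(\<Sum>\<^sub>\<infinity>w\<in>int_lattice. echar (- form k (x + w)) * u (x + w))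
          = (\<Sum>\<^sub>\<infinity>w\<in>int_lattice. u (x + w) * echar (- form k x))"
        using form_lattice[OF k(1)] by (intro infsum_cong) (simp add: form_simps echar_diff)
      also have "\<dots> = G x * echar (- form k x)"
        unfolding G_def by (rule infsum_cmult_left')
      finally show ?thesis .
    qed
    ultimately have 1: "(LINT x:unit_cube|lborel. G x * echar (- form k x)) = ft u k" by simp
    have sum: "((\<lambda>l. LINT x:unit_cube|lborel. ft u l * echar (form l x) * echar (- form k x)) has_sum
        (LINT x:unit_cube|lborel. \<Sum>\<^sub>\<infinity>l\<in>int_lattice. ft u l * echar (form l x) * echar (- form k x))) int_lattice"
      by (rule has_sum_LINT_cube[OF bound]) (auto intro!: continuous_intros simp: norm_mult)
    have "(LINT x:unit_cube|lborel. \<Sum>\<^sub>\<infinity>l\<in>int_lattice. ft u l * echar (form l x) * echar (- form k x)) = ft u k"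
    proof (rule has_sum_single[OF sum k(1)])
      fix l :: 'a assume l: "l \<in> int_lattice"
      have "(LINT x:unit_cube|lborel. ft u l * echar (form l x) * echar (- form k x))
          = (LINT x:unit_cube|lborel. ft u l * echar (form (l - k) x))"
        by (simp add: form_simps echar_diff mult.assoc)
      then show "(LINT x:unit_cube|lborel. ft u l * echar (form l x) * echar (- form k x)) = (if l = k then ft u k else 0)"
        using LINT_unit_cube_form[OF int_lattice_closed(2)[OF l k(1)]] by simp
    qed
    then have 2: "(LINT x:unit_cube|lborel. H x * echar (- form k x)) = ft u k"
      by (simp only: H_def infsum_cmult_left')
    show "(LINT x:unit_cube|lborel. (G x - H x) * echar (k' \<bullet> x)) = 0"
      unfolding fk left_diff_distrib
      by (subst set_integral_diff) (auto intro!: set_integrable_unit_cube continuous_intros contG contH simp: 1 2)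
  qed
  then have "G 0 = H 0" using fourier_null_at_0 by fastforce
  then show ?thesis by (simp add: G_def H_def form_simps)
qed

lemma ft_shift_modulate:
  assumes "u \<in> borel_measurable borel"
  shows "ft (\<lambda>x. echar (form x \<mu>) * u (x + a)) \<xi> = echar (form a (\<xi> - \<mu>)) * ft u (\<xi> - \<mu>)"
proof -
  have [measurable]: "u \<in> borel_measurable borel" by (rule assms)
  have "ft (\<lambda>x. echar (form x \<mu>) * u (x + a)) \<xi>
      = (LINT x|lborel. echar (form a (\<xi> - \<mu>)) * (echar (- form (\<xi> - \<mu>) (x + a)) * u (x + a)))"
    unfolding ft_def
  proof (rule Bochner_Integration.integral_cong[OF refl])
    fix x
    have "form a (\<xi> - \<mu>) + - form (\<xi> - \<mu>) (x + a) = - form \<xi> x + form x \<mu>"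
      by (simp add: form_simps form_commute[of x \<mu>] form_commute[of a])
    then show "echar (- form \<xi> x) * (echar (form x \<mu>) * u (x + a))
        = echar (form a (\<xi> - \<mu>)) * (echar (- form (\<xi> - \<mu>) (x + a)) * u (x + a))"
      by (simp only: mult.assoc[symmetric] echar_add[symmetric])
  qed
  also have "\<dots> = echar (form a (\<xi> - \<mu>)) * (LINT x|lborel. echar (- form (\<xi> - \<mu>) (x + a)) * u (x + a))"
    by simp
  also have "(LINT x|lborel. echar (- form (\<xi> - \<mu>) (x + a)) * u (x + a)) = ft u (\<xi> - \<mu>)"
    unfolding ft_def by (rule integral_lborel_shift) measurable
  finally show ?thesis .
qed

text \<open>The transform exchanges translation and modulation; the prefactor is the phase by which
  the two fail to commute.\<close>

corollary poisson_twisted: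
  assumes u: "decaying u" and fu: "decaying (ft u)"
  shows "(\<Sum>\<^sub>\<infinity>w\<in>int_lattice. echar (form w \<mu>) * u (w + a))
       = echar (- form a \<mu>) * (\<Sum>\<^sub>\<infinity>k\<in>int_lattice. echar (form k a) * ft u (k - \<mu>))"
proof -
  have ft: "ft (\<lambda>x. echar (form x \<mu>) * u (x + a)) = (\<lambda>\<xi>. echar (form a (\<xi> - \<mu>)) * ft u (\<xi> - \<mu>))"
    using ft_shift_modulate[OF decaying_measurable[OF u]] by auto
  have "(\<Sum>\<^sub>\<infinity>w\<in>int_lattice. echar (form w \<mu>) * u (w + a))
      = (\<Sum>\<^sub>\<infinity>k\<in>int_lattice. echar (form a (k - \<mu>)) * ft u (k - \<mu>))"
    unfolding fun_cong[OF ft, symmetric]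
  proof (rule poisson)
    show "decaying (\<lambda>x. echar (form x \<mu>) * u (x + a))"
      by (intro decaying_mult_bounded[where K = 1] decaying_shift u continuous_intros) simp
    show "decaying (ft (\<lambda>x. echar (form x \<mu>) * u (x + a)))"
      unfolding ft using decaying_shift[OF fu, of "- \<mu>"]
      by (intro decaying_mult_bounded[where K = 1] continuous_intros) auto
  qed
  also have "\<dots> = (\<Sum>\<^sub>\<infinity>k\<in>int_lattice. echar (- form a \<mu>) * (echar (form k a) * ft u (k - \<mu>)))"
    by (intro infsum_cong) (simp add: form_simps echar_diff form_commute[of a])
  also have "\<dots> = echar (- form a \<mu>) * (\<Sum>\<^sub>\<infinity>k\<in>int_lattice. echar (form k a) * ft u (k - \<mu>))"
    by (rule infsum_cmult_right')
  finally show ?thesis .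
qed

text \<open>Inversion comes out of Poisson summation: integrating the \<open>\<mu>\<close>-twisted formula over the unit cube
  keeps only the term \<open>u 0\<close> on one side and unfolds to the integral of \<open>ft u\<close> on the other.\<close>

theorem ft_inversion_0:
  assumes u: "decaying u" and fu: "decaying (ft u)"
  shows "(LINT \<xi>|lborel. ft u \<xi>) = u 0"
proof -
  have "(LINT \<xi>|lborel. ft u \<xi>) = (LINT \<mu>:unit_cube|lborel. \<Sum>\<^sub>\<infinity>k\<in>int_lattice. ft u (\<mu> + k))"
    by (rule LINT_unfold[OF fu, symmetric])
  \<comment> \<open>With a = 0 the prefactor is 1, and the twist by -mu turns the argument k - mu
    into mu + k.\<close>
  also have "\<dots> = (LINT \<mu>:unit_cube|lborel. \<Sum>\<^sub>\<infinity>w\<in>int_lattice. echar (form (- w) \<mu>) * u w)"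
    using poisson_twisted[OF u fu, of "- _" 0] by (simp add: form_simps add.commute)
  also have "\<dots> = u 0"
  proof -
    have sum: "((\<lambda>w. LINT \<mu>:unit_cube|lborel. echar (form (- w) \<mu>) * u w) has_sum
        (LINT \<mu>:unit_cube|lborel. \<Sum>\<^sub>\<infinity>w\<in>int_lattice. echar (form (- w) \<mu>) * u w)) int_lattice"
      by (rule has_sum_LINT_cube[OF decaying_abs_summable[OF u]]) (auto intro!: continuous_intros simp: norm_mult)
    show ?thesis
    proof (rule has_sum_single[OF sum int_lattice_closed(4)])
      fix w :: 'a assume "w \<in> int_lattice"
      then show "(LINT \<mu>:unit_cube|lborel. echar (form (- w) \<mu>) * u w) = (if w = 0 then u 0 else 0)"
        using LINT_unit_cube_form[OF int_lattice_closed(3)] by simp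
    qed
  qed
  finally show ?thesis .
qed

text \<open>Translating by -x moves the evaluation point to 0; under the transform the translation
  becomes exactly the character that \<open>ft (ft u) x\<close> integrates against.\<close>

theorem ft_inversion:
  assumes u: "decaying u" and fu: "decaying (ft u)"
  shows "ft (ft u) x = u (- x)"
proof -
  have eq: "ft (\<lambda>y. u (y + (- x))) \<xi> = echar (- form x \<xi>) * ft u \<xi>" for \<xi>
    using ft_shift_modulate[OF decaying_measurable[OF u], of 0 "- x" \<xi>] by (simp add: form_simps)
  have "ft (ft u) x = (LINT \<xi>|lborel. ft (\<lambda>y. u (y + (- x))) \<xi>)"
    unfolding eq ft_def[of "ft u"] ..
  also have "\<dots> = u (0 + (- x))"
  proof (rule ft_inversion_0)
    show "decaying (\<lambda>y. u (y + - x))" by (rule decaying_shift[OF u])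
    show "decaying (ft (\<lambda>y. u (y + - x)))"
      unfolding eq[abs_def] by (intro decaying_mult_bounded[OF fu, where K = 1] continuous_intros) simp
  qed
  finally show ?thesis by simp
qed

end

lemma Fubini_bounded_kernel:
  fixes u v :: "'a::euclidean_space \<Rightarrow> complex"
  assumes u: "integrable lborel u" and v: "integrable lborel v"
    and [measurable]: "(\<lambda>(x, y). k x y) \<in> borel_measurable (borel \<Otimes>\<^sub>M borel)"
    and k: "\<And>x y. norm (k x y) \<le> 1"
  shows "(LINT x|lborel. LINT y|lborel. k x y * (u x * v y)) = (LINT y|lborel. LINT x|lborel. k x y * (u x * v y))"
proof (rule lborel_pair.Fubini_integral[symmetric])
  have [measurable]: "u \<in> borel_measurable borel" "v \<in> borel_measurable borel" using u v by auto
  have "integrable (lborel \<Otimes>\<^sub>M lborel) (\<lambda>p. u (fst p) * v (snd p))"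
    using integrable_norm[OF u] v
    by (intro lborel_pair.Fubini_integrable) (auto simp: norm_mult)
  then show "integrable (lborel \<Otimes>\<^sub>M lborel) (\<lambda>(x, y). k x y * (u x * v y))"
    by (rule Bochner_Integration.integrable_bound) (auto simp: norm_mult mult_left_le_one_le k)
qed

section \<open>Chirped Schwartz functions\<close>

definition rapid :: "('a::euclidean_space \<Rightarrow> complex) \<Rightarrow> bool" where
  "rapid f \<longleftrightarrow> (\<forall>k. \<exists>C. \<forall>x. norm x ^ k * norm (f x) \<le> C)"

lemma rapid_decaying:
  fixes f :: "'a::euclidean_space \<Rightarrow> complex"
  assumes "rapid f" "continuous_on UNIV f"
  shows "decaying f"
proof -
  obtain A B where AB: "\<And>x. norm x ^ 0 * norm (f x) \<le> A" "\<And>x. norm x ^ (2 * DIM('a)) * norm (f x) \<le> B"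
    using assms(1) unfolding rapid_def by meson
  have "norm (f x) \<le> 2 ^ DIM('a) * (A + B) * decay x" for x
  proof -
    have "1 * norm (f x) \<le> decay x * (2 ^ DIM('a) * (1 + norm x ^ (2 * DIM('a)))) * norm (f x)"
      by (intro mult_right_mono decay_ge_norm) auto
    also have "\<dots> = 2 ^ DIM('a) * decay x * (norm (f x) + norm x ^ (2 * DIM('a)) * norm (f x))"
      by (simp add: algebra_simps)
    also have "\<dots> \<le> 2 ^ DIM('a) * decay x * (A + B)"
      using AB[of x] by (intro mult_left_mono add_mono) (auto simp: decay_nonneg)
    finally show ?thesis by (simp add: mult_ac)
  qed
  then show ?thesis using assms(2) by (intro decayingI)
qed

text \<open>The products of Schwartz functions with polynomials; closing under multiplication by linear forms
  by hand avoids a Leibniz rule for iterated partial derivatives.\<close>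

inductive poly_schwartz :: "('a::euclidean_space \<Rightarrow> complex) \<Rightarrow> bool" where
  base: "schwartz f \<Longrightarrow> poly_schwartz f"
| add: "poly_schwartz f \<Longrightarrow> poly_schwartz g \<Longrightarrow> poly_schwartz (\<lambda>x. f x + g x)"
| linear_mult: "poly_schwartz f \<Longrightarrow> poly_schwartz (\<lambda>x. of_real (x \<bullet> a) * f x)"
| cmult: "poly_schwartz f \<Longrightarrow> poly_schwartz (\<lambda>x. c * f x)"

lemma iter_partial_append: "iter_partial (bs @ [b]) f = iter_partial bs (\<lambda>x. frechet_derivative f (at x) b)"
  by (induction bs) auto

lemma schwartz_differentiable: "schwartz f \<Longrightarrow> f differentiable at x"
  unfolding schwartz_def by (metis iter_partial.simps(1) lists.Nil)

lemma schwartz_rapid: "schwartz f \<Longrightarrow> rapid f"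
  unfolding schwartz_def rapid_def bounded_iff
  by (auto dest!: bspec[of _ _ "[]"])

lemma schwartz_partial:
  assumes "schwartz f" "b \<in> Basis"
  shows "schwartz (\<lambda>x. frechet_derivative f (at x) b)"
  unfolding schwartz_def
proof
  fix bs :: "'a list" assume "bs \<in> lists Basis"
  then have "bs @ [b] \<in> lists Basis" using assms(2) by simp
  then show "(\<forall>x. iter_partial bs (\<lambda>x. frechet_derivative f (at x) b) differentiable at x) \<and>
      (\<forall>k. bounded (range (\<lambda>x. norm x ^ k *\<^sub>R iter_partial bs (\<lambda>x. frechet_derivative f (at x) b) x)))"
    using assms(1) unfolding schwartz_def iter_partial_append[symmetric] by blast
qed

lemma poly_schwartz_rapid: "poly_schwartz f \<Longrightarrow> rapid f"
proof (induction rule: poly_schwartz.induct)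
  case (base f)
  then show ?case by (rule schwartz_rapid)
next
  case (add f g)
  show ?case unfolding rapid_def
  proof
    fix k
    obtain A B where AB: "\<And>x. norm x ^ k * norm (f x) \<le> A" "\<And>x. norm x ^ k * norm (g x) \<le> B"
      using add.IH unfolding rapid_def by meson
    have "norm x ^ k * norm (f x + g x) \<le> A + B" for x
      using mult_left_mono[OF norm_triangle_ineq, of "norm x ^ k" "f x" "g x"] AB[of x]
      by (simp add: distrib_left)
    then show "\<exists>C. \<forall>x. norm x ^ k * norm (f x + g x) \<le> C" by blast
  qed
next
  case (linear_mult f a)
  show ?case unfolding rapid_def
  proof
    fix k
    obtain A where A: "\<And>x. norm x ^ Suc k * norm (f x) \<le> A"
      using linear_mult.IH unfolding rapid_def by meson
    have "norm x ^ k * norm (of_real (x \<bullet> a) * f x) \<le> norm a * A" for x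
    proof -
      have "norm x ^ k * norm (of_real (x \<bullet> a) * f x) \<le> norm x ^ k * (norm x * norm a * norm (f x))"
        using Cauchy_Schwarz_ineq2[of x a] by (intro mult_left_mono) (auto simp: norm_mult mult_right_mono)
      also have "\<dots> = norm a * (norm x ^ Suc k * norm (f x))" by (simp add: mult_ac)
      also have "\<dots> \<le> norm a * A" by (intro mult_left_mono A) auto
      finally show ?thesis .
    qed
    then show "\<exists>C. \<forall>x. norm x ^ k * norm (of_real (x \<bullet> a) * f x) \<le> C" by blast
  qed
next
  case (cmult f c)
  show ?case unfolding rapid_def
  proof
    fix k
    obtain A where A: "\<And>x. norm x ^ k * norm (f x) \<le> A"
      using cmult.IH unfolding rapid_def by meson
    have "norm x ^ k * norm (c * f x) \<le> norm c * A" for x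
      using mult_left_mono[OF A[of x], of "norm c"] by (simp add: norm_mult mult_ac)
    then show "\<exists>C. \<forall>x. norm x ^ k * norm (c * f x) \<le> C" by blast
  qed
qed

text \<open>Closure under directional derivatives is what lets integration by parts be
  iterated.\<close>

lemma poly_schwartz_derivative:
  "poly_schwartz f \<Longrightarrow> \<exists>f'. (\<forall>x. (f has_derivative f' x) (at x)) \<and> (\<forall>b\<in>Basis. poly_schwartz (\<lambda>x. f' x b))"
proof (induction rule: poly_schwartz.induct)
  case (base f)
  show ?case
    using schwartz_differentiable[OF base] schwartz_partial[OF base, THEN poly_schwartz.base]
    by (intro exI[of _ "\<lambda>x. frechet_derivative f (at x)"])
      (auto simp: frechet_derivative_works[symmetric])
next
  case (add f g)
  then obtain f' g' where *: "\<And>x. (f has_derivative f' x) (at x)" "\<And>b. b \<in> Basis \<Longrightarrow> poly_schwartz (\<lambda>x. f' x b)"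
    "\<And>x. (g has_derivative g' x) (at x)" "\<And>b. b \<in> Basis \<Longrightarrow> poly_schwartz (\<lambda>x. g' x b)"
    by blast
  then show ?case
    by (intro exI[of _ "\<lambda>x h. f' x h + g' x h"]) (auto intro: poly_schwartz.add has_derivative_add)
next
  case (linear_mult f a)
  then obtain f' where *: "\<And>x. (f has_derivative f' x) (at x)" "\<And>b. b \<in> Basis \<Longrightarrow> poly_schwartz (\<lambda>x. f' x b)"
    by blast
  have "((\<lambda>x. of_real (x \<bullet> a) * f x) has_derivative (\<lambda>h. of_real (x \<bullet> a) * f' x h + of_real (h \<bullet> a) * f x)) (at x)" for x
    by (intro has_derivative_mult *(1) has_derivative_of_real has_derivative_inner_left has_derivative_ident)
  then show ?case using * linear_mult.hyps
    by (intro exI[of _ "\<lambda>x h. of_real (x \<bullet> a) * f' x h + of_real (h \<bullet> a) * f x"])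
      (auto intro!: poly_schwartz.add poly_schwartz.linear_mult poly_schwartz.cmult)
next
  case (cmult f c)
  then obtain f' where *: "\<And>x. (f has_derivative f' x) (at x)" "\<And>b. b \<in> Basis \<Longrightarrow> poly_schwartz (\<lambda>x. f' x b)"
    by blast
  then show ?case
    by (intro exI[of _ "\<lambda>x h. c * f' x h"]) (auto intro: poly_schwartz.cmult has_derivative_mult_right)
qed

lemma poly_schwartz_decaying:
  assumes "poly_schwartz f"
  shows "decaying f"
proof (rule rapid_decaying[OF poly_schwartz_rapid[OF assms]])
  obtain f' where "\<And>x. (f has_derivative f' x) (at x)"
    using poly_schwartz_derivative[OF assms] by blast
  then show "continuous_on UNIV f"
    by (intro continuous_at_imp_continuous_on ballI has_derivative_continuous)
qed

text \<open>Boundary terms are avoided by applying the fundamental theorem on the segment from x to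
  x + b. Integrating over x turns one side into the integral of the derivative and the other into a
  difference of two equal integrals.\<close>

lemma LINT_partial_eq_0:
  fixes u :: "'a::euclidean_space \<Rightarrow> complex"
  assumes u: "decaying u" and v: "decaying (\<lambda>x. u' x b)"
    and deriv: "\<And>x. (u has_derivative u' x) (at x)"
  shows "(LINT x|lborel. u' x b) = 0"
proof -
  define v where "v x = u' x b" for x
  have vd: "decaying v" using v by (simp add: v_def[abs_def])
  have [measurable]: "v \<in> borel_measurable borel" "u \<in> borel_measurable borel"
    by (intro decaying_measurable vd u)+
  have FTC: "(LINT t|lborel. indicator {0..1::real} t *\<^sub>R v (x + t *\<^sub>R b)) = u (x + b) - u x" for x
  proof -
    have "(LINT t|lborel. indicator {0..1::real} t *\<^sub>R v (x + t *\<^sub>R b)) = u (x + 1 *\<^sub>R b) - u (x + 0 *\<^sub>R b)"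
    proof (rule integral_FTC_Icc)
      fix t :: real
      have "((\<lambda>t. u (x + t *\<^sub>R b)) has_derivative (\<lambda>h. u' (x + t *\<^sub>R b) (h *\<^sub>R b))) (at t within {0..1})"
        by (rule has_derivative_compose[OF _ deriv]) (auto intro!: derivative_eq_intros)
      moreover have "u' (x + t *\<^sub>R b) (h *\<^sub>R b) = h *\<^sub>R v (x + t *\<^sub>R b)" for h
        using has_derivative_linear[OF deriv, of "x + t *\<^sub>R b"] by (simp add: v_def linear_scale)
      ultimately show "((\<lambda>t. u (x + t *\<^sub>R b)) has_vector_derivative v (x + t *\<^sub>R b)) (at t within {0..1})"
        by (simp add: has_vector_derivative_def)
    qed (auto intro!: continuous_intros continuous_on_compose2[OF decaying_continuous[OF vd, of UNIV]])
    then show ?thesis by simp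
  qed
  have shift: "integrable lborel (\<lambda>x. v (x + a))" "(LINT x|lborel. v (x + a)) = (LINT x|lborel. v x)"
    "(LINT x|lborel. norm (v (x + a))) = (LINT x|lborel. norm (v x))" for a
  proof -
    show "integrable lborel (\<lambda>x. v (x + a))" "(LINT x|lborel. v (x + a)) = (LINT x|lborel. v x)"
      using decaying_integrable[OF vd] by (simp_all add: integrable_lborel_shift integral_lborel_shift)
    have "(LINT x|lborel. complex_of_real (norm (v (x + a)))) = (LINT x|lborel. complex_of_real (norm (v x)))"
      by (rule integral_lborel_shift[of "\<lambda>x. complex_of_real (norm (v x))"]) simp
    then show "(LINT x|lborel. norm (v (x + a))) = (LINT x|lborel. norm (v x))" by simp
  qed
  have "integrable (lborel \<Otimes>\<^sub>M lborel) (\<lambda>(t, x). indicator {0..1::real} t *\<^sub>R v (x + t *\<^sub>R b))"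
    by (rule lborel_pair.Fubini_integrable) (auto simp: shift)
  then have "(LINT x|lborel. LINT t|lborel. indicator {0..1::real} t *\<^sub>R v (x + t *\<^sub>R b))
      = (LINT t|lborel. LINT x|lborel. indicator {0..1::real} t *\<^sub>R v (x + t *\<^sub>R b))"
    by (rule lborel_pair.Fubini_integral)
  also have "\<dots> = (LINT t|lborel. indicator {0..1::real} t *\<^sub>R (LINT x|lborel. v x))"
    by (simp add: shift)
  also have "\<dots> = (LINT x|lborel. v x)" by simp
  finally have "(LINT x|lborel. v x) = (LINT x|lborel. u (x + b) - u x)" by (simp add: FTC)
  also have "\<dots> = 0"
    using decaying_integrable[OF u] by (simp add: integrable_lborel_shift integral_lborel_shift)
  finally show ?thesis by (simp add: v_def)
qed

lemma has_derivative_echar: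
  assumes "(\<theta> has_derivative \<theta>') (at x)"
  shows "((\<lambda>x. echar (\<theta> x)) has_derivative (\<lambda>h. 2 * pi * \<i> * of_real (\<theta>' h) * echar (\<theta> x))) (at x)"
proof -
  have "((\<lambda>z. exp (2 * pi * \<i> * z)) has_field_derivative 2 * pi * \<i> * exp (2 * pi * \<i> * of_real t)) (at (of_real t))" for t :: real
    by (auto intro!: derivative_eq_intros)
  then have "((\<lambda>t. exp (2 * pi * \<i> * of_real t)) has_vector_derivative 2 * pi * \<i> * exp (2 * pi * \<i> * of_real t)) (at t)" for t :: real
    by (rule has_vector_derivative_real_field)
  moreover have "exp (2 * pi * \<i> * of_real t) = echar t" for t
    by (simp add: echar_def cis_conv_exp mult_ac)
  ultimately have "(echar has_derivative (\<lambda>h. h *\<^sub>R (2 * pi * \<i> * echar t))) (at t)" for t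
    by (simp add: has_vector_derivative_def)
  from has_derivative_compose[OF assms this] show ?thesis
    by (simp add: scaleR_conv_of_real mult_ac)
qed

section \<open>Plancherel and the decay of transforms of chirped functions\<close>

context selfdual_form
begin

lemma ft_integral_swap:
  assumes u: "integrable lborel u" and v: "integrable lborel v"
  shows "(LINT x|lborel. ft u x * v x) = (LINT x|lborel. u x * ft v x)"
proof -
  have "(LINT x|lborel. LINT y|lborel. echar (- form x y) * (v x * u y))
      = (LINT y|lborel. LINT x|lborel. echar (- form x y) * (v x * u y))"
    by (rule Fubini_bounded_kernel[OF v u]) auto
  moreover have "(LINT y|lborel. echar (- form x y) * (v x * u y)) = ft u x * v x" for x
    unfolding ft_def by (subst integral_mult_left_zero[symmetric]) (simp add: mult_ac)
  moreover have "(LINT x|lborel. echar (- form x y) * (v x * u y)) = u y * ft v y" for y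
    unfolding ft_def by (subst integral_mult_right_zero[symmetric]) (simp add: mult_ac form_commute)
  ultimately show ?thesis by simp
qed

text \<open>The swap formula is applied to u and the conjugate of \<open>ft u\<close>, whose
  transform is the conjugate of u by inversion.\<close>

lemma ft_plancherel:
  assumes u: "decaying u" and fu: "decaying (ft u)"
  shows "(LINT x|lborel. ft u x * cnj (ft u x)) = (LINT x|lborel. u x * cnj (u x))"
proof -
  have "ft (\<lambda>\<xi>. cnj (ft u \<xi>)) x = cnj (u x)" for x
  proof -
    have "ft (\<lambda>\<xi>. cnj (ft u \<xi>)) x = cnj (ft (ft u) (- x))"
    proof -
      have "cnj (LINT \<xi>|lborel. echar (form x \<xi>) * ft u \<xi>) = (LINT \<xi>|lborel. cnj (echar (form x \<xi>) * ft u \<xi>))"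
        by (rule Bochner_Integration.integral_cnj[symmetric])
      then show ?thesis by (simp add: ft_def[of _ x] ft_def[of _ "- x"] form_simps)
    qed
    then show ?thesis by (simp add: ft_inversion[OF u fu])
  qed
  then show ?thesis
    using ft_integral_swap[OF decaying_integrable[OF u] decaying_integrable[OF decaying_cnj[OF fu]]] by simp
qed

text \<open>The function exp(pi i c B(x, x)), a Gaussian with imaginary exponent. It is bounded but
  not integrable, so its transform is accessible only through products and convolutions.\<close>

definition chirp :: "real \<Rightarrow> 'a \<Rightarrow> complex" where
  "chirp c x = echar (c * form x x / 2)"

lemma norm_chirp [simp]: "norm (chirp c x) = 1"
  by (simp add: chirp_def)

lemma chirp_0 [simp]: "chirp 0 x = 1"
  by (simp add: chirp_def)

lemma chirp_minus [simp]: "chirp c (- x) = chirp c x"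
  by (simp add: chirp_def form_simps)

lemma chirp_scaleR: "chirp c (a *\<^sub>R x) = chirp (c * a\<^sup>2) x"
  by (simp add: chirp_def form_simps power2_eq_square mult_ac)

lemma chirp_add: "chirp (a + b) x = chirp a x * chirp b x"
  by (simp add: chirp_def echar_add ring_distribs add_divide_distrib)

lemma continuous_on_chirp [continuous_intros]:
  "continuous_on A f \<Longrightarrow> continuous_on A (\<lambda>x. chirp c (f x))"
  unfolding chirp_def by (intro continuous_intros) auto

lemma borel_measurable_chirp [measurable]: "chirp c \<in> borel_measurable borel"
  by (intro borel_measurable_continuous_onI continuous_intros)

lemma decaying_chirp: "decaying u \<Longrightarrow> decaying (\<lambda>x. chirp c x * u x)"
  by (rule decaying_mult_bounded[where K = 1]) (auto intro: continuous_intros)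

text \<open>Differentiating the total phase - \<open>form xi x\<close> + c \<open>form x x\<close> /
  2 along b gives, up to 2 pi i, the constant - T xi . b, which becomes the gained factor, and the
  linear form c (x . T b), which is absorbed into g'. For this the class has to be closed under
  multiplication by linear forms.\<close>

lemma ft_partial:
  assumes g: "poly_schwartz g" and b: "b \<in> Basis"
  obtains g' where "poly_schwartz g'"
    "\<And>\<xi>. ft (\<lambda>x. chirp c x * g' x) \<xi> = 2 * pi * \<i> * of_real (T \<xi> \<bullet> b) * ft (\<lambda>x. chirp c x * g x) \<xi>"
proof -
  obtain D where D: "\<And>x. (g has_derivative D x) (at x)" "\<And>b. b \<in> Basis \<Longrightarrow> poly_schwartz (\<lambda>x. D x b)"
    using poly_schwartz_derivative[OF g] by blast
  define g' where "g' x = D x b + 2 * pi * \<i> * c * (of_real (x \<bullet> T b) * g x)" for x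
  have g': "poly_schwartz g'"
    unfolding g'_def[abs_def] by (intro poly_schwartz.add poly_schwartz.linear_mult poly_schwartz.cmult D(2) b g)
  have "ft (\<lambda>x. chirp c x * g' x) \<xi> = 2 * pi * \<i> * of_real (T \<xi> \<bullet> b) * ft (\<lambda>x. chirp c x * g x) \<xi>" for \<xi>
  proof -
    define \<theta> where "\<theta> x = - form \<xi> x + c * form x x / 2" for x
    define u' where "u' x h = echar (\<theta> x) * D x h + 2 * pi * \<i> * of_real (- form \<xi> h + c * form x h) * echar (\<theta> x) * g x" for x h
    have echar_\<theta>: "echar (\<theta> x) = echar (- form \<xi> x) * chirp c x" for x
      unfolding \<theta>_def chirp_def echar_add ..
    have "(\<theta> has_derivative (\<lambda>h. - form \<xi> h + c * form x h)) (at x)" for x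
    proof -
      have T': "(T has_derivative T) (at x)"
        by (rule bounded_linear_imp_has_derivative[OF bounded_linear_T])
      have "((\<lambda>x. - (T \<xi> \<bullet> x) + c * (T x \<bullet> x) / 2) has_derivative
          (\<lambda>h. - (T \<xi> \<bullet> h) + c * (T x \<bullet> h + T h \<bullet> x) / 2)) (at x)"
        by (auto intro!: derivative_eq_intros T' simp: fun_eq_iff algebra_simps)
      moreover have "T h \<bullet> x = T x \<bullet> h" for h
        by (metis inner_commute selfadjoint)
      ultimately show ?thesis
        unfolding \<theta>_def form_def by simp
    qed
    then have deriv: "((\<lambda>x. echar (\<theta> x) * g x) has_derivative u' x) (at x)" for x
      unfolding u'_def by (intro has_derivative_mult has_derivative_echar D(1))
    have cont: "continuous_on UNIV (\<lambda>x. echar (\<theta> x))"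
      unfolding \<theta>_def by (intro continuous_intros) auto
    have d1: "decaying (\<lambda>x. echar (\<theta> x) * w x)" if "poly_schwartz w" for w
      by (intro decaying_mult_bounded[OF poly_schwartz_decaying[OF that] cont, of 1]) simp
    have u'_eq: "u' x b = echar (\<theta> x) * g' x - 2 * pi * \<i> * of_real (T \<xi> \<bullet> b) * (echar (\<theta> x) * g x)" for x
      by (simp add: u'_def g'_def form_def selfadjoint[of x] algebra_simps)
    have "(LINT x|lborel. u' x b) = 0"
    proof (rule LINT_partial_eq_0[OF d1[OF g] _ deriv])
      have "poly_schwartz (\<lambda>x. g' x + (- (2 * pi * \<i> * of_real (T \<xi> \<bullet> b))) * g x)"
        by (intro poly_schwartz.add poly_schwartz.cmult g' g)
      from d1[OF this] show "decaying (\<lambda>x. u' x b)"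
        by (simp add: u'_eq algebra_simps)
    qed
    also have "(LINT x|lborel. u' x b) = (LINT x|lborel. echar (\<theta> x) * g' x)
        - 2 * pi * \<i> * of_real (T \<xi> \<bullet> b) * (LINT x|lborel. echar (\<theta> x) * g x)"
      unfolding u'_eq
      by (subst Bochner_Integration.integral_diff)
        (auto intro!: decaying_integrable decaying_cmult d1 g g')
    finally show ?thesis
      by (simp add: ft_def echar_\<theta> mult.assoc)
  qed
  with g' show ?thesis by (rule that)
qed

text \<open>Each use of \<open>ft_partial\<close> trades one factor T xi . b for a new member of the
  class, so the induction leaves g arbitrary; the base case is the L1 bound.\<close>

lemma ft_partial_bound:
  assumes "poly_schwartz g" "b \<in> Basis"
  shows "\<exists>C. \<forall>\<xi>. \<bar>T \<xi> \<bullet> b\<bar> ^ k * norm (ft (\<lambda>x. chirp c x * g x) \<xi>) \<le> C"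
  using assms(1)
proof (induction k arbitrary: g)
  case 0
  have "norm (ft (\<lambda>x. chirp c x * g x) \<xi>) \<le> (LINT x|lborel. norm (g x))" for \<xi>
    unfolding ft_def by (rule order_trans[OF integral_norm_bound]) (simp add: norm_mult)
  then show ?case by auto
next
  case (Suc k)
  obtain g' where g': "poly_schwartz g'"
    "\<And>\<xi>. ft (\<lambda>x. chirp c x * g' x) \<xi> = 2 * pi * \<i> * of_real (T \<xi> \<bullet> b) * ft (\<lambda>x. chirp c x * g x) \<xi>"
    using ft_partial[OF Suc.prems assms(2)] by metis
  obtain C where C: "\<And>\<xi>. \<bar>T \<xi> \<bullet> b\<bar> ^ k * norm (ft (\<lambda>x. chirp c x * g' x) \<xi>) \<le> C"
    using Suc.IH[OF g'(1)] by blast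
  have "\<bar>T \<xi> \<bullet> b\<bar> ^ Suc k * norm (ft (\<lambda>x. chirp c x * g x) \<xi>) \<le> C / (2 * pi)" for \<xi>
    using C[of \<xi>] unfolding g'(2) by (simp add: norm_mult pos_le_divide_eq mult_ac)
  then show ?case by blast
qed

lemma ft_chirp_rapid:
  assumes "poly_schwartz g"
  shows "rapid (ft (\<lambda>x. chirp c x * g x))"
  unfolding rapid_def
proof
  fix k
  let ?F = "ft (\<lambda>x. chirp c x * g x)"
  have "\<forall>b\<in>Basis. \<exists>C. \<forall>\<xi>. \<bar>T \<xi> \<bullet> b\<bar> ^ k * norm (?F \<xi>) \<le> C"
    by (intro ballI ft_partial_bound assms)
  then obtain C' where "\<forall>b\<in>Basis. \<forall>\<xi>. \<bar>T \<xi> \<bullet> b\<bar> ^ k * norm (?F \<xi>) \<le> C' b"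
    by (auto dest!: bchoice)
  then obtain C where C: "\<And>b \<xi>. b \<in> Basis \<Longrightarrow> \<bar>T \<xi> \<bullet> b\<bar> ^ k * norm (?F \<xi>) \<le> C b"
    by (intro that) auto
  obtain B where B: "B > 0" "\<And>x. B * norm x \<le> norm (T x)"
    using linear_inj_bounded_below_pos[OF linear_T inj_T] by (auto simp: mult.commute)
  have C0: "0 \<le> C b" if "b \<in> Basis" for b
    using C[OF that, of 0] by (rule order_trans[rotated]) simp
  have "norm \<xi> ^ k * norm (?F \<xi>) \<le> (DIM('a) / B) ^ k * (\<Sum>b\<in>Basis. C b)" for \<xi>
  proof -
    \<comment> \<open>The largest coordinate of T xi is at least its norm divided by the dimension.
      Which one it is depends on xi, hence the sum of all \<open>C b\<close> in the bound.\<close>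
    have "\<exists>b\<in>Basis. norm (T \<xi>) \<le> DIM('a) * \<bar>T \<xi> \<bullet> b\<bar>"
    proof (rule ccontr)
      assume "\<not> ?thesis"
      then have "\<bar>T \<xi> \<bullet> b\<bar> < norm (T \<xi>) / DIM('a)" if "b \<in> Basis" for b
        using that by (auto simp: pos_less_divide_eq not_le mult.commute)
      then have "(\<Sum>b\<in>Basis. \<bar>T \<xi> \<bullet> b\<bar>) < (\<Sum>b\<in>(Basis::'a set). norm (T \<xi>) / DIM('a))"
        by (intro sum_strict_mono) auto
      then show False using norm_le_l1[of "T \<xi>"] by simp
    qed
    then obtain b where b: "b \<in> Basis" "norm (T \<xi>) \<le> DIM('a) * \<bar>T \<xi> \<bullet> b\<bar>" by blast
    have "B * norm \<xi> \<le> DIM('a) * \<bar>T \<xi> \<bullet> b\<bar>" using B(2)[of \<xi>] b(2) by linarith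
    then have "norm \<xi> \<le> DIM('a) / B * \<bar>T \<xi> \<bullet> b\<bar>" using B(1) by (simp add: field_simps)
    then have "norm \<xi> ^ k * norm (?F \<xi>) \<le> (DIM('a) / B * \<bar>T \<xi> \<bullet> b\<bar>) ^ k * norm (?F \<xi>)"
      by (intro mult_right_mono power_mono) auto
    also have "\<dots> = (DIM('a) / B) ^ k * (\<bar>T \<xi> \<bullet> b\<bar> ^ k * norm (?F \<xi>))"
      by (simp only: power_mult_distrib mult.assoc)
    also have "\<dots> \<le> (DIM('a) / B) ^ k * (\<Sum>b\<in>Basis. C b)"
      using B(1) C[OF b(1)] member_le_sum[OF b(1), of C] C0
      by (intro mult_left_mono) (auto intro: order_trans)
    finally show ?thesis .
  qed
  then show "\<exists>C. \<forall>x. norm x ^ k * norm (?F x) \<le> C" by blast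
qed

lemma ft_chirp_decaying:
  assumes "poly_schwartz g"
  shows "decaying (ft (\<lambda>x. chirp c x * g x))"
  by (intro rapid_decaying ft_chirp_rapid continuous_on_ft decaying_integrable decaying_chirp
      poly_schwartz_decaying assms)


lemma ft_scaleR:
  assumes [measurable]: "g \<in> borel_measurable borel" and "a \<noteq> 0"
  shows "ft (\<lambda>x. g (a *\<^sub>R x)) \<xi> = of_real (1 / \<bar>a\<bar> ^ DIM('a)) * ft g ((1 / a) *\<^sub>R \<xi>)"
proof -
  have "ft g ((1 / a) *\<^sub>R \<xi>) = of_real (\<bar>a\<bar> ^ DIM('a)) * (LINT x|lborel. echar (- form ((1 / a) *\<^sub>R \<xi>) (a *\<^sub>R x)) * g (a *\<^sub>R x))"
    unfolding ft_def using assms(2) by (intro integral_lborel_scaleR) measurable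
  also have "\<dots> = of_real (\<bar>a\<bar> ^ DIM('a)) * ft (\<lambda>x. g (a *\<^sub>R x)) \<xi>"
    using assms(2) by (simp add: ft_def form_simps)
  finally show ?thesis using assms(2) by simp
qed

lemma ft_minus: "g \<in> borel_measurable borel \<Longrightarrow> ft (\<lambda>x. g (- x)) \<xi> = ft g (- \<xi>)"
  using ft_scaleR[of g "-1" \<xi>] by simp

lemma ft_cmult: "ft (\<lambda>x. c * u x) \<xi> = c * ft u \<xi>"
  unfolding ft_def by (subst integral_mult_right_zero[symmetric]) (simp add: mult_ac)

text \<open>Closed under all chirps, with members and transforms that decay: inversion, Plancherel
  and Poisson summation apply throughout this class.\<close>

definition chirped :: "('a \<Rightarrow> complex) \<Rightarrow> bool" where
  "chirped u \<longleftrightarrow> (\<exists>c g. poly_schwartz g \<and> u = (\<lambda>x. chirp c x * g x))"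

lemma chirped_decaying: "chirped u \<Longrightarrow> decaying u"
  by (auto simp: chirped_def intro: decaying_chirp poly_schwartz_decaying)

lemma chirped_ft_decaying: "chirped u \<Longrightarrow> decaying (ft u)"
  by (auto simp: chirped_def intro: ft_chirp_decaying)

lemma chirped_chirp:
  assumes "chirped u"
  shows "chirped (\<lambda>x. chirp c x * u x)"
proof -
  obtain a g where g: "poly_schwartz g" "u = (\<lambda>x. chirp a x * g x)"
    using assms by (auto simp: chirped_def)
  then show ?thesis
    unfolding chirped_def by (intro exI[of _ "c + a"] exI[of _ g]) (simp add: chirp_add mult.assoc)
qed

lemma chirped_poly_schwartz: "poly_schwartz g \<Longrightarrow> chirped g"
  unfolding chirped_def by (intro exI[of _ 0] exI[of _ g]) simp

section \<open>Convolution with a chirp\<close>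

definition conv :: "real \<Rightarrow> ('a \<Rightarrow> complex) \<Rightarrow> 'a \<Rightarrow> complex" where
  "conv c u x = (LINT y|lborel. chirp c (x - y) * u y)"

text \<open>Expanding \<open>form (x - y) (x - y)\<close> leaves two chirps and a character. This
  yields the decay of the convolution, although the chirp itself does not decay.\<close>

lemma conv_eq: "conv c u x = chirp c x * ft (\<lambda>y. chirp c y * u y) (c *\<^sub>R x)"
proof -
  have "chirp c (x - y) = chirp c x * (echar (- form (c *\<^sub>R x) y) * chirp c y)" for y
  proof -
    have "c * form (x - y) (x - y) / 2 = c * form x x / 2 + (- form (c *\<^sub>R x) y + c * form y y / 2)"
      by (simp add: form_simps form_commute[of y x] field_simps)
    then show ?thesis by (simp only: chirp_def echar_add)
  qed
  then show ?thesis
    unfolding conv_def ft_def by (subst integral_mult_right_zero[symmetric]) (simp add: mult.assoc)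
qed

lemma decaying_conv:
  assumes "decaying (ft (\<lambda>y. chirp c y * u y))" "c \<noteq> 0"
  shows "decaying (conv c u)"
  unfolding conv_eq[abs_def] by (intro decaying_chirp decaying_scaleR assms)

text \<open>Both sides are the total integral of \<open>chirp c\<close> convolved with \<open>u\<close> and \<open>v\<close>.\<close>

lemma LINT_conv_swap:
  assumes u: "integrable lborel u" and v: "integrable lborel v"
    and cu: "integrable lborel (conv c u)" and cv: "integrable lborel (conv c v)"
  shows "(LINT x|lborel. conv c u x) * (LINT x|lborel. v x) = (LINT x|lborel. conv c v x) * (LINT x|lborel. u x)"
proof -
  have *: "(LINT x|lborel. conv c u x) * (LINT x|lborel. v x) = (LINT x|lborel. LINT y|lborel. conv c u (x - y) * v y)"
    if v: "integrable lborel v" and cu: "integrable lborel (conv c u)" for u v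
  proof -
    have [measurable]: "conv c u \<in> borel_measurable borel" "v \<in> borel_measurable borel"
      using v cu by auto
    have shift: "integrable lborel (\<lambda>x. conv c u (x - a))" "(LINT x|lborel. conv c u (x - a)) = (LINT x|lborel. conv c u x)"
      "(LINT x|lborel. norm (conv c u (x - a))) = (LINT x|lborel. norm (conv c u x))" for a
    proof -
      show "integrable lborel (\<lambda>x. conv c u (x - a))" "(LINT x|lborel. conv c u (x - a)) = (LINT x|lborel. conv c u x)"
        using integrable_lborel_shift[of "conv c u" "- a"] integral_lborel_shift[of "conv c u" "- a"] cu by simp_all
      have "(LINT x|lborel. complex_of_real (norm (conv c u (x + - a)))) = (LINT x|lborel. complex_of_real (norm (conv c u x)))"
        by (rule integral_lborel_shift[of "\<lambda>x. complex_of_real (norm (conv c u x))"]) simp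
      then show "(LINT x|lborel. norm (conv c u (x - a))) = (LINT x|lborel. norm (conv c u x))" by simp
    qed
    have "integrable (lborel \<Otimes>\<^sub>M lborel) (\<lambda>(y, x). conv c u (x - y) * v y)"
      by (rule lborel_pair.Fubini_integrable) (use v in \<open>auto simp: shift norm_mult\<close>)
    then have "(LINT x|lborel. LINT y|lborel. conv c u (x - y) * v y) = (LINT y|lborel. LINT x|lborel. conv c u (x - y) * v y)"
      by (rule lborel_pair.Fubini_integral)
    then show ?thesis by (simp add: shift)
  qed
  have "(LINT y|lborel. conv c u (x - y) * v y) = (LINT y|lborel. conv c v (x - y) * u y)" for x
  proof -
    have "(LINT y|lborel. conv c u (x - y) * v y) = (LINT y|lborel. LINT z|lborel. chirp c (x - y - z) * (v y * u z))"
      unfolding conv_def by (subst integral_mult_left_zero[symmetric]) (simp add: mult_ac)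
    also have "\<dots> = (LINT z|lborel. LINT y|lborel. chirp c (x - y - z) * (v y * u z))"
      by (rule Fubini_bounded_kernel[OF v u]) auto
    also have "\<dots> = (LINT z|lborel. conv c v (x - z) * u z)"
      unfolding conv_def by (subst integral_mult_left_zero[symmetric]) (simp add: mult_ac diff_diff_eq add.commute)
    finally show ?thesis .
  qed
  then show ?thesis using *[OF v cu] *[OF u cv] by simp
qed

lemma conv_modulate:
  "conv c (\<lambda>x. echar (- form \<xi> x) * u x) x = chirp c x * ft (\<lambda>x. chirp c x * u x) (c *\<^sub>R x + \<xi>)"
proof -
  have "ft (\<lambda>y. chirp c y * (echar (- form \<xi> y) * u y)) (c *\<^sub>R x) = ft (\<lambda>x. chirp c x * u x) (c *\<^sub>R x + \<xi>)"
    unfolding ft_def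
  proof (rule Bochner_Integration.integral_cong[OF refl])
    fix y
    have "- form (c *\<^sub>R x + \<xi>) y = - form (c *\<^sub>R x) y + - form \<xi> y" by (simp add: form_simps)
    then show "echar (- form (c *\<^sub>R x) y) * (chirp c y * (echar (- form \<xi> y) * u y))
        = echar (- form (c *\<^sub>R x + \<xi>) y) * (chirp c y * u y)"
      by (simp only: echar_add mult_ac)
  qed
  then show ?thesis by (simp add: conv_eq)
qed

text \<open>Completing the square: substituting x + xi / c removes the cross term and releases the
  chirp with parameter -1 / c. What remains is the plain integral of a convolution.\<close>

lemma ft_conv_eq:
  assumes "decaying (ft (\<lambda>x. chirp c x * u x))" and c: "c \<noteq> 0"
  shows "ft (conv c u) \<xi> = chirp (- 1 / c) \<xi> * (LINT x|lborel. conv c (\<lambda>x. echar (- form \<xi> x) * u x) x)"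
proof -
  define \<Phi> where "\<Phi> = ft (\<lambda>x. chirp c x * u x)"
  have [measurable]: "\<Phi> \<in> borel_measurable borel"
    unfolding \<Phi>_def by (rule decaying_measurable[OF assms(1)])
  have "ft (conv c u) \<xi> = (LINT x|lborel. echar (- form \<xi> x) * (chirp c x * \<Phi> (c *\<^sub>R x)))"
    by (simp add: ft_def[of "conv c u"] conv_eq \<Phi>_def)
  also have "\<dots> = (LINT x|lborel. echar (- form \<xi> (x + (1 / c) *\<^sub>R \<xi>)) * (chirp c (x + (1 / c) *\<^sub>R \<xi>) * \<Phi> (c *\<^sub>R (x + (1 / c) *\<^sub>R \<xi>))))"
    by (rule integral_lborel_shift[symmetric]) measurable
  also have "\<dots> = (LINT x|lborel. chirp (- 1 / c) \<xi> * (chirp c x * \<Phi> (c *\<^sub>R x + \<xi>)))"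
  proof (rule Bochner_Integration.integral_cong[OF refl])
    fix x
    have "- form \<xi> (x + (1 / c) *\<^sub>R \<xi>) + c * form (x + (1 / c) *\<^sub>R \<xi>) (x + (1 / c) *\<^sub>R \<xi>) / 2
        = (- 1 / c) * form \<xi> \<xi> / 2 + c * form x x / 2"
      using c by (simp add: form_simps form_commute[of x \<xi>] field_simps)
    then have "echar (- form \<xi> (x + (1 / c) *\<^sub>R \<xi>)) * chirp c (x + (1 / c) *\<^sub>R \<xi>) = chirp (- 1 / c) \<xi> * chirp c x"
      by (simp only: chirp_def echar_add[symmetric])
    then show "echar (- form \<xi> (x + (1 / c) *\<^sub>R \<xi>)) * (chirp c (x + (1 / c) *\<^sub>R \<xi>) * \<Phi> (c *\<^sub>R (x + (1 / c) *\<^sub>R \<xi>)))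
        = chirp (- 1 / c) \<xi> * (chirp c x * \<Phi> (c *\<^sub>R x + \<xi>))"
      using c by (simp add: scaleR_add_right flip: mult.assoc)
  qed
  also have "\<dots> = chirp (- 1 / c) \<xi> * (LINT x|lborel. chirp c x * \<Phi> (c *\<^sub>R x + \<xi>))"
    by simp
  finally show ?thesis by (simp add: conv_modulate \<Phi>_def)
qed

text \<open>The Fourier transform of a chirp is a multiple of a chirp, in the form of a convolution theorem. The
  constant is not evaluated: symmetry of convolution shows that it does not depend on \<open>u\<close>, and Plancherel
  gives its modulus.\<close>

theorem ft_conv_chirp:
  assumes c: "c \<noteq> 0"
  shows "\<exists>\<kappa>. norm \<kappa> = \<bar>c\<bar> powr (- (DIM('a) / 2)) \<and>
     (\<forall>u \<xi>. chirped u \<longrightarrow> ft (conv c u) \<xi> = \<kappa> * chirp (- 1 / c) \<xi> * ft u \<xi>)"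
proof -
  define J where "J u \<xi> = (LINT x|lborel. conv c (\<lambda>x. echar (- form \<xi> x) * u x) x)" for u \<xi>
  have ftJ: "ft (conv c u) \<xi> = chirp (- 1 / c) \<xi> * J u \<xi>" if "chirped u" for u \<xi>
    unfolding J_def by (intro ft_conv_eq chirped_ft_decaying chirped_chirp that c)
  have dec_conv: "decaying (conv c (\<lambda>x. echar (- form \<xi> x) * u x))" if "chirped u" for u \<xi>
  proof -
    have "decaying (\<lambda>x. ft (\<lambda>x. chirp c x * u x) (c *\<^sub>R (x + (1 / c) *\<^sub>R \<xi>)))"
      using decaying_shift[OF decaying_scaleR[OF chirped_ft_decaying[OF chirped_chirp[OF that]] c]] .
    then have "decaying (\<lambda>x. ft (\<lambda>x. chirp c x * u x) (c *\<^sub>R x + \<xi>))"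
      using c by (simp add: scaleR_add_right)
    then show ?thesis unfolding conv_modulate by (rule decaying_chirp)
  qed
  \<comment> \<open>Separation of variables: the ratio of \<open>J u\<close> to \<open>ft u\<close>
    is the same for all functions and frequencies, hence a constant.\<close>
  have sym: "J u \<xi> * ft v \<eta> = J v \<eta> * ft u \<xi>" if uv: "chirped u" "chirped v" for u v \<xi> \<eta>
  proof -
    have "integrable lborel (\<lambda>x. echar (- form \<xi> x) * w x)" if "chirped w" for w \<xi>
      by (intro decaying_integrable decaying_mult_bounded[where K = 1] chirped_decaying that continuous_intros) simp
    then show ?thesis
      unfolding J_def ft_def using uv by (intro LINT_conv_swap decaying_integrable[OF dec_conv])
  qed
  show ?thesis
  proof (cases "\<exists>v \<eta>. chirped v \<and> ft v \<eta> \<noteq> 0")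
    \<comment> \<open>If all transforms vanish, inversion makes every member of the class zero and
      any constant of the right modulus will do. This spares exhibiting a nonzero Schwartz
      function.\<close>
    case False
    have "ft (conv c u) \<xi> = 0" if u: "chirped u" for u \<xi>
    proof -
      have "u x = 0" for x
        using ft_inversion[OF chirped_decaying[OF u] chirped_ft_decaying[OF u], of "- x"] False u
        by (simp add: ft_def[of "ft u"])
      then show ?thesis by (simp add: conv_def[abs_def] ft_def)
    qed
    then show ?thesis
      using False by (intro exI[of _ "of_real (\<bar>c\<bar> powr (- (DIM('a) / 2)))"]) auto
  next
    case True
    then obtain v \<eta> where v: "chirped v" "ft v \<eta> \<noteq> 0" by blast
    define \<kappa> where "\<kappa> = J v \<eta> / ft v \<eta>"
    have \<kappa>: "ft (conv c u) \<xi> = \<kappa> * chirp (- 1 / c) \<xi> * ft u \<xi>" if "chirped u" for u \<xi>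
      using sym[OF that v(1), of \<xi> \<eta>] v(2) by (simp add: ftJ[OF that] \<kappa>_def field_simps)
    define I where "I = (LINT x|lborel. (norm (v x))\<^sup>2)"
    have I: "(LINT x|lborel. w x * cnj (w x)) = of_real (LINT x|lborel. (norm (w x))\<^sup>2)" for w :: "'a \<Rightarrow> complex"
      unfolding complex_norm_square[symmetric] by (rule integral_complex_of_real)
    have dv: "decaying v" "decaying (ft v)" "decaying (\<lambda>x. chirp c x * v x)" "decaying (ft (\<lambda>x. chirp c x * v x))"
      using v(1) by (intro chirped_decaying chirped_ft_decaying chirped_chirp; assumption)+
    have dw: "decaying (conv c v)" by (rule decaying_conv[OF dv(4) c])
    have "decaying (\<lambda>\<xi>. \<kappa> * chirp (- 1 / c) \<xi> * ft v \<xi>)"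
      using decaying_cmult[OF decaying_chirp[OF dv(2)]] by (simp add: mult.assoc)
    then have dfw: "decaying (ft (conv c v))" by (simp add: \<kappa>[OF v(1), abs_def])
    \<comment> \<open>The squared L2 norm of the convolution is computed twice: directly, where
      dilation by c yields the power of |c|, and through its transform, where the squared modulus of
      kappa appears.\<close>
    have "(LINT x|lborel. conv c v x * cnj (conv c v x)) = (LINT x|lborel. ft (\<lambda>x. chirp c x * v x) (c *\<^sub>R x) * cnj (ft (\<lambda>x. chirp c x * v x) (c *\<^sub>R x)))"
      unfolding I by (simp add: conv_eq norm_mult)
    also have "\<dots> = of_real (1 / \<bar>c\<bar> ^ DIM('a)) * (LINT x|lborel. ft (\<lambda>x. chirp c x * v x) x * cnj (ft (\<lambda>x. chirp c x * v x) x))"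
    proof -
      have "(\<lambda>x. ft (\<lambda>x. chirp c x * v x) x * cnj (ft (\<lambda>x. chirp c x * v x) x)) \<in> borel_measurable borel"
        by (intro borel_measurable_continuous_onI continuous_intros decaying_continuous dv(4))
      from integral_lborel_scaleR[OF this c] show ?thesis using c by simp
    qed
    also have "(LINT x|lborel. ft (\<lambda>x. chirp c x * v x) x * cnj (ft (\<lambda>x. chirp c x * v x) x)) = of_real I"
      unfolding ft_plancherel[OF dv(3,4)] I by (simp add: norm_mult I_def)
    finally have 1: "(LINT x|lborel. conv c v x * cnj (conv c v x)) = of_real (I / \<bar>c\<bar> ^ DIM('a))"
      by simp
    have "(LINT x|lborel. conv c v x * cnj (conv c v x)) = (LINT x|lborel. ft (conv c v) x * cnj (ft (conv c v) x))"
      by (rule ft_plancherel[OF dw dfw, symmetric])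
    also have "\<dots> = of_real ((norm \<kappa>)\<^sup>2) * (LINT x|lborel. ft v x * cnj (ft v x))"
      unfolding I by (simp add: \<kappa>[OF v(1)] norm_mult power_mult_distrib)
    also have "\<dots> = of_real ((norm \<kappa>)\<^sup>2 * I)"
      unfolding ft_plancherel[OF dv(1,2)] I by (simp add: I_def)
    finally have "complex_of_real ((norm \<kappa>)\<^sup>2 * I) = of_real (I / \<bar>c\<bar> ^ DIM('a))" using 1 by simp
    then have "(norm \<kappa>)\<^sup>2 * I = I / \<bar>c\<bar> ^ DIM('a)" by (simp only: of_real_eq_iff)
    moreover have "I \<noteq> 0"
    proof
      assume "I = 0"
      \<comment> \<open>The integral of a non-integrable function is 0 by convention, so
        \<open>I = 0\<close> says something about v only once integrability is known.\<close>
      have "integrable lborel (\<lambda>x. v x * cnj (v x))"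
      proof -
        obtain C where C: "C \<ge> 0" "\<And>x. norm (v x) \<le> C * decay x"
          using decaying_bound[OF dv(1)] by blast
        have "norm (cnj (v x)) \<le> C" for x
        proof -
          have "decay x \<le> 1" unfolding decay_def by (intro prod_le_1) auto
          then have "C * decay x \<le> C" using C(1) by (simp add: mult_left_le)
          then show ?thesis using C(2)[of x] by simp
        qed
        then have "decaying (\<lambda>x. cnj (v x) * v x)"
          by (intro decaying_mult_bounded[OF dv(1)] decaying_continuous decaying_cnj dv(1))
        then show ?thesis using decaying_integrable by (simp add: mult.commute)
      qed
      then have "integrable lborel (\<lambda>x. (norm (v x))\<^sup>2)"
        unfolding complex_norm_square[symmetric] by (simp only: complex_of_real_integrable_eq)
      then have "AE x in lborel. (norm (v x))\<^sup>2 = 0"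
        using \<open>I = 0\<close> unfolding I_def by (subst (asm) integral_nonneg_eq_0_iff_AE) auto
      then have zero: "AE x in lborel. echar (- form \<eta> x) * v x = 0"
        by (auto elim: eventually_mono)
      have [measurable]: "v \<in> borel_measurable borel" by (rule decaying_measurable[OF dv(1)])
      have "(LINT x|lborel. echar (- form \<eta> x) * v x) = (LINT x|(lborel :: 'a measure). 0)"
        using zero by (rule Bochner_Integration.integral_cong_AE[rotated 2]) measurable
      then have "ft v \<eta> = 0" by (simp add: ft_def)
      then show False using v(2) by simp
    qed
    ultimately have "(norm \<kappa>)\<^sup>2 = 1 / \<bar>c\<bar> ^ DIM('a)" using c by (simp add: field_simps)
    also have "\<dots> = \<bar>c\<bar> powr (- (DIM('a) / 2) + - (DIM('a) / 2))"
      using c by (simp add: powr_minus_divide powr_realpow)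
    also have "\<dots> = (\<bar>c\<bar> powr (- (DIM('a) / 2)))\<^sup>2"
      by (simp only: power2_eq_square powr_add)
    finally have "norm \<kappa> = \<bar>c\<bar> powr (- (DIM('a) / 2))"
      by (simp add: power2_eq_iff_nonneg)
    then show ?thesis using \<kappa> by blast
  qed
qed

section \<open>The projective representation of the rotation group\<close>

text \<open>Expanding the exponent of the kernel gives an outer chirp, a transform at x / sin phi
  and an inner chirp, both chirps with parameter cot phi. At the singular angles cos phi is 1 or -1,
  so one formula covers the identity and the reflection.\<close>

definition weil :: "real \<Rightarrow> ('a \<Rightarrow> complex) \<Rightarrow> 'a \<Rightarrow> complex" where
  "weil \<phi> f x = (if sin \<phi> = 0 then f (cos \<phi> *\<^sub>R x)
     else of_real (\<bar>sin \<phi>\<bar> powr (- (DIM('a) / 2)))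
          * (chirp (cot \<phi>) x * ft (\<lambda>y. chirp (cot \<phi>) y * f y) ((1 / sin \<phi>) *\<^sub>R x)))"

lemma weil_decaying:
  assumes "poly_schwartz f"
  shows "decaying (weil \<phi> f)"
proof (cases "sin \<phi> = 0")
  case True
  then have "cos \<phi> \<noteq> 0" using sin_zero_abs_cos_one[of \<phi>] by auto
  then show ?thesis
    using True unfolding weil_def[abs_def] by (auto intro: decaying_scaleR poly_schwartz_decaying assms)
next
  case False
  then show ?thesis
    using decaying_cmult[OF decaying_chirp[OF decaying_scaleR[OF chirped_ft_decaying[OF
      chirped_chirp[OF chirped_poly_schwartz[OF assms]]]]]]
    unfolding weil_def[abs_def] by simp
qed

text \<open>The convolution theorem with c = -1 / C, read backwards: the transform of the
  convolution is a multiple of \<open>chirp C\<close> times \<open>ft g\<close>, so transforming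
  again recovers the convolution by inversion. The constant becomes the reciprocal.\<close>

lemma ft_chirp_ft:
  assumes "C \<noteq> 0"
  shows "\<exists>\<kappa>. norm \<kappa> = \<bar>C\<bar> powr (- (DIM('a) / 2)) \<and>
     (\<forall>g w. chirped g \<longrightarrow> ft (\<lambda>z. chirp C z * ft g z) w
        = \<kappa> * (chirp (- 1 / C) w * ft (\<lambda>y. chirp (- 1 / C) y * g y) ((1 / C) *\<^sub>R w)))"
proof -
  define c where "c = - 1 / C"
  have c: "c \<noteq> 0" "- 1 / c = C" using assms by (auto simp: c_def)
  obtain \<kappa> where \<kappa>: "norm \<kappa> = \<bar>c\<bar> powr (- (DIM('a) / 2))"
    "\<And>u \<xi>. chirped u \<Longrightarrow> ft (conv c u) \<xi> = \<kappa> * chirp C \<xi> * ft u \<xi>"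
    using ft_conv_chirp[OF c(1)] unfolding c(2) by blast
  have ne: "\<kappa> \<noteq> 0" using \<kappa>(1) c(1) by auto
  have "ft (\<lambda>z. chirp C z * ft g z) w = (1 / \<kappa>) * (chirp c w * ft (\<lambda>y. chirp c y * g y) ((1 / C) *\<^sub>R w))"
    if g: "chirped g" for g w
  proof -
    have d: "decaying (conv c g)"
      by (intro decaying_conv chirped_ft_decaying chirped_chirp g c(1))
    have "decaying (\<lambda>\<xi>. \<kappa> * chirp C \<xi> * ft g \<xi>)"
      using decaying_cmult[OF decaying_chirp[OF chirped_ft_decaying[OF g]]] by (simp add: mult.assoc)
    then have fd: "decaying (ft (conv c g))" by (simp add: \<kappa>(2)[OF g, abs_def])
    have "chirp C z * ft g z = 1 / \<kappa> * ft (conv c g) z" for z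
      using ne by (simp add: \<kappa>(2)[OF g])
    then have "ft (\<lambda>z. chirp C z * ft g z) w = 1 / \<kappa> * ft (ft (conv c g)) w"
      by (simp only: ft_cmult)
    also have "ft (ft (conv c g)) w = conv c g (- w)" by (rule ft_inversion[OF d fd])
    also have "\<dots> = chirp c w * ft (\<lambda>y. chirp c y * g y) ((1 / C) *\<^sub>R w)"
      by (simp add: conv_eq) (simp add: c_def)
    finally show ?thesis .
  qed
  moreover have "norm (1 / \<kappa>) = \<bar>C\<bar> powr (- (DIM('a) / 2))"
    using assms by (simp add: norm_divide \<kappa>(1) c_def powr_divide powr_minus field_simps)
  ultimately show ?thesis unfolding c_def[symmetric] by blast
qed

text \<open>The constant is chosen before f and x, since both theta sums must acquire the same one.
  The cases are: phi singular, the sum singular, neither.\<close>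

theorem weil_comp:
  assumes \<theta>: "sin \<theta> \<noteq> 0"
  shows "\<exists>\<kappa>. norm \<kappa> = 1 \<and> (\<forall>f x. poly_schwartz f \<longrightarrow> weil \<theta> (weil \<phi> f) x = \<kappa> * weil (\<theta> + \<phi>) f x)"
proof -
  consider "sin \<phi> = 0" | "sin \<phi> \<noteq> 0" "sin (\<theta> + \<phi>) = 0" | "sin \<phi> \<noteq> 0" "sin (\<theta> + \<phi>) \<noteq> 0" by blast
  then show ?thesis
  proof cases
    case 1
    define s where "s = cos \<phi>"
    have s: "s = 1 \<or> s = -1" using sin_zero_abs_cos_one[OF 1] by (auto simp: s_def abs_if split: if_splits)
    have add: "sin (\<theta> + \<phi>) = s * sin \<theta>" "cos (\<theta> + \<phi>) = s * cos \<theta>"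
      using 1 by (simp_all add: sin_add cos_add s_def)
    then have cot: "cot (\<theta> + \<phi>) = cot \<theta>" using s by (auto simp: cot_def)
    have "weil \<theta> (weil \<phi> f) x = weil (\<theta> + \<phi>) f x" if f: "poly_schwartz f" for f x
    proof -
      have m: "(\<lambda>y. chirp (cot \<theta>) y * f y) \<in> borel_measurable borel"
        by (intro decaying_measurable decaying_chirp poly_schwartz_decaying f)
      have "weil \<phi> f = (\<lambda>x. f (s *\<^sub>R x))" using 1 by (auto simp: weil_def s_def)
      then show ?thesis
        using s \<theta> ft_minus[OF m, of "(1 / sin \<theta>) *\<^sub>R x"] by (auto simp: weil_def add cot)
    qed
    then show ?thesis by (intro exI[of _ 1]) auto
  next
    case 2
    define s where "s = cos (\<theta> + \<phi>)"
    have s: "s = 1 \<or> s = -1" using sin_zero_abs_cos_one[OF 2(2)] by (auto simp: s_def abs_if split: if_splits)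
    \<comment> \<open>Here phi is congruent to -theta modulo pi, so the chirps between the two
      transforms cancel and a pure double transform is left.\<close>
    have "sin \<phi> = sin ((\<theta> + \<phi>) - \<theta>)" "cos \<phi> = cos ((\<theta> + \<phi>) - \<theta>)" by simp_all
    then have sc: "sin \<phi> = - s * sin \<theta>" "cos \<phi> = s * cos \<theta>"
      by (simp_all only: sin_diff cos_diff 2(2) s_def)
    then have cot: "cot \<phi> = - cot \<theta>" using s by (auto simp: cot_def)
    have abs: "\<bar>sin \<phi>\<bar> = \<bar>sin \<theta>\<bar>" using s sc by auto
    define p where "p = \<bar>sin \<theta>\<bar> powr (- (DIM('a) / 2))"
    have pp: "p * p * \<bar>sin \<theta>\<bar> ^ DIM('a) = 1"
      using \<theta> by (simp add: p_def powr_realpow[symmetric] flip: powr_add)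
    have "weil \<theta> (weil \<phi> f) x = weil (\<theta> + \<phi>) f x" if f: "poly_schwartz f" for f x
    proof -
      define g where "g y = chirp (- cot \<theta>) y * f y" for y
      have g: "chirped g" unfolding g_def[abs_def] by (intro chirped_chirp chirped_poly_schwartz f)
      have a: "1 / (- s * sin \<theta>) \<noteq> 0" using s \<theta> by auto
      have "chirp (cot \<theta>) y * weil \<phi> f y = of_real p * ft g ((1 / (- s * sin \<theta>)) *\<^sub>R y)" for y
      proof -
        have "chirp (cot \<theta>) y * chirp (- cot \<theta>) y = 1" by (simp flip: chirp_add)
        moreover have "weil \<phi> f y = of_real p * (chirp (- cot \<theta>) y * ft g ((1 / (- s * sin \<theta>)) *\<^sub>R y))"
          unfolding weil_def cot abs p_def[symmetric] g_def[abs_def] using 2(1) by (simp add: sc)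
        ultimately show ?thesis by (simp add: mult_ac)
      qed
      then have ft_eq: "ft (\<lambda>y. chirp (cot \<theta>) y * weil \<phi> f y) \<xi>
          = of_real p * (of_real (1 / \<bar>1 / (- s * sin \<theta>)\<bar> ^ DIM('a)) * ft (ft g) ((1 / (1 / (- s * sin \<theta>))) *\<^sub>R \<xi>))" for \<xi>
        by (simp only: ft_cmult ft_scaleR[OF decaying_measurable[OF chirped_ft_decaying[OF g]] a])
      have "1 / \<bar>1 / (- s * sin \<theta>)\<bar> ^ DIM('a) = \<bar>sin \<theta>\<bar> ^ DIM('a)"
        using s by (auto simp: power_divide)
      then have "weil \<theta> (weil \<phi> f) x
          = of_real (p * p * \<bar>sin \<theta>\<bar> ^ DIM('a)) * (chirp (cot \<theta>) x * ft (ft g) (((1 / (1 / (- s * sin \<theta>)))) *\<^sub>R (1 / sin \<theta>) *\<^sub>R x))"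
        using \<theta> by (simp add: weil_def[of \<theta>] p_def[symmetric] ft_eq mult_ac)
      also have "((1 / (1 / (- s * sin \<theta>)))) *\<^sub>R (1 / sin \<theta>) *\<^sub>R x = - (s *\<^sub>R x)"
        using \<theta> by simp
      also have "ft (ft g) (- (s *\<^sub>R x)) = g (s *\<^sub>R x)"
        using ft_inversion[OF chirped_decaying[OF g] chirped_ft_decaying[OF g], of "- (s *\<^sub>R x)"] by simp
      also have "g (s *\<^sub>R x) = chirp (- cot \<theta>) x * f (s *\<^sub>R x)"
        using s by (auto simp: g_def)
      also have "chirp (cot \<theta>) x * (chirp (- cot \<theta>) x * f (s *\<^sub>R x)) = f (s *\<^sub>R x)"
        by (simp flip: mult.assoc chirp_add)
      finally show ?thesis using pp 2(2) by (simp add: weil_def[of "\<theta> + \<phi>"] s_def)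
    qed
    then show ?thesis by (intro exI[of _ 1]) auto
  next
    case 3
    define S where "S = sin (\<theta> + \<phi>)"
    \<comment> \<open>Between the transforms stands a chirp with parameter cot theta + cot phi = S /
      (sin theta sin phi); after dilation by sin phi the parameter is C.\<close>
    define C where "C = S * sin \<phi> / sin \<theta>"
    have S: "S \<noteq> 0" using 3 by (simp add: S_def)
    have C: "C \<noteq> 0" using 3 \<theta> by (simp add: C_def S_def)
    have Seq: "S = sin \<theta> * cos \<phi> + cos \<theta> * sin \<phi>" by (simp add: S_def sin_add)
    have Ceq: "(cot \<theta> + cot \<phi>) * (sin \<phi>)\<^sup>2 = C"
      using 3(1) \<theta> by (simp add: C_def Seq cot_def field_simps power2_eq_square)
    \<comment> \<open>1 / C is the difference of cot phi and cot (theta + phi), so the chirp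
      released by \<open>ft_chirp_ft\<close> completes the inner parameter; \<open>cot2\<close> does
      the same for the outer chirp.\<close>
    have cot1: "- 1 / C + cot \<phi> = cot (\<theta> + \<phi>)"
    proof -
      have "cot \<phi> - cot (\<theta> + \<phi>) = (cos \<phi> * sin (\<theta> + \<phi>) - cos (\<theta> + \<phi>) * sin \<phi>) / (S * sin \<phi>)"
        using 3 by (simp add: cot_def S_def field_simps)
      also have "cos \<phi> * sin (\<theta> + \<phi>) - cos (\<theta> + \<phi>) * sin \<phi> = sin ((\<theta> + \<phi>) - \<phi>)"
        by (simp only: sin_diff mult.commute)
      finally show ?thesis by (simp add: C_def)
    qed
    have cot2: "cot \<theta> + (- 1 / C) * (sin \<phi> / sin \<theta>)\<^sup>2 = cot (\<theta> + \<phi>)"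
    proof -
      have "cot \<theta> - cot (\<theta> + \<phi>) = (cos \<theta> * sin (\<theta> + \<phi>) - cos (\<theta> + \<phi>) * sin \<theta>) / (S * sin \<theta>)"
        using 3 \<theta> by (simp add: cot_def S_def field_simps)
      also have "cos \<theta> * sin (\<theta> + \<phi>) - cos (\<theta> + \<phi>) * sin \<theta> = sin ((\<theta> + \<phi>) - \<theta>)"
        by (simp only: sin_diff mult.commute)
      also have "sin ((\<theta> + \<phi>) - \<theta>) = sin \<phi>" by simp
      finally show ?thesis using 3(1) \<theta> S by (simp add: C_def field_simps power2_eq_square)
    qed
    obtain \<kappa> where \<kappa>: "norm \<kappa> = \<bar>C\<bar> powr (- (DIM('a) / 2))"
      "\<And>g w. chirped g \<Longrightarrow> ft (\<lambda>z. chirp C z * ft g z) w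
        = \<kappa> * (chirp (- 1 / C) w * ft (\<lambda>y. chirp (- 1 / C) y * g y) ((1 / C) *\<^sub>R w))"
      using ft_chirp_ft[OF C] by blast
    define p where "p t = \<bar>t\<bar> powr (- (DIM('a) / 2))" for t :: real
    \<comment> \<open>K collects the normalising factors. The modulus of kappa is p C; as p is
      multiplicative and the square of p a is |a|^(-d), with d the dimension, K is
      unimodular.\<close>
    define K where "K = of_real (p (sin \<theta>) * p (sin \<phi>) * \<bar>sin \<phi>\<bar> ^ DIM('a) / p S) * \<kappa>"
    have pS: "p S \<noteq> 0" using S by (simp add: p_def)
    have "weil \<theta> (weil \<phi> f) x = K * weil (\<theta> + \<phi>) f x" if f: "poly_schwartz f" for f x
    proof -
      define g where "g y = chirp (cot \<phi>) y * f y" for y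
      have g: "chirped g" unfolding g_def[abs_def] by (intro chirped_chirp chirped_poly_schwartz f)
      have a: "1 / sin \<phi> \<noteq> 0" using 3 by simp
      define h where "h z = chirp C z * ft g z" for z
      have h: "h \<in> borel_measurable borel"
        unfolding h_def[abs_def] by (intro decaying_measurable decaying_chirp chirped_ft_decaying g)
      have "chirp (cot \<theta>) y * weil \<phi> f y = of_real (p (sin \<phi>)) * h ((1 / sin \<phi>) *\<^sub>R y)" for y
      proof -
        have "chirp C ((1 / sin \<phi>) *\<^sub>R y) = chirp (cot \<theta> + cot \<phi>) y"
          using 3(1) by (simp add: chirp_scaleR power_divide flip: Ceq)
        also have "\<dots> = chirp (cot \<theta>) y * chirp (cot \<phi>) y" by (rule chirp_add)
        finally show ?thesis
          using 3(1) by (simp add: weil_def h_def p_def g_def[abs_def] mult_ac)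
      qed
      then have "ft (\<lambda>y. chirp (cot \<theta>) y * weil \<phi> f y) \<xi>
          = of_real (p (sin \<phi>)) * (of_real (1 / \<bar>1 / sin \<phi>\<bar> ^ DIM('a)) * ft h ((1 / (1 / sin \<phi>)) *\<^sub>R \<xi>))" for \<xi>
        by (simp only: ft_cmult ft_scaleR[OF h a])
      then have "weil \<theta> (weil \<phi> f) x
          = of_real (p (sin \<theta>) * p (sin \<phi>) * \<bar>sin \<phi>\<bar> ^ DIM('a)) * (chirp (cot \<theta>) x * ft h ((sin \<phi> / sin \<theta>) *\<^sub>R x))"
        using \<theta> by (simp add: weil_def[of \<theta>] p_def power_divide mult_ac)
      also have "ft h ((sin \<phi> / sin \<theta>) *\<^sub>R x) = \<kappa> * (chirp ((- 1 / C) * (sin \<phi> / sin \<theta>)\<^sup>2) x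
          * ft (\<lambda>y. chirp (- 1 / C) y * g y) ((1 / S) *\<^sub>R x))"
      proof -
        have "(1 / C) *\<^sub>R (sin \<phi> / sin \<theta>) *\<^sub>R x = (1 / S) *\<^sub>R x"
          using 3(1) \<theta> by (simp add: C_def)
        then show ?thesis by (simp only: h_def[abs_def] \<kappa>(2)[OF g] chirp_scaleR)
      qed
      also have "(\<lambda>y. chirp (- 1 / C) y * g y) = (\<lambda>y. chirp (cot (\<theta> + \<phi>)) y * f y)"
        unfolding g_def cot1[symmetric] chirp_add by (simp add: mult.assoc)
      also have "chirp (cot \<theta>) x * (\<kappa> * (chirp ((- 1 / C) * (sin \<phi> / sin \<theta>)\<^sup>2) x
          * ft (\<lambda>y. chirp (cot (\<theta> + \<phi>)) y * f y) ((1 / S) *\<^sub>R x)))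
          = \<kappa> * (chirp (cot (\<theta> + \<phi>)) x * ft (\<lambda>y. chirp (cot (\<theta> + \<phi>)) y * f y) ((1 / S) *\<^sub>R x))"
        unfolding cot2[symmetric] chirp_add by (simp only: mult_ac)
      also have "of_real (p S) * (chirp (cot (\<theta> + \<phi>)) x * ft (\<lambda>y. chirp (cot (\<theta> + \<phi>)) y * f y) ((1 / S) *\<^sub>R x)) = weil (\<theta> + \<phi>) f x"
        using 3(2) by (simp add: weil_def p_def S_def)
      then have "chirp (cot (\<theta> + \<phi>)) x * ft (\<lambda>y. chirp (cot (\<theta> + \<phi>)) y * f y) ((1 / S) *\<^sub>R x) = weil (\<theta> + \<phi>) f x / of_real (p S)"
        using pS by (simp add: field_simps)
      finally show ?thesis by (simp add: K_def)
    qed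
    moreover have "norm K = 1"
    proof -
      have pm: "p (a * b) = p a * p b" "p (a / b) = p a / p b" for a b
        by (simp_all add: p_def abs_mult powr_mult powr_divide)
      have p2: "p a * p a * \<bar>a\<bar> ^ DIM('a) = 1" if "a \<noteq> 0" for a
        using that by (simp add: p_def powr_realpow[symmetric] flip: powr_add)
      have pp: "p a > 0" if "a \<noteq> 0" for a using that by (simp add: p_def)
      have "norm \<kappa> = p S * p (sin \<phi>) / p (sin \<theta>)"
        unfolding \<kappa>(1) p_def[symmetric] C_def pm ..
      then have "norm K = p (sin \<theta>) * p (sin \<phi>) * \<bar>sin \<phi>\<bar> ^ DIM('a) / p S * (p S * p (sin \<phi>) / p (sin \<theta>))"
        using pp[OF S] pp[OF \<theta>] pp[OF 3(1)] by (simp add: K_def norm_mult norm_divide norm_power abs_mult)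
      also have "\<dots> = p (sin \<phi>) * p (sin \<phi>) * \<bar>sin \<phi>\<bar> ^ DIM('a)"
        using pp[OF S] pp[OF \<theta>] by (simp add: field_simps)
      finally show ?thesis using p2[OF 3(1)] by simp
    qed
    ultimately show ?thesis by blast
  qed
qed

end

section \<open>Theta sums of a self-dual form\<close>

lemma Re_Im_minus_inverse:
  "Re (- 1 / \<tau>) = - Re \<tau> / (norm \<tau>)\<^sup>2" "Im (- 1 / \<tau>) = Im \<tau> / (norm \<tau>)\<^sup>2"
  by (simp_all add: Re_divide Im_divide cmod_power2)

lemma sin_cos_Arg:
  assumes "\<tau> \<noteq> 0"
  shows "sin (Arg \<tau>) = Im \<tau> / norm \<tau>" "cos (Arg \<tau>) = Re \<tau> / norm \<tau>"
  using assms arg_cong[OF rcis_cmod_Arg[of \<tau>], of Re] arg_cong[OF rcis_cmod_Arg[of \<tau>], of Im]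
  by (simp_all add: field_simps)

context selfdual_form
begin

definition flow :: "complex \<Rightarrow> ('a \<Rightarrow> complex) \<Rightarrow> 'a \<Rightarrow> complex" where
  "flow \<tau> f x = of_real (Im \<tau> powr (DIM('a) / 4)) * (chirp (Re \<tau>) x * f (Im \<tau> powr (1/2) *\<^sub>R x))"

lemma flow_decaying: "Im \<tau> > 0 \<Longrightarrow> decaying f \<Longrightarrow> decaying (flow \<tau> f)"
  unfolding flow_def[abs_def] by (intro decaying_cmult decaying_chirp decaying_scaleR) auto

lemma flow_cmult: "flow \<tau> (\<lambda>x. c * f x) x = c * flow \<tau> f x"
  by (simp add: flow_def mult_ac)

text \<open>With u, v the real and imaginary parts of tau, cot (Arg tau) = u / v. Hence the chirp of
  \<open>flow tau\<close>, after dilation by the square root of v, is the inner chirp of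
  \<open>weil (Arg tau)\<close>.\<close>

lemma ft_flow:
  assumes \<tau>: "Im \<tau> > 0" and [measurable]: "f \<in> borel_measurable borel"
  shows "ft (flow \<tau> f) \<xi> = flow (- 1 / \<tau>) (weil (Arg \<tau>) f) \<xi>"
proof -
  define u v r where "u = Re \<tau>" and "v = Im \<tau>" and "r = norm \<tau>"
  have v: "v > 0" using \<tau> by (simp add: v_def)
  have r: "r > 0" using \<tau> by (auto simp: r_def)
  have trig: "sin (Arg \<tau>) = v / r" "cos (Arg \<tau>) = u / r"
    using sin_cos_Arg[of \<tau>] r by (auto simp: u_def v_def r_def)
  have cot: "cot (Arg \<tau>) = u / v" using r by (simp add: cot_def trig)
  have sqrt: "v powr (1/2) = sqrt v" "(v / r\<^sup>2) powr (1/2) = sqrt v / r"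
    using v r by (simp_all add: powr_half_sqrt real_sqrt_divide)
  define g where "g y = chirp (u / v) y * f y" for y
  have [measurable]: "g \<in> borel_measurable borel" unfolding g_def[abs_def] by measurable
  have "flow \<tau> f = (\<lambda>x. of_real (v powr (DIM('a) / 4)) * g (sqrt v *\<^sub>R x))"
    using v by (simp add: fun_eq_iff flow_def g_def chirp_scaleR sqrt flip: u_def v_def)
  then have "ft (flow \<tau> f) \<xi> = of_real (v powr (DIM('a) / 4) * (1 / \<bar>sqrt v\<bar> ^ DIM('a))) * ft g ((1 / sqrt v) *\<^sub>R \<xi>)"
    using v ft_scaleR[of g "sqrt v" \<xi>] by (simp add: ft_cmult)
  \<comment> \<open>With d the dimension, both sides equal v powr (- d / 4).\<close>
  also have "v powr (DIM('a) / 4) * (1 / \<bar>sqrt v\<bar> ^ DIM('a)) = (v / r\<^sup>2) powr (DIM('a) / 4) * (v / r) powr (- (DIM('a) / 2))"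
  proof -
    have "\<bar>sqrt v\<bar> ^ DIM('a) = v powr (DIM('a) / 2)"
      using v by (simp add: powr_realpow[symmetric] powr_half_sqrt[symmetric] powr_powr)
    moreover have "(r\<^sup>2) powr (DIM('a) / 4) = r powr (DIM('a) / 2)"
      using r by (simp add: powr_powr flip: powr_numeral)
    moreover have "v powr (DIM('a) / 2) = v powr (DIM('a) / 4) * v powr (DIM('a) / 4)"
      by (simp flip: powr_add)
    ultimately show ?thesis
      using v r by (simp add: powr_divide powr_minus divide_simps)
  qed
  also have "1 / sqrt v = r / v * (sqrt v / r)"
    using v r by (simp add: field_simps)
  \<comment> \<open>The inserted chirps cancel, as - u / r^2 + (u / v) (v / r^2) = 0. They are the
    chirp of \<open>flow (- 1 / tau)\<close> and the outer chirp of \<open>weil\<close>.\<close>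
  also have "ft g ((r / v * (sqrt v / r)) *\<^sub>R \<xi>)
      = chirp (- u / r\<^sup>2) \<xi> * chirp (u / v) ((sqrt v / r) *\<^sub>R \<xi>) * ft g ((r / v * (sqrt v / r)) *\<^sub>R \<xi>)"
    using v r by (simp add: chirp_scaleR power_divide flip: chirp_add)
  also have "of_real ((v / r\<^sup>2) powr (DIM('a) / 4) * (v / r) powr (- (DIM('a) / 2))) * \<dots> = flow (- 1 / \<tau>) (weil (Arg \<tau>) f) \<xi>"
    unfolding flow_def Re_Im_minus_inverse u_def[symmetric] v_def[symmetric] r_def[symmetric] sqrt
    using v r by (simp add: weil_def trig cot g_def[abs_def] mult_ac)
  finally show ?thesis .
qed

definition theta :: "('a \<Rightarrow> complex) \<Rightarrow> complex \<Rightarrow> real \<Rightarrow> 'a \<Rightarrow> 'a \<Rightarrow> complex" where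
  "theta f \<tau> \<phi> l \<mu> = (\<Sum>\<^sub>\<infinity>w\<in>int_lattice. echar (form w \<mu>) * flow \<tau> (weil \<phi> f) (w + l))"

lemma theta_inversion:
  assumes \<tau>: "Im \<tau> > 0"
  shows "\<exists>\<kappa>. norm \<kappa> = 1 \<and> (\<forall>f. poly_schwartz f \<longrightarrow>
     theta f \<tau> \<phi> l \<mu> = \<kappa> * theta f (- 1 / \<tau>) (\<phi> + Arg \<tau>) (- \<mu>) l)"
proof -
  have "\<tau> \<noteq> 0" using \<tau> by auto
  \<comment> \<open>This is the regularity of the outer angle that \<open>weil_comp\<close> asks
    for.\<close>
  then have "sin (Arg \<tau>) \<noteq> 0" using \<tau> sin_cos_Arg(1)[of \<tau>] by simp
  then obtain \<kappa> where \<kappa>: "norm \<kappa> = 1"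
    "\<And>f x. poly_schwartz f \<Longrightarrow> weil (Arg \<tau>) (weil \<phi> f) x = \<kappa> * weil (Arg \<tau> + \<phi>) f x"
    using weil_comp[of "Arg \<tau>" \<phi>] by blast
  have \<tau>': "Im (- 1 / \<tau>) > 0" using \<tau> \<open>\<tau> \<noteq> 0\<close> unfolding Re_Im_minus_inverse by simp
  have "theta f \<tau> \<phi> l \<mu> = (echar (- form l \<mu>) * \<kappa>) * theta f (- 1 / \<tau>) (\<phi> + Arg \<tau>) (- \<mu>) l"
    if f: "poly_schwartz f" for f
  proof -
    have dec: "decaying (flow \<tau> (weil \<phi> f))"
      by (intro flow_decaying weil_decaying \<tau> f)
    have ft: "ft (flow \<tau> (weil \<phi> f)) = (\<lambda>\<xi>. \<kappa> * flow (- 1 / \<tau>) (weil (\<phi> + Arg \<tau>) f) \<xi>)"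
    proof
      fix \<xi>
      have "weil (Arg \<tau>) (weil \<phi> f) = (\<lambda>x. \<kappa> * weil (\<phi> + Arg \<tau>) f x)"
        using \<kappa>(2)[OF f] by (auto simp: add.commute)
      then show "ft (flow \<tau> (weil \<phi> f)) \<xi> = \<kappa> * flow (- 1 / \<tau>) (weil (\<phi> + Arg \<tau>) f) \<xi>"
        using ft_flow[OF \<tau> decaying_measurable[OF weil_decaying[OF f]], of \<phi> \<xi>] by (simp only: flow_cmult)
    qed
    have dft: "decaying (ft (flow \<tau> (weil \<phi> f)))"
      unfolding ft by (intro decaying_cmult flow_decaying weil_decaying \<tau>' f)
    have "theta f \<tau> \<phi> l \<mu> = echar (- form l \<mu>) * (\<Sum>\<^sub>\<infinity>k\<in>int_lattice. \<kappa> * (echar (form k l) * flow (- 1 / \<tau>) (weil (\<phi> + Arg \<tau>) f) (k + - \<mu>)))"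
      unfolding theta_def poisson_twisted[OF dec dft] unfolding ft by (simp add: mult_ac)
    also have "\<dots> = echar (- form l \<mu>) * (\<kappa> * theta f (- 1 / \<tau>) (\<phi> + Arg \<tau>) (- \<mu>) l)"
      unfolding theta_def infsum_cmult_right' ..
    finally show ?thesis by (simp only: mult.assoc)
  qed
  moreover have "norm (echar (- form l \<mu>) * \<kappa>) = 1" using \<kappa>(1) by (simp add: norm_mult)
  ultimately show ?thesis by blast
qed

text \<open>Shifting tau by 2 instead of 1 adds the whole form at w + l rather than half of it, so
  that integrality of \<open>form w w\<close> is enough even when its values are odd. The term - 2 l
  in the second argument removes the cross term.\<close>

lemma theta_translation:
  assumes s: "s \<in> int_lattice"
  shows "\<exists>\<kappa>. norm \<kappa> = 1 \<and> (\<forall>f. theta f (\<tau> + 2) \<phi> l (s - 2 *\<^sub>R l + \<mu>) = \<kappa> * theta f \<tau> \<phi> l \<mu>)"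
proof (intro exI conjI allI)
  fix f :: "'a \<Rightarrow> complex"
  have "echar (form w (s - 2 *\<^sub>R l + \<mu>)) * flow (\<tau> + 2) (weil \<phi> f) (w + l)
      = echar (form l l) * (echar (form w \<mu>) * flow \<tau> (weil \<phi> f) (w + l))" if w: "w \<in> int_lattice" for w
  proof -
    have "form w (s - 2 *\<^sub>R l + \<mu>) + (Re \<tau> + 2) * form (w + l) (w + l) / 2
        = (form w s + form w w) + (form l l + form w \<mu> + Re \<tau> * form (w + l) (w + l) / 2)"
      by (simp add: form_simps form_commute[of l w] field_simps)
    then have "echar (form w (s - 2 *\<^sub>R l + \<mu>)) * chirp (Re \<tau> + 2) (w + l)
        = echar (form w s + form w w) * (echar (form l l) * echar (form w \<mu>) * chirp (Re \<tau>) (w + l))"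
      by (simp only: chirp_def echar_add[symmetric])
    also have "echar (form w s + form w w) = 1"
      using w s by (intro echar_Ints Ints_add form_lattice)
    finally show ?thesis by (simp add: flow_def mult_ac)
  qed
  then show "theta f (\<tau> + 2) \<phi> l (s - 2 *\<^sub>R l + \<mu>) = echar (form l l) * theta f \<tau> \<phi> l \<mu>"
    unfolding theta_def infsum_cmult_right'[symmetric] by (rule infsum_cong)
qed simp

lemma theta_shift:
  assumes l0: "l0 \<in> int_lattice" and \<mu>0: "\<mu>0 \<in> int_lattice"
  shows "\<exists>\<kappa>. norm \<kappa> = 1 \<and> (\<forall>f. theta f \<tau> \<phi> (l + l0) (\<mu> + \<mu>0) = \<kappa> * theta f \<tau> \<phi> l \<mu>)"
proof (intro exI conjI allI)
  fix f :: "'a \<Rightarrow> complex"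
  have "theta f \<tau> \<phi> (l + l0) (\<mu> + \<mu>0)
      = (\<Sum>\<^sub>\<infinity>w\<in>int_lattice. echar (form (w - l0) (\<mu> + \<mu>0)) * flow \<tau> (weil \<phi> f) (w + l))"
    unfolding theta_def
    by (rule infsum_reindex_bij_witness[where i = "\<lambda>w. w - l0" and j = "\<lambda>w. w + l0"])
      (auto intro: int_lattice_closed l0 simp: add_ac)
  also have "\<dots> = (\<Sum>\<^sub>\<infinity>w\<in>int_lattice. echar (- form l0 (\<mu> + \<mu>0)) * (echar (form w \<mu>) * flow \<tau> (weil \<phi> f) (w + l)))"
  proof (rule infsum_cong)
    fix w :: 'a assume w: "w \<in> int_lattice"
    have "form (w - l0) (\<mu> + \<mu>0) = form w \<mu>0 + (- form l0 (\<mu> + \<mu>0) + form w \<mu>)"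
      by (simp add: form_simps)
    then have "echar (form (w - l0) (\<mu> + \<mu>0)) = echar (form w \<mu>0) * (echar (- form l0 (\<mu> + \<mu>0)) * echar (form w \<mu>))"
      by (simp only: echar_add)
    also have "echar (form w \<mu>0) = 1" by (intro echar_Ints form_lattice w \<mu>0)
    finally show "echar (form (w - l0) (\<mu> + \<mu>0)) * flow \<tau> (weil \<phi> f) (w + l)
        = echar (- form l0 (\<mu> + \<mu>0)) * (echar (form w \<mu>) * flow \<tau> (weil \<phi> f) (w + l))" by simp
  qed
  also have "\<dots> = echar (- form l0 (\<mu> + \<mu>0)) * theta f \<tau> \<phi> l \<mu>"
    unfolding theta_def by (rule infsum_cmult_right')
  finally show "theta f \<tau> \<phi> (l + l0) (\<mu> + \<mu>0) = echar (- form l0 (\<mu> + \<mu>0)) * theta f \<tau> \<phi> l \<mu>" .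
qed simp

end

section \<open>The Jacobi group\<close>

lemma inner_M_eq: "inner_M M x y = x \<bullet> (M ** y)"
  for M :: "real^'m^'m" and x y :: "real^'n^'m"
proof -
  have "inner_M M x y = (\<Sum>j\<in>UNIV. \<Sum>i\<in>UNIV. x $ i $ j * (M ** y) $ i $ j)"
    unfolding inner_M_def matrix_mul_assoc[symmetric]
    by (simp add: trace_def transpose_def matrix_matrix_mult_def[of "\<chi> i j. x $ j $ i"])
  also have "\<dots> = (\<Sum>i\<in>UNIV. \<Sum>j\<in>UNIV. x $ i $ j * (M ** y) $ i $ j)"
    by (rule sum.swap)
  also have "\<dots> = x \<bullet> (M ** y)"
    by (simp add: inner_vec_def)
  finally show ?thesis .
qed

lemma inner_M_commute:
  assumes "transpose M = M"
  shows "inner_M M x y = inner_M M y x"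
proof -
  have "inner_M M x y = trace (transpose (transpose x ** M ** y))"
    unfolding inner_M_def by (simp add: trace_def transpose_def)
  also have "\<dots> = inner_M M y x"
    by (simp add: inner_M_def matrix_transpose_mul assms matrix_mul_assoc)
  finally show ?thesis .
qed

text \<open>The form is a sum of values of the quadratic form of M over the columns of x.
  Nonnegativity lets the square of \<open>norm_M\<close> undo its square root.\<close>

lemma inner_M_nonneg:
  fixes M :: "real^'m^'m" and x :: "real^'n^'m"
  assumes "positive_definite M"
  shows "0 \<le> inner_M M x x"
proof -
  have "0 \<le> column j x \<bullet> (M *v column j x)" for j
    using assms unfolding positive_definite_def
    by (cases "column j x = 0") (auto simp: less_imp_le)
  then have "0 \<le> (\<Sum>j\<in>UNIV. column j x \<bullet> (M *v column j x))" by (intro sum_nonneg)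
  also have "\<dots> = (\<Sum>j\<in>UNIV. \<Sum>i\<in>UNIV. x $ i $ j * (M ** x) $ i $ j)"
    by (simp add: inner_vec_def column_def matrix_vector_mult_def matrix_matrix_mult_def)
  also have "\<dots> = (\<Sum>i\<in>UNIV. \<Sum>j\<in>UNIV. x $ i $ j * (M ** x) $ i $ j)"
    by (rule sum.swap)
  also have "\<dots> = inner_M M x x" by (simp add: inner_M_eq inner_vec_def)
  finally show ?thesis .
qed

lemma integral_matrices_eq: "integral_matrices = int_lattice"
  by (auto simp: integral_matrices_def int_lattice_def Basis_vec_def inner_axis)

lemma selfdual_form_matrix:
  fixes M :: "real^'m^'m"
  assumes "transpose M = M"
    and "(\<lambda>\<omega> :: real^'n^'m. M ** \<omega>) ` integral_matrices = integral_matrices"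
  shows "selfdual_form (\<lambda>\<omega> :: real^'n^'m. M ** \<omega>)"
proof (rule selfdual_form.intro)
  show "linear (\<lambda>\<omega> :: real^'n^'m. M ** \<omega>)"
    by (intro linearI) (simp_all add: matrix_matrix_mult_def vec_eq_iff sum_distrib_left distrib_left sum.distrib mult_ac)
  show "(M ** x) \<bullet> y = x \<bullet> (M ** y)" for x y :: "real^'n^'m"
    using inner_M_commute[OF assms(1), of x y] by (simp add: inner_M_eq inner_commute)
  show "(\<lambda>\<omega> :: real^'n^'m. M ** \<omega>) ` int_lattice = int_lattice"
    using assms(2) by (simp add: integral_matrices_eq)
qed

lemma rcong_2pi_iff: "[\<phi> = \<psi>] (rmod (2 * pi)) \<longleftrightarrow> sin \<phi> = sin \<psi> \<and> cos \<phi> = cos \<psi>"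
  unfolding rcong_altdef sin_cos_eq_iff[of \<psi> \<phi>] eq_commute[of "sin \<phi>"] eq_commute[of "cos \<phi>"]
  by (simp add: mult_ac)

lemma weil_R_eq:
  fixes M :: "real^'m^'m" and f :: "real^'n^'m \<Rightarrow> complex"
  assumes M: "positive_definite M" "transpose M = M" "unimodular M"
    and form: "selfdual_form (\<lambda>\<omega> :: real^'n^'m. M ** \<omega>)"
  shows "weil_R M \<phi> f x = selfdual_form.weil (\<lambda>\<omega>. M ** \<omega>) \<phi> f x"
proof -
  interpret selfdual_form "\<lambda>\<omega> :: real^'n^'m. M ** \<omega>" by (rule form)
  have form_eq: "form x y = inner_M M x y" for x y :: "real^'n^'m"
    by (simp add: form_def selfadjoint inner_M_eq)
  show ?thesis
  proof (cases "sin \<phi> = 0")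
    case True
    then show ?thesis
      using sin_zero_abs_cos_one[OF True]
      by (auto simp: weil_def weil_R_def rcong_2pi_iff abs_if split: if_splits)
  next
    case False
    \<comment> \<open>The sign is left open: under the convention for \<open>powr\<close>, both
      determinants give the factor 1.\<close>
    have "det M = 1 \<or> det M = -1" using M(3) by (auto simp: unimodular_def abs_if split: if_splits)
    then have det: "det M powr (real CARD('n) / 2) = 1" by (auto simp: powr_def ln_minus)
    have "exp (pi * \<i> * of_real ((((norm_M M x)\<^sup>2 + (norm_M M y)\<^sup>2) * cos \<phi> - 2 * inner_M M x y) / sin \<phi>))
        = chirp (cot \<phi>) x * (echar (- form ((1 / sin \<phi>) *\<^sub>R x) y) * chirp (cot \<phi>) y)" for y
    proof -
      have "(((norm_M M x)\<^sup>2 + (norm_M M y)\<^sup>2) * cos \<phi> - 2 * inner_M M x y) / sin \<phi>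
          = 2 * (cot \<phi> * form x x / 2 + (- form ((1 / sin \<phi>) *\<^sub>R x) y + cot \<phi> * form y y / 2))"
        using inner_M_nonneg[OF M(1), of x] inner_M_nonneg[OF M(1), of y] False
        by (simp add: norm_M_def form_simps form_eq[of x x] form_eq[of y y] form_eq[of x y] cot_def field_simps)
      then show ?thesis
        unfolding chirp_def echar_add[symmetric]
        by (simp add: echar_def cis_conv_exp mult_ac)
    qed
    then show ?thesis
      using False
      unfolding weil_R_def rcong_2pi_iff weil_def ft_def det
      by (simp add: mult.assoc)
  qed
qed

lemma theta_sum_eq:
  fixes M :: "real^'m^'m" and f :: "real^'n^'m \<Rightarrow> complex"
  assumes M: "positive_definite M" "transpose M = M" "unimodular M"
    and form: "selfdual_form (\<lambda>\<omega> :: real^'n^'m. M ** \<omega>)"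
  shows "theta_sum M f \<tau> \<phi> l \<mu> = selfdual_form.theta (\<lambda>\<omega>. M ** \<omega>) f \<tau> \<phi> l \<mu>"
proof -
  interpret selfdual_form "\<lambda>\<omega> :: real^'n^'m. M ** \<omega>" by (rule form)
  have form_eq: "form x y = inner_M M x y" for x y :: "real^'n^'m"
    by (simp add: form_def selfadjoint inner_M_eq)
  have "exp (pi * \<i> * of_real (Re \<tau> * (norm_M M (w + l))\<^sup>2 + 2 * inner_M M w \<mu>)) = echar (form w \<mu>) * chirp (Re \<tau>) (w + l)" for w
  proof -
    have "Re \<tau> * (norm_M M (w + l))\<^sup>2 + 2 * inner_M M w \<mu> = 2 * (form w \<mu> + Re \<tau> * form (w + l) (w + l) / 2)"
      using inner_M_nonneg[OF M(1), of "w + l"] by (simp add: norm_M_def form_eq)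
    then show ?thesis
      unfolding chirp_def echar_add[symmetric] by (simp add: echar_def cis_conv_exp mult_ac)
  qed
  then show ?thesis
    unfolding theta_sum_def theta_def integral_matrices_eq infsum_cmult_right'[symmetric]
    by (intro infsum_cong) (simp add: flow_def weil_R_eq[OF M form] mult_ac)
qed

section \<open>Group coordinates and the action of the generators\<close>

lemma jacobi_coord_eq:
  "jacobi_coord (\<tau>, \<phi>, l, mu) = (sl2_coord \<tau> \<phi>, right_act (l, mu) (sl2_coord \<tau> \<phi>))"
  by (simp add: jacobi_coord_def jacobi_group_def flip: zero_prod_def)

text \<open>The action of S can move phi out of [0, 2 pi), the range in which
  \<open>on_group\<close> inverts the coordinates. Dependence on phi through sine and cosine alone
  removes the discrepancy.\<close>

lemma on_group_jacobi_coord: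
  fixes F :: "complex \<Rightarrow> real \<Rightarrow> real^'n^'m \<Rightarrow> real^'n^'m \<Rightarrow> complex"
  assumes \<tau>: "Im \<tau> > 0"
    and periodic: "\<And>\<phi> \<psi>. sin \<phi> = sin \<psi> \<Longrightarrow> cos \<phi> = cos \<psi> \<Longrightarrow> F \<tau> \<phi> l mu = F \<tau> \<psi> l mu"
  shows "on_group F (jacobi_coord (\<tau>, \<phi>, l, mu)) = F \<tau> \<phi> l mu"
proof -
  define \<psi> where "\<psi> = \<phi> rmod (2 * pi)"
  have "[\<psi> = \<phi>] (rmod (2 * pi))" by (simp add: \<psi>_def rcong_def)
  then have sc: "sin \<psi> = sin \<phi>" "cos \<psi> = cos \<phi>" by (simp_all add: rcong_2pi_iff)
  have dom: "(\<tau>, \<psi>, l, mu) \<in> coord_domain"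
    using \<tau> by (simp add: coord_domain_def \<psi>_def rmod_nonneg rmod_less)
  have "jacobi_coord (\<tau>, \<phi>, l, mu) = jacobi_coord (\<tau>, \<psi>, l, mu)"
    by (simp add: jacobi_coord_eq sl2_coord_def sc)
  then have "inv_into coord_domain jacobi_coord (jacobi_coord (\<tau>, \<phi>, l, mu)) = (\<tau>, \<psi>, l, mu)"
    using inv_into_f_f[OF bij_betw_imp_inj_on[OF bij_betw_jacobi_coord] dom] by simp
  then show ?thesis using periodic[OF sc] by (simp add: on_group_def)
qed

text \<open>The new coordinates q are to satisfy q A = p + (l, mu); the first premise is this
  relation multiplied on the right by \<open>sl2_coord\<close>, the form in which translation parts
  occur in group elements.\<close>

lemma jacobi_mult_coord:
  assumes "right_act q (A ** sl2_coord \<tau> \<phi>) = right_act (p + (l, mu)) (sl2_coord \<tau> \<phi>)"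
    and "A ** sl2_coord \<tau> \<phi> = sl2_coord \<tau>' \<phi>'"
  shows "(A, p) \<otimes>\<^bsub>jacobi_group\<^esub> jacobi_coord (\<tau>, \<phi>, l, mu) = jacobi_coord (\<tau>', \<phi>', q)"
  using assms by (cases q) (simp add: jacobi_coord_eq jacobi_group_def right_act_add)

lemma sl2_coord_inversion:
  assumes \<tau>: "Im \<tau> > 0"
  shows "mat2 0 (-1) 1 0 ** sl2_coord \<tau> \<phi> = sl2_coord (- 1 / \<tau>) (\<phi> + Arg \<tau>)"
proof -
  define u v r where "u = Re \<tau>" and "v = Im \<tau>" and "r = norm \<tau>"
  define s where "s = sqrt v"
  have v: "v > 0" using \<tau> by (simp add: v_def)
  have r: "r > 0" using \<tau> by (auto simp: r_def)
  have s: "s > 0" "v = s * s" using v by (simp_all add: s_def)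
  have r2: "r * r = u * u + v * v" by (simp add: r_def u_def v_def cmod_def power2_eq_square)
  have trig: "sin (Arg \<tau>) = v / r" "cos (Arg \<tau>) = u / r"
    using sin_cos_Arg[of \<tau>] r by (auto simp: u_def v_def r_def)
  have half: "t powr (1/2) = sqrt t" "t powr (-1/2) = 1 / sqrt t" if "t > 0" for t
    using that powr_minus_divide[of t "1/2"] by (simp_all add: powr_half_sqrt)
  have "sqrt (v / r\<^sup>2) = s / r" using r by (simp add: real_sqrt_divide s_def)
  moreover have "v / r\<^sup>2 > 0" using v r by simp
  ultimately have p: "v powr (1/2) = s" "v powr (-1/2) = 1 / s" "(v / r\<^sup>2) powr (1/2) = s / r" "(v / r\<^sup>2) powr (-1/2) = r / s"
    using half[OF v] half[of "v / r\<^sup>2"] by (simp_all add: s_def)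
  have e: "Re (- 1 / \<tau>) = - u / r\<^sup>2" "Im (- 1 / \<tau>) = v / r\<^sup>2"
    by (simp_all only: Re_Im_minus_inverse u_def v_def r_def)
  \<comment> \<open>Here n and c stand for sin phi and cos phi. Facts 1 and 2 compare the first
    rows, where u^2 + v^2 cancels r^2; fact 3 compares the second rows.\<close>
  have 1: "- (1 / s * n) = s / r * (c * (u / r) - n * (v / r)) + - u / r\<^sup>2 * (r / s * (n * (u / r) + c * (v / r)))" for c n
  proof -
    have "s / r * (c * (u / r) - n * (v / r)) + - u / r\<^sup>2 * (r / s * (n * (u / r) + c * (v / r)))
        = - (n * (u * u + v * v)) / (r * r * s)"
      using s(1) r unfolding s(2) by (simp add: field_simps power2_eq_square)
    then show ?thesis using r by (simp flip: r2)
  qed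
  have 2: "- (1 / s * c) = - (s / r * (n * (u / r) + c * (v / r))) + - u / r\<^sup>2 * (r / s * (c * (u / r) - n * (v / r)))" for c n
  proof -
    have "- (s / r * (n * (u / r) + c * (v / r))) + - u / r\<^sup>2 * (r / s * (c * (u / r) - n * (v / r)))
        = - (c * (u * u + v * v)) / (r * r * s)"
      using s(1) r unfolding s(2) by (simp add: field_simps power2_eq_square)
    then show ?thesis using r by (simp flip: r2)
  qed
  have 3: "s * c + u * (1 / s * n) = r / s * (n * (u / r) + c * (v / r))"
    "- (s * n) + u * (1 / s * c) = r / s * (c * (u / r) - n * (v / r))" for c n
    using s(1) r unfolding s(2) by (simp_all add: field_simps)
  have mult: "(mat2 0 (-1) 1 0 ** X) $ 1 $ 1 = - X $ 2 $ 1" "(mat2 0 (-1) 1 0 ** X) $ 1 $ 2 = - X $ 2 $ 2"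
    "(mat2 0 (-1) 1 0 ** X) $ 2 $ 1 = X $ 1 $ 1" "(mat2 0 (-1) 1 0 ** X) $ 2 $ 2 = X $ 1 $ 2" for X :: "real^2^2"
    by (simp_all add: matrix_matrix_mult_def sum_2)
  show ?thesis
    unfolding mat2_eq_iff mult sl2_coord_nth e sin_add cos_add trig u_def[symmetric] v_def[symmetric] p
    by (intro conjI 1 2 3)
qed

lemma sl2_coord_translation: "mat2 1 2 0 1 ** sl2_coord \<tau> \<phi> = sl2_coord (\<tau> + 2) \<phi>"
  by (simp add: mat2_eq_iff sl2_coord_nth matrix_matrix_mult_def sum_2 algebra_simps)

theorem theorem3p4:
  fixes M :: "real^'m^'m" and f g :: "real^'n^'m \<Rightarrow> complex"
    and \<gamma> h :: "('m, 'n) jacobi"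
  assumes "positive_definite M" and "transpose M = M" and "unimodular M"
    and "M \<in> integral_matrices"
    and "(\<lambda>\<omega> :: real^'n^'m. M ** \<omega>) ` integral_matrices = integral_matrices"
    and "schwartz f" and "schwartz g"
    and "\<gamma> \<in> jacobi_Gamma2" and "h \<in> carrier jacobi_group"
  shows "on_group (\<lambda>\<tau> \<phi> l mu. theta_sum M f \<tau> \<phi> l mu * cnj (theta_sum M g \<tau> \<phi> l mu))
           (\<gamma> \<otimes>\<^bsub>jacobi_group\<^esub> h)
       = on_group (\<lambda>\<tau> \<phi> l mu. theta_sum M f \<tau> \<phi> l mu * cnj (theta_sum M g \<tau> \<phi> l mu)) h"
proof -
  have form: "selfdual_form (\<lambda>\<omega> :: real^'n^'m. M ** \<omega>)"
    by (rule selfdual_form_matrix[OF assms(2,5)])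
  interpret selfdual_form "\<lambda>\<omega> :: real^'n^'m. M ** \<omega>" by (rule form)
  interpret J: group "jacobi_group :: ('m, 'n) jacobi monoid" by (rule group_jacobi_group)
  note theta_eq = theta_sum_eq[OF assms(1-3) form]
  have f: "poly_schwartz f" and g: "poly_schwartz g"
    using assms(6,7) by (auto intro: poly_schwartz.base)
  define F where "F = (\<lambda>\<tau> \<phi> l mu. theta_sum M f \<tau> \<phi> l mu * cnj (theta_sum M g \<tau> \<phi> l mu))"
  have F_eqI: "F \<tau> \<phi> l mu = F \<tau>' \<phi>' l' mu'"
    if inv: "\<exists>\<kappa>. norm \<kappa> = 1 \<and> (\<forall>f. poly_schwartz f \<longrightarrow> theta f \<tau> \<phi> l mu = \<kappa> * theta f \<tau>' \<phi>' l' mu')"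
    for \<tau> \<phi> l mu \<tau>' \<phi>' l' mu'
  proof -
    obtain \<kappa> where \<kappa>: "norm \<kappa> = 1" "theta f \<tau> \<phi> l mu = \<kappa> * theta f \<tau>' \<phi>' l' mu'"
      "theta g \<tau> \<phi> l mu = \<kappa> * theta g \<tau>' \<phi>' l' mu'"
      using inv f g by blast
    have "\<kappa> * cnj \<kappa> = 1" using \<kappa>(1) by (simp flip: complex_norm_square)
    then show ?thesis by (simp add: F_def theta_eq \<kappa>(2,3) algebra_simps)
  qed
  have coord: "on_group F (jacobi_coord (\<tau>, \<phi>, l, mu)) = F \<tau> \<phi> l mu" if "Im \<tau> > 0" for \<tau> \<phi> l mu
  proof (rule on_group_jacobi_coord[OF that])
    fix \<phi> \<psi> :: real assume "sin \<phi> = sin \<psi>" "cos \<phi> = cos \<psi>"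
    then have "weil \<phi> f = weil \<psi> f" for f by (auto simp: weil_def cot_def)
    then show "F \<tau> \<phi> l mu = F \<tau> \<psi> l mu" by (simp add: F_def theta_eq theta_def)
  qed
  have generators: "on_group F (\<gamma> \<otimes>\<^bsub>jacobi_group\<^esub> h) = on_group F h"
    if \<gamma>: "\<gamma> \<in> {(mat2 0 (-1) 1 0, (0, 0))}
      \<union> {(mat2 1 2 0 1, (0, s)) | s. s \<in> integral_matrices}
      \<union> {(mat 1, (l0, mu0)) | l0 mu0. l0 \<in> integral_matrices \<and> mu0 \<in> integral_matrices}"
      and h: "h \<in> carrier jacobi_group" for \<gamma> h :: "('m, 'n) jacobi"
  proof -
    obtain \<tau> \<phi> l mu where \<tau>: "Im \<tau> > 0" and h: "h = jacobi_coord (\<tau>, \<phi>, l, mu)"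
    proof -
      have "h \<in> jacobi_coord ` coord_domain" using bij_betw_jacobi_coord h by (auto simp: bij_betw_def)
      then show ?thesis using that by (auto simp: coord_domain_def)
    qed
    consider "\<gamma> = (mat2 0 (-1) 1 0, (0, 0))" | s where "s \<in> int_lattice" "\<gamma> = (mat2 1 2 0 1, (0, s))"
      | l0 mu0 where "l0 \<in> int_lattice" "mu0 \<in> int_lattice" "\<gamma> = (mat 1, (l0, mu0))"
      using \<gamma> unfolding integral_matrices_eq by blast
    then show ?thesis
    proof cases
      case 1
      have "\<tau> \<noteq> 0" using \<tau> by auto
      then have \<tau>': "Im (- 1 / \<tau>) > 0" using \<tau> unfolding Re_Im_minus_inverse by simp
      have "\<gamma> \<otimes>\<^bsub>jacobi_group\<^esub> h = jacobi_coord (- 1 / \<tau>, \<phi> + Arg \<tau>, - mu, l)"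
        unfolding 1 h
        by (rule jacobi_mult_coord[OF _ sl2_coord_inversion[OF \<tau>]])
          (simp add: right_act_def matrix_matrix_mult_def sum_2 flip: zero_prod_def)
      then show ?thesis
        using F_eqI[OF theta_inversion[OF \<tau>], of \<phi> l mu] by (simp only: h coord[OF \<tau>] coord[OF \<tau>'])
    next
      case (2 s)
      have \<tau>': "Im (\<tau> + 2) > 0" using \<tau> by simp
      have "\<gamma> \<otimes>\<^bsub>jacobi_group\<^esub> h = jacobi_coord (\<tau> + 2, \<phi>, l, s - 2 *\<^sub>R l + mu)"
        unfolding 2(2) h
        by (rule jacobi_mult_coord[OF _ sl2_coord_translation])
          (simp add: right_act_def matrix_matrix_mult_def sum_2 algebra_simps flip: zero_prod_def)
      then show ?thesis
        using F_eqI[of "\<tau> + 2" \<phi> l "s - 2 *\<^sub>R l + mu" \<tau> \<phi> l mu] theta_translation[OF 2(1), of \<tau> \<phi> l mu]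
        by (auto simp: h coord[OF \<tau>] coord[OF \<tau>'])
    next
      case (3 l0 mu0)
      have "\<gamma> \<otimes>\<^bsub>jacobi_group\<^esub> h = jacobi_coord (\<tau>, \<phi>, l + l0, mu + mu0)"
        unfolding 3(3) h
        by (rule jacobi_mult_coord) (simp_all add: matrix_mul_lid add.commute)
      then show ?thesis
        using F_eqI[of \<tau> \<phi> "l + l0" "mu + mu0" \<tau> \<phi> l mu] theta_shift[OF 3(1,2), of \<tau> \<phi> l mu]
        by (auto simp: h coord[OF \<tau>])
    qed
  qed
  have Gamma_carrier: "jacobi_Gamma \<subseteq> carrier (jacobi_group :: ('m, 'n) jacobi monoid)"
    by (rule subgroup.subset[OF subgroup_jacobi_Gamma])
  have gens_Gamma: "{(mat2 0 (-1) 1 0, (0, 0))}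
      \<union> {(mat2 1 2 0 1, (0, s)) | s. s \<in> integral_matrices}
      \<union> {(mat 1, (l0, mu0)) | l0 mu0. l0 \<in> integral_matrices \<and> mu0 \<in> integral_matrices}
      \<subseteq> (jacobi_Gamma :: ('m, 'n) jacobi set)"
    by (auto simp: jacobi_Gamma_def integral_matrices_def det_2 forall_2 mat_def)
  \<comment> \<open>Membership in \<open>jacobi_Gamma\<close> is carried along because
    \<open>generate\<close> works in the monoid with restricted carrier: it identifies inverses
    there with inverses in the full group and licenses associativity.\<close>
  have "\<gamma> \<in> jacobi_Gamma \<and> (\<forall>h\<in>carrier jacobi_group. on_group F (\<gamma> \<otimes>\<^bsub>jacobi_group\<^esub> h) = on_group F h)"
    using assms(8) unfolding jacobi_Gamma2_def
  proof (induction rule: generate.induct)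
    case one
    then show ?case
      using subgroup.one_closed[OF subgroup_jacobi_Gamma] by auto
  next
    case (incl \<gamma>)
    then show ?case using gens_Gamma generators by blast
  next
    case (inv \<gamma>)
    then have \<gamma>: "\<gamma> \<in> jacobi_Gamma" using gens_Gamma by blast
    then have \<gamma>': "\<gamma> \<in> carrier jacobi_group" using Gamma_carrier by blast
    \<comment> \<open>Invariance under the generator itself, applied at the point inv gamma times
      h.\<close>
    have "on_group F (inv\<^bsub>jacobi_group\<^esub> \<gamma> \<otimes>\<^bsub>jacobi_group\<^esub> h) = on_group F h"
      if h: "h \<in> carrier jacobi_group" for h
      using generators[OF inv, of "inv\<^bsub>jacobi_group\<^esub> \<gamma> \<otimes>\<^bsub>jacobi_group\<^esub> h"] h \<gamma>'
      by (simp add: J.m_assoc[symmetric])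
    then show ?case
      using \<gamma> subgroup.m_inv_closed[OF subgroup_jacobi_Gamma \<gamma>]
      by (simp add: J.m_inv_consistent[OF subgroup_jacobi_Gamma])
  next
    case (eng \<gamma>1 \<gamma>2)
    then have "\<gamma>1 \<in> carrier jacobi_group" "\<gamma>2 \<in> carrier jacobi_group"
      using Gamma_carrier by blast+
    then show ?case
      using eng.IH subgroup.m_closed[OF subgroup_jacobi_Gamma, of \<gamma>1 \<gamma>2] by (simp add: J.m_assoc)
  qed
  then show ?thesis using assms(9) by (simp add: F_def)
qed

end
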